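(* (1) Let $G_1$ and $G_2$ be finitely generated groups. If both $G_1$ and $G_2$ satisfy the Chen ranks formula, then the direct product $G_1\times G_2$ also satisfies the Chen ranks formula. (2) There exist finitely generated groups $G_1$ and $G_2$ which both satisfy the Chen ranks formula, but whose free product $G_1*G_2$ does not satisfy the Chen ranks formula.
   Context: For a finitely generated group $G$, the Chen ranks are $\theta_k(G)=\dim_{\mathbb{C}}\mathrm{gr}_k(G/G'')$, where $\mathrm{gr}_k(K)=(\Gamma_kK/\Gamma_{k+1}K)\otimes\mathbb{C}$ for the lower central series $\Gamma_1K=K$, $\Gamma_{k+1}K=[\Gamma_kK,K]$. The (degree $1$, depth $1$) resonance variety $\mathcal{R}^1_1(G)\subset H^1(G;\mathbb{C})$ is the algebraic set of those $a\in H^1(G;\mathbb{C})$ such that $\dim H^1(A,a)\ge1$, where $A=H^*(G;\mathbb{C})$ and $(A,a)$ is the cochain complex $A^0\to A^1\to A^2\to\cdots$ with differentials $u\mapsto a\cdot u$. Let $h_m(G)$ be the number of $m$-dimensional irreducible components of $\mathcal{R}^1_1(G)$, and let $F_m$ be the free group of rank $m$. The group $G$ is said to satisfy the Chen ranks formula if $\theta_k(G)=\sum_{m\ge2}h_m(G)\cdot\theta_k(F_m)$ for all sufficiently large $k$. *)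

theory Defs
  imports
    "HOL-Algebra.Generated_Groups"
    "HOL-Library.Function_Algebras"
    "HOL-Library.Extended_Nat"
begin

section \<open>Quotients of spaces of complex-valued functions\<close>

definition cscale :: "complex \<Rightarrow> ('x \<Rightarrow> complex) \<Rightarrow> 'x \<Rightarrow> complex" where
  "cscale c f = (\<lambda>x. c * f x)"

global_interpretation cfun: vector_space "cscale :: complex \<Rightarrow> ('x \<Rightarrow> complex) \<Rightarrow> 'x \<Rightarrow> complex"
  by unfold_locales (auto simp: cscale_def fun_eq_iff algebra_simps)

text \<open>For subspaces \<open>W \<subseteq> V\<close>: a finite set of vectors of \<open>V\<close> whose classes form a basis of \<open>V/W\<close>.
  As for the library's \<open>dim\<close>, the dimension is 0 if \<open>V/W\<close> is infinite-dimensional.\<close>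

definition quotient_basis :: "('x \<Rightarrow> complex) set \<Rightarrow> ('x \<Rightarrow> complex) set \<Rightarrow> ('x \<Rightarrow> complex) set \<Rightarrow> bool" where
  "quotient_basis V W B \<longleftrightarrow>
     finite B \<and> B \<subseteq> V \<and> V \<subseteq> cfun.span (B \<union> W) \<and>
     (\<forall>c. (\<Sum>b\<in>B. cscale (c b) b) \<in> W \<longrightarrow> (\<forall>b\<in>B. c b = 0))"

definition quotient_dim :: "('x \<Rightarrow> complex) set \<Rightarrow> ('x \<Rightarrow> complex) set \<Rightarrow> nat" where
  "quotient_dim V W =
     (if \<exists>B. quotient_basis V W B then card (SOME B. quotient_basis V W B) else 0)"


section \<open>Chen ranks\<close>

definition finitely_generated_group :: "('a, 'b) monoid_scheme \<Rightarrow> bool" where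
  "finitely_generated_group G \<longleftrightarrow>
     group G \<and> (\<exists>S. finite S \<and> S \<subseteq> carrier G \<and> generate G S = carrier G)"

definition commutator_subgroup :: "('a, 'b) monoid_scheme \<Rightarrow> 'a set \<Rightarrow> 'a set \<Rightarrow> 'a set" where
  "commutator_subgroup G H K =
     generate G (\<Union>h\<in>H. \<Union>k\<in>K. {h \<otimes>\<^bsub>G\<^esub> k \<otimes>\<^bsub>G\<^esub> inv\<^bsub>G\<^esub> h \<otimes>\<^bsub>G\<^esub> inv\<^bsub>G\<^esub> k})"

text \<open>Indexed from 1; the value at 0 is a dummy.\<close>

fun lower_central :: "('a, 'b) monoid_scheme \<Rightarrow> nat \<Rightarrow> 'a set" where
  "lower_central K 0 = carrier K"
| "lower_central K (Suc 0) = carrier K"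
| "lower_central K (Suc (Suc k)) =
     commutator_subgroup K (lower_central K (Suc k)) (carrier K)"

definition delta :: "'x \<Rightarrow> 'x \<Rightarrow> complex" where
  "delta x = (\<lambda>y. if y = x then 1 else 0)"

text \<open>The dimension of \<open>A \<otimes>\<^sub>\<int> \<complex>\<close> for an abelian group \<open>A\<close> in multiplicative notation. The tensor
  product is the complex vector space with generators \<open>x \<otimes> 1\<close> for \<open>x\<close> in \<open>A\<close>, here \<^term>\<open>delta x\<close>,
  subject to additivity in \<open>x\<close>.\<close>

definition complexification_dim :: "('a, 'b) monoid_scheme \<Rightarrow> nat" where
  "complexification_dim A =
     quotient_dim
       (cfun.span (delta ` carrier A))
       (cfun.span {delta (x \<otimes>\<^bsub>A\<^esub> y) - delta x - delta y | x y. x \<in> carrier A \<and> y \<in> carrier A})"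

definition gr_dim :: "('a, 'b) monoid_scheme \<Rightarrow> nat \<Rightarrow> nat" where
  "gr_dim K k =
     complexification_dim (K\<lparr>carrier := lower_central K k\<rparr> Mod lower_central K (Suc k))"

definition chen_rank :: "('a, 'b) monoid_scheme \<Rightarrow> nat \<Rightarrow> nat" where
  "chen_rank G k = gr_dim (G Mod derived G (derived G (carrier G))) k"


section \<open>Group cohomology with trivial complex coefficients\<close>

text \<open>The inhomogeneous bar complex: an \<open>n\<close>-cochain is a function on \<open>G\<^sup>n\<close>, encoded as a function
  on lists that vanishes off the lists of length \<open>n\<close> over \<open>G\<close>.\<close>

definition cochains :: "('a, 'b) monoid_scheme \<Rightarrow> nat \<Rightarrow> ('a list \<Rightarrow> complex) set" where
  "cochains G n = {f. \<forall>xs. f xs \<noteq> 0 \<longrightarrow> length xs = n \<and> set xs \<subseteq> carrier G}"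

definition coboundary ::
    "('a, 'b) monoid_scheme \<Rightarrow> nat \<Rightarrow> ('a list \<Rightarrow> complex) \<Rightarrow> 'a list \<Rightarrow> complex" where
  "coboundary G n f = (\<lambda>xs.
     if length xs = Suc n \<and> set xs \<subseteq> carrier G then
       f (tl xs)
       + (\<Sum>i<n. (-1) ^ Suc i *
            f (take i xs @ (xs ! i \<otimes>\<^bsub>G\<^esub> xs ! Suc i) # drop (Suc (Suc i)) xs))
       + (-1) ^ Suc n * f (butlast xs)
     else 0)"

definition cocycles :: "('a, 'b) monoid_scheme \<Rightarrow> nat \<Rightarrow> ('a list \<Rightarrow> complex) set" where
  "cocycles G n = {f \<in> cochains G n. coboundary G n f = 0}"

fun coboundaries :: "('a, 'b) monoid_scheme \<Rightarrow> nat \<Rightarrow> ('a list \<Rightarrow> complex) set" where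
  "coboundaries G 0 = {0}"
| "coboundaries G (Suc n) = coboundary G n ` cochains G n"

text \<open>The cup product of a \<open>p\<close>-cochain with a cochain of any degree.\<close>

definition cup ::
    "nat \<Rightarrow> ('a list \<Rightarrow> complex) \<Rightarrow> ('a list \<Rightarrow> complex) \<Rightarrow> 'a list \<Rightarrow> complex" where
  "cup p f g = (\<lambda>xs. f (take p xs) * g (drop p xs))"

text \<open>Since coefficients are trivial, \<open>B\<^sup>1 = 0\<close>, so \<open>H\<^sup>1 = Z\<^sup>1/B\<^sup>1\<close> is identified with \<open>Z\<^sup>1\<close>.\<close>

lemma coboundaries_1: "coboundaries G 1 = {0}"
proof -
  have "coboundary G 0 f = 0" for f :: "'a list \<Rightarrow> complex"
    by (auto simp: coboundary_def fun_eq_iff length_Suc_conv)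
  moreover have "0 \<in> cochains G 0"
    by (simp add: cochains_def)
  ultimately show ?thesis
    by auto
qed

definition H1 :: "('a, 'b) monoid_scheme \<Rightarrow> ('a list \<Rightarrow> complex) set" where
  "H1 G = cocycles G 1"


section \<open>The resonance variety\<close>

text \<open>For \<open>a\<close> in \<open>H\<^sup>1\<close>, multiplication by \<open>a\<close> makes \<open>A = H\<^sup>*(G; \<complex>)\<close> a cochain complex. Its cocycles
  and coboundaries in \<open>A\<^sup>n = Z\<^sup>n/B\<^sup>n\<close> are represented by their preimages in \<open>Z\<^sup>n\<close>.\<close>

definition aomoto_cocycles ::
    "('a, 'b) monoid_scheme \<Rightarrow> ('a list \<Rightarrow> complex) \<Rightarrow> nat \<Rightarrow> ('a list \<Rightarrow> complex) set" where
  "aomoto_cocycles G a n = {u \<in> cocycles G n. cup 1 a u \<in> coboundaries G (Suc n)}"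

fun aomoto_coboundaries ::
    "('a, 'b) monoid_scheme \<Rightarrow> ('a list \<Rightarrow> complex) \<Rightarrow> nat \<Rightarrow> ('a list \<Rightarrow> complex) set" where
  "aomoto_coboundaries G a 0 = coboundaries G 0"
| "aomoto_coboundaries G a (Suc n) =
     {cup 1 a v + w | v w. v \<in> cocycles G n \<and> w \<in> coboundaries G (Suc n)}"

definition aomoto_betti ::
    "('a, 'b) monoid_scheme \<Rightarrow> ('a list \<Rightarrow> complex) \<Rightarrow> nat \<Rightarrow> nat" where
  "aomoto_betti G a n = quotient_dim (aomoto_cocycles G a n) (aomoto_coboundaries G a n)"

definition resonance :: "('a, 'b) monoid_scheme \<Rightarrow> ('a list \<Rightarrow> complex) set" where
  "resonance G = {a \<in> H1 G. aomoto_betti G a 1 \<ge> 1}"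


section \<open>Zariski topology on a finite-dimensional subspace\<close>

text \<open>Polynomial functions on the ambient function space. Every linear functional on a subspace
  extends to the ambient space, so the restrictions of these functions to a finite-dimensional
  subspace \<open>V\<close> are exactly the polynomial functions on \<open>V\<close>.\<close>

inductive_set polynomial_functions :: "(('x \<Rightarrow> complex) \<Rightarrow> complex) set" where
  const: "(\<lambda>_. c) \<in> polynomial_functions"
| linear: "Vector_Spaces.linear cscale (*) \<phi> \<Longrightarrow> \<phi> \<in> polynomial_functions"
| add: "p \<in> polynomial_functions \<Longrightarrow> q \<in> polynomial_functions \<Longrightarrow>
    (\<lambda>v. p v + q v) \<in> polynomial_functions"
| mult: "p \<in> polynomial_functions \<Longrightarrow> q \<in> polynomial_functions \<Longrightarrow>
    (\<lambda>v. p v * q v) \<in> polynomial_functions"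

definition algebraic_set :: "('x \<Rightarrow> complex) set \<Rightarrow> ('x \<Rightarrow> complex) set \<Rightarrow> bool" where
  "algebraic_set V Z \<longleftrightarrow>
     (\<exists>P \<subseteq> polynomial_functions. Z = {v \<in> V. \<forall>p\<in>P. p v = 0})"

definition irreducible_set :: "('x \<Rightarrow> complex) set \<Rightarrow> ('x \<Rightarrow> complex) set \<Rightarrow> bool" where
  "irreducible_set V Z \<longleftrightarrow>
     algebraic_set V Z \<and> Z \<noteq> {} \<and>
     (\<forall>Z1 Z2. algebraic_set V Z1 \<and> algebraic_set V Z2 \<and> Z = Z1 \<union> Z2 \<longrightarrow> Z = Z1 \<or> Z = Z2)"

definition irreducible_components ::
    "('x \<Rightarrow> complex) set \<Rightarrow> ('x \<Rightarrow> complex) set \<Rightarrow> ('x \<Rightarrow> complex) set set" where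
  "irreducible_components V R =
     {Z. irreducible_set V Z \<and> Z \<subseteq> R \<and>
         (\<forall>Z'. irreducible_set V Z' \<and> Z \<subseteq> Z' \<and> Z' \<subseteq> R \<longrightarrow> Z' = Z)}"

text \<open>The Krull dimension.\<close>

definition zariski_dim :: "('x \<Rightarrow> complex) set \<Rightarrow> ('x \<Rightarrow> complex) set \<Rightarrow> enat" where
  "zariski_dim V Z =
     Sup {enat n | n. \<exists>C :: nat \<Rightarrow> ('x \<Rightarrow> complex) set.
       (\<forall>i\<le>n. irreducible_set V (C i) \<and> C i \<subseteq> Z) \<and> (\<forall>i<n. C i \<subset> C (Suc i))}"

definition resonance_count :: "('a, 'b) monoid_scheme \<Rightarrow> nat \<Rightarrow> nat" where
  "resonance_count G m =
     card {Z \<in> irreducible_components (H1 G) (resonance G). zariski_dim (H1 G) Z = enat m}"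


section \<open>Free groups and free products\<close>

text \<open>Words over the alphabet \<open>A\<close> modulo the congruence generated by the relations \<open>R\<close>, which are
  pairs of words over \<open>A\<close>.\<close>

definition word_step :: "'x set \<Rightarrow> ('x list \<times> 'x list) set \<Rightarrow> ('x list \<times> 'x list) set" where
  "word_step A R = {(p @ u @ q, p @ v @ q) | p q u v. p \<in> lists A \<and> q \<in> lists A \<and> (u, v) \<in> R}"

definition word_cong :: "'x set \<Rightarrow> ('x list \<times> 'x list) set \<Rightarrow> ('x list \<times> 'x list) set" where
  "word_cong A R = Restr ((word_step A R \<union> (word_step A R)\<inverse>)\<^sup>*) (lists A)"

definition presented_monoid :: "'x set \<Rightarrow> ('x list \<times> 'x list) set \<Rightarrow> 'x list set monoid" where
  "presented_monoid A R =
     \<lparr>carrier = lists A // word_cong A R,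
      mult = (\<lambda>X Y. \<Union>x\<in>X. \<Union>y\<in>Y. word_cong A R `` {x @ y}),
      one = word_cong A R `` {[]}\<rparr>"

text \<open>The letters \<open>(x, True)\<close> and \<open>(x, False)\<close> stand for \<open>x\<close> and its inverse.\<close>

definition free_group :: "'x set \<Rightarrow> ('x \<times> bool) list set monoid" where
  "free_group S =
     presented_monoid (S \<times> UNIV) {([(x, b), (x, \<not> b)], []) | x b. x \<in> S}"

definition free_product ::
    "('a, 'c) monoid_scheme \<Rightarrow> ('b, 'd) monoid_scheme \<Rightarrow> ('a + 'b) list set monoid" where
  "free_product G H =
     presented_monoid (Inl ` carrier G \<union> Inr ` carrier H)
       ({([Inl \<one>\<^bsub>G\<^esub>], []), ([Inr \<one>\<^bsub>H\<^esub>], [])}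
        \<union> {([Inl x, Inl y], [Inl (x \<otimes>\<^bsub>G\<^esub> y)]) | x y. x \<in> carrier G \<and> y \<in> carrier G}
        \<union> {([Inr x, Inr y], [Inr (x \<otimes>\<^bsub>H\<^esub> y)]) | x y. x \<in> carrier H \<and> y \<in> carrier H})"


section \<open>The Chen ranks formula\<close>

text \<open>A resonance variety has only finitely many components, so the formally infinite sum over
  \<open>m \<ge> 2\<close> is taken over the indices with a nonzero coefficient.\<close>

definition chen_ranks_formula :: "('a, 'b) monoid_scheme \<Rightarrow> bool" where
  "chen_ranks_formula G \<longleftrightarrow>
     (\<forall>\<^sub>F k in sequentially.
        chen_rank G k =
          (\<Sum>m | m \<ge> 2 \<and> resonance_count G m \<noteq> 0.
             resonance_count G m * chen_rank (free_group {..<m}) k))"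

end

theory Submission
  imports
    Defs
    "HOL-Computational_Algebra.Formal_Power_Series"
    "HOL-Library.Nat_Bijection"
    "Jordan_Normal_Form.Determinant"
begin

text \<open>
  The linear functionals on \<open>gr\<^sub>k(G/G'') \<otimes> \<complex>\<close> pull back to the additive functions on \<open>\<Gamma>\<^sub>k(G)\<close> that
  vanish on \<open>\<Gamma>\<^sub>k\<^sub>+\<^sub>1(G)\<close> and on \<open>\<Gamma>\<^sub>k(G) \<inter> G''\<close>. This description is contravariant in \<open>G\<close>, so the Chen
  ranks add up on direct products and decrease along surjections. A class \<open>a\<close> is resonant iff
  \<open>a \<cup> u = 0\<close> for some \<open>u\<close> outside the line of \<open>a\<close>; comparing the values on commuting pairs of elements
  shows that the resonance variety of \<open>G1 \<times> G2\<close> is the union of those of the factors, which meet at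
  the origin only. Its components are those of the factors, finite in number by Hilbert's basis
  theorem.

  For the free product take two copies of \<open>\<int>\<^sup>2\<close>, which satisfy the formula with both sides zero. Every
  class of \<open>\<int>\<^sup>2 * \<int>\<^sup>2\<close> is resonant, so the formula would equate its Chen ranks with those of a free
  group \<open>F\<^sub>m\<close>, where \<open>m \<ge> 4\<close> is the dimension of \<open>H\<^sup>1\<close> (or with 0, were the dimension infinite). But
  \<open>F\<^sub>m\<close> maps onto \<open>\<int>\<^sup>2 * \<int>\<^sup>2\<close> with \<open>[x, y]\<close> in the kernel, and \<open>[x, y, z, \<dots>, z]\<close> survives in all graded
  pieces of \<open>F\<^sub>m/F\<^sub>m''\<close>, as seen in a metabelian group of affine maps over \<open>\<complex>[[X]]\<close>. So the Chen ranks of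
  \<open>\<int>\<^sup>2 * \<int>\<^sup>2\<close> are strictly smaller. They are positive by the same argument.
\<close>

section \<open>Linear algebra of complex-valued functions\<close>

text \<open>\<open>quotient_dim\<close> is 0 on infinite-dimensional quotients, so finite generation
  has to become finite dimension before a Chen rank or a resonance condition can be read off; this
  is done by exhibiting finitely many points at which the functions in question are determined. The
  resonance variety is not closed by definition either: counting its components needs equations, and
  a determinant supplies one for each nonresonant class. The counterexample rests on what resonance
  sees, namely which cup products vanish. On a free product a class with both components nonzero is
  annihilated by either component, so resonance is as large as for a free group of the same first
  Betti number, while the relations inside the factors still shrink the graded pieces. Neither a
  Chen rank of a free group nor the exact dimension of \<open>H1\<close> of the free product is
  computed. The affine maps over C[[X]] record weight in the lower central series as order in X: a
  commutator with an element of linear part e^(tX) multiplies a translation by 1 - e^(tX), of order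
  one for nonzero t.\<close>

interpretation cfun_pair: vector_space_pair
  "cscale :: complex \<Rightarrow> ('x \<Rightarrow> complex) \<Rightarrow> 'x \<Rightarrow> complex"
  "cscale :: complex \<Rightarrow> ('y \<Rightarrow> complex) \<Rightarrow> 'y \<Rightarrow> complex"
  by unfold_locales

lemma vector_space_complex: "vector_space ((*) :: complex \<Rightarrow> complex \<Rightarrow> complex)"
  by unfold_locales (auto simp: algebra_simps)

interpretation cfun_dual: vector_space_pair
  "cscale :: complex \<Rightarrow> ('x \<Rightarrow> complex) \<Rightarrow> 'x \<Rightarrow> complex" "(*) :: complex \<Rightarrow> complex \<Rightarrow> complex"
  by (intro vector_space_pair.intro cfun.vector_space_axioms vector_space_complex)

text \<open>For scalar multiplication \<open>(*)\<close> this rule is the reverse of \<open>mult.assoc\<close>, and simp would loop.\<close>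

declare cfun_dual.vs2.scale_scale [simp del]

lemma cscale_apply [simp]: "cscale c f x = c * f x"
  by (simp add: cscale_def)

lemma sum_fun_apply: "(\<Sum>i\<in>A. f i) x = (\<Sum>i\<in>A. f i x)" for f :: "'i \<Rightarrow> 'x \<Rightarrow> complex"
  by (induction A rule: infinite_finite_induct) auto

lemma linear_cscaleI:
  assumes "\<And>f g. L (f + g) = L f + L g" and "\<And>c f. L (cscale c f) = cscale c (L f)"
  shows "Vector_Spaces.linear cscale cscale L"
  unfolding Vector_Spaces.linear_iff by (intro conjI allI cfun.vector_space_axioms assms)

lemma linear_functionalI:
  assumes "\<And>f g. L (f + g) = L f + L g" and "\<And>c f. L (cscale c f) = c * L f"
  shows "Vector_Spaces.linear cscale (*) L"
  unfolding Vector_Spaces.linear_iff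
  by (intro conjI allI cfun.vector_space_axioms vector_space_complex assms)

text \<open>The functions \<open>\<phi> t\<close> form the basis of \<open>D\<close> dual to the evaluations at the points of \<open>T\<close>.\<close>

definition dual_points :: "('x \<Rightarrow> complex) set \<Rightarrow> 'x set \<Rightarrow> ('x \<Rightarrow> 'x \<Rightarrow> complex) \<Rightarrow> bool" where
  "dual_points D T \<phi> \<longleftrightarrow> finite T \<and> (\<forall>t\<in>T. \<phi> t \<in> D \<and> (\<forall>s\<in>T. \<phi> t s = (if s = t then 1 else 0)))
     \<and> (\<forall>f\<in>D. (\<forall>t\<in>T. f t = 0) \<longrightarrow> f = 0)"

text \<open>Take a determining subset of least cardinality. Dropping a point t from it leaves a
  nonzero function of D that vanishes at the other points; it is nonzero at t and can be normalised
  there.\<close>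

lemma dual_points_exist:
  assumes D: "cfun.subspace D" and T: "finite T"
    and det: "\<And>f. f \<in> D \<Longrightarrow> (\<And>t. t \<in> T \<Longrightarrow> f t = 0) \<Longrightarrow> f = 0"
  obtains T' \<phi> where "T' \<subseteq> T" "dual_points D T' \<phi>"
proof -
  define P where "P S \<longleftrightarrow> S \<subseteq> T \<and> (\<forall>f\<in>D. (\<forall>t\<in>S. f t = 0) \<longrightarrow> f = 0)" for S
  have "P T" using det by (auto simp: P_def)
  then obtain S where S: "P S" and min: "\<And>S'. P S' \<Longrightarrow> card S \<le> card S'"
    using ex_has_least_nat[of P T card] by auto
  have finS: "finite S" using S T finite_subset by (auto simp: P_def)
  have "\<exists>f\<in>D. \<forall>s\<in>S. f s = (if s = t then 1 else 0)" if t: "t \<in> S" for t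
  proof -
    have "\<not> P (S - {t})"
      using min[of "S - {t}"] t finS card_Diff1_less[of S t] by (auto simp del: card_Diff_insert)
    then obtain f where f: "f \<in> D" "\<forall>s\<in>S - {t}. f s = 0" "f \<noteq> 0"
      using S by (auto simp: P_def)
    have "f t \<noteq> 0" using f S by (auto simp: P_def)
    moreover have "cscale (1 / f t) f \<in> D" using f D cfun.subspace_scale by blast
    ultimately show ?thesis using f by (intro bexI[of _ "cscale (1 / f t) f"]) auto
  qed
  then obtain \<phi> where "\<forall>t\<in>S. \<phi> t \<in> D \<and> (\<forall>s\<in>S. \<phi> t s = (if s = t then 1 else 0))"
    by metis
  with S finS have "dual_points D S \<phi>" by (auto simp: dual_points_def P_def)
  with S that show thesis by (auto simp: P_def)
qed

lemma dual_points_expand: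
  assumes "cfun.subspace D" "dual_points D T \<phi>" "f \<in> D"
  shows "f = (\<Sum>t\<in>T. cscale (f t) (\<phi> t))"
proof -
  let ?g = "f - (\<Sum>t\<in>T. cscale (f t) (\<phi> t))"
  have "?g \<in> D"
    using assms by (intro cfun.subspace_diff cfun.subspace_sum cfun.subspace_scale)
      (auto simp: dual_points_def)
  moreover have "?g s = 0" if "s \<in> T" for s
  proof -
    have "(\<Sum>t\<in>T. f t * \<phi> t s) = (\<Sum>t\<in>T. if t = s then f s else 0)"
      using assms that by (intro sum.cong) (auto simp: dual_points_def)
    then show ?thesis using that assms by (auto simp: sum_fun_apply dual_points_def)
  qed
  ultimately have "?g = 0" using assms by (auto simp: dual_points_def)
  then show ?thesis by simp
qed

lemma dual_points_basis:
  assumes D: "cfun.subspace D" and dp: "dual_points D T \<phi>"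
  shows "inj_on \<phi> T" "cfun.independent (\<phi> ` T)" "cfun.span (\<phi> ` T) = D" "\<phi> ` T \<subseteq> D" "finite (\<phi> ` T)"
    "cfun.dim D = card T"
proof -
  show inj: "inj_on \<phi> T"
    using dp by (intro inj_onI) (metis dual_points_def zero_neq_one)
  have fin: "finite T" using dp by (simp add: dual_points_def)
  show sub: "\<phi> ` T \<subseteq> D" and finite: "finite (\<phi> ` T)" using dp by (auto simp: dual_points_def)
  show span: "cfun.span (\<phi> ` T) = D"
  proof (rule cfun.span_subspace[OF sub _ D], rule subsetI)
    fix f assume "f \<in> D"
    then have "f = (\<Sum>t\<in>T. cscale (f t) (\<phi> t))" using dual_points_expand D dp by blast
    then show "f \<in> cfun.span (\<phi> ` T)"
      by (metis (no_types, lifting) cfun.span_sum cfun.span_scale cfun.span_base imageI)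
  qed
  show ind: "cfun.independent (\<phi> ` T)"
  proof (rule cfun.independent_if_scalars_zero[OF finite])
    fix c x assume z: "(\<Sum>x\<in>\<phi> ` T. cscale (c x) x) = 0" and "x \<in> \<phi> ` T"
    then obtain t where t: "t \<in> T" "x = \<phi> t" by auto
    have "0 = (\<Sum>x\<in>\<phi> ` T. cscale (c x) x) t" using z by simp
    also have "\<dots> = (\<Sum>s\<in>T. c (\<phi> s) * \<phi> s t)" using inj by (simp add: sum_fun_apply sum.reindex)
    also have "\<dots> = (\<Sum>s\<in>T. if s = t then c x else 0)"
      using dp t by (intro sum.cong) (auto simp: dual_points_def)
    finally show "c x = 0" using t fin by simp
  qed
  show "cfun.dim D = card T"
    using cfun.dim_span_eq_card_independent[OF ind] span inj by (simp add: card_image)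
qed

text \<open>The gate through which finite generation of a group becomes finite dimension:
  homomorphisms and functionals on graded pieces are determined at finitely many elements.\<close>

lemma span_finite_if_determined:
  assumes "cfun.subspace D" and "finite T"
    and "\<And>f. f \<in> D \<Longrightarrow> (\<And>t. t \<in> T \<Longrightarrow> f t = 0) \<Longrightarrow> f = 0"
  obtains B where "finite B" "cfun.span B = D"
  using assms by (metis dual_points_basis(3,5) dual_points_exist)

lemma dim_linear_image:
  assumes L: "Vector_Spaces.linear cscale cscale L" and D: "cfun.subspace D" and inj: "inj_on L D"
  shows "cfun.dim (L ` D) = cfun.dim D"
proof -
  obtain B where B: "B \<subseteq> D" "cfun.independent B" "D \<subseteq> cfun.span B" "card B = cfun.dim D"
    using cfun.basis_exists by metis
  have span: "cfun.span B = D" using B D cfun.span_subspace by blast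
  have "cfun.span (L ` B) = L ` D"
    using cfun_pair.linear_span_image[OF L] span by metis
  moreover have "cfun.independent (L ` B)"
    using cfun_pair.linear_independent_injective_image[OF L] B(2) inj span by metis
  ultimately have "cfun.dim (L ` D) = card (L ` B)"
    by (metis cfun.dim_span_eq_card_independent)
  also have "\<dots> = card B" using inj B(1) by (meson card_image inj_on_subset)
  finally show ?thesis using B by simp
qed

lemma dim_less:
  assumes "cfun.subspace D" and "D \<subset> E" and "finite B" "E \<subseteq> cfun.span B"
  shows "cfun.dim D < cfun.dim E"
proof -
  obtain B1 where B1: "B1 \<subseteq> D" "cfun.independent B1" "D \<subseteq> cfun.span B1" "card B1 = cfun.dim D"
    using cfun.basis_exists by metis
  obtain B2 where B2: "B1 \<subseteq> B2" "B2 \<subseteq> E" "cfun.independent B2" "E \<subseteq> cfun.span B2"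
    using cfun.maximal_independent_subset_extend[of B1 E] B1 assms by blast
  have "finite B2"
    using cfun.independent_span_bound[of B B2] assms B2 by auto
  moreover have "B1 \<noteq> B2"
    using B1 B2 assms by (metis cfun.span_subspace psubset_eq subset_antisym)
  ultimately have "card B1 < card B2" using B2(1) by (simp add: psubset_card_mono psubset_eq)
  then show ?thesis using B1 B2 cfun.basis_card_eq_dim by metis
qed

lemma dim_direct_sum:
  assumes D: "cfun.subspace D" "finite F" "D \<subseteq> cfun.span F"
    and E: "cfun.subspace E" "finite F'" "E \<subseteq> cfun.span F'"
    and int: "D \<inter> E \<subseteq> {0}" and U: "U = {x + y | x y. x \<in> D \<and> y \<in> E}"
  shows "cfun.dim U = cfun.dim D + cfun.dim E"
proof -
  obtain B where B: "B \<subseteq> D" "cfun.independent B" "D \<subseteq> cfun.span B" "card B = cfun.dim D"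
    using cfun.basis_exists by metis
  obtain C where C: "C \<subseteq> E" "cfun.independent C" "E \<subseteq> cfun.span C" "card C = cfun.dim E"
    using cfun.basis_exists by metis
  have fB: "finite B" using cfun.independent_span_bound[of F B] D B by auto
  have fC: "finite C" using cfun.independent_span_bound[of F' C] E C by auto
  have disj: "B \<inter> C = {}"
  proof -
    have "0 \<notin> B" using B(2) cfun.dependent_zero by blast
    then show ?thesis using B(1) C(1) int by auto
  qed
  have ind: "cfun.independent (B \<union> C)"
  proof (rule cfun.independent_if_scalars_zero)
    show "finite (B \<union> C)" using fB fC by simp
    fix c x assume "(\<Sum>x\<in>B \<union> C. cscale (c x) x) = 0" and x: "x \<in> B \<union> C"
    then have s: "(\<Sum>x\<in>B. cscale (c x) x) + (\<Sum>x\<in>C. cscale (c x) x) = 0"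
      using fB fC disj by (simp add: sum.union_disjoint)
    have 1: "(\<Sum>x\<in>B. cscale (c x) x) \<in> D"
      using B D by (intro cfun.subspace_sum cfun.subspace_scale) auto
    have 2: "(\<Sum>x\<in>C. cscale (c x) x) \<in> E"
      using C E by (intro cfun.subspace_sum cfun.subspace_scale) auto
    have "(\<Sum>x\<in>B. cscale (c x) x) = - (\<Sum>x\<in>C. cscale (c x) x)"
      using s by (simp add: eq_neg_iff_add_eq_0)
    then have "(\<Sum>x\<in>B. cscale (c x) x) \<in> E"
      using cfun.subspace_neg[OF E(1) 2] by simp
    then have z1: "(\<Sum>x\<in>B. cscale (c x) x) = 0" using 1 int by auto
    with s have z2: "(\<Sum>x\<in>C. cscale (c x) x) = 0" by simp
    show "c x = 0"
      using x cfun.independentD[OF B(2) fB subset_refl z1] cfun.independentD[OF C(2) fC subset_refl z2]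
      by auto
  qed
  have "cfun.span (B \<union> C) = U"
    unfolding cfun.span_Un U using B C D E by (metis cfun.span_subspace)
  then have "cfun.dim U = card (B \<union> C)" using ind by (metis cfun.dim_span_eq_card_independent)
  then show ?thesis using B C fB fC disj by (simp add: card_Un_disjoint)
qed


section \<open>Dimensions of quotient spaces\<close>

text \<open>Turns independence modulo W into independence in the ambient space, so that a linear map
  can be prescribed on B and made zero on W at the same time.\<close>

lemma independent_quotient_basis:
  assumes B: "quotient_basis V W B" and W: "cfun.subspace W"
    and BW: "cfun.independent BW" "cfun.span BW = W"
  shows "cfun.independent (B \<union> BW)" "B \<inter> BW = {}"
proof -
  have fin: "finite B" and z: "\<And>c. (\<Sum>b\<in>B. cscale (c b) b) \<in> W \<Longrightarrow> \<forall>b\<in>B. c b = 0"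
    using B by (auto simp: quotient_basis_def)
  show disj: "B \<inter> BW = {}"
  proof (rule ccontr)
    assume "B \<inter> BW \<noteq> {}"
    then obtain b where b: "b \<in> B" "b \<in> W" using BW cfun.span_base by blast
    have "(\<Sum>x\<in>B. cscale (if x = b then 1 else 0) x) = (\<Sum>x\<in>B. if x = b then b else 0)"
      by (intro sum.cong) (auto simp: fun_eq_iff)
    also have "\<dots> = b" using b fin by simp
    finally have "(\<Sum>x\<in>B. cscale (if x = b then 1 else 0) x) \<in> W" using b by simp
    from z[OF this] b show False by auto
  qed
  show "cfun.independent (B \<union> BW)"
    unfolding cfun.independent_explicit_module
  proof (intro allI impI)
    fix t u v assume t: "finite t" "t \<subseteq> B \<union> BW" and s: "(\<Sum>v\<in>t. cscale (u v) v) = 0" and v: "v \<in> t"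
    have split: "t = (t \<inter> B) \<union> (t \<inter> BW)" using t by auto
    have "(\<Sum>v\<in>(t \<inter> B) \<union> (t \<inter> BW). cscale (u v) v) =
        (\<Sum>v\<in>t \<inter> B. cscale (u v) v) + (\<Sum>v\<in>t \<inter> BW. cscale (u v) v)"
      using t disj by (intro sum.union_disjoint) auto
    then have s2: "(\<Sum>v\<in>t \<inter> B. cscale (u v) v) + (\<Sum>v\<in>t \<inter> BW. cscale (u v) v) = 0"
      using s split by simp
    have w: "(\<Sum>v\<in>t \<inter> BW. cscale (u v) v) \<in> W"
      unfolding BW(2)[symmetric] by (intro cfun.span_sum cfun.span_scale cfun.span_base) auto
    define c where "c v = (if v \<in> t then u v else 0)" for v
    have "(\<Sum>v\<in>B. cscale (c v) v) = (\<Sum>v\<in>t \<inter> B. cscale (u v) v)"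
      using fin by (intro sum.mono_neutral_cong_right) (auto simp: c_def)
    also have "\<dots> = - (\<Sum>v\<in>t \<inter> BW. cscale (u v) v)"
      using s2 by (simp add: eq_neg_iff_add_eq_0)
    finally have "(\<Sum>v\<in>B. cscale (c v) v) \<in> W" using cfun.subspace_neg[OF W w] by simp
    from z[OF this] have c0: "\<And>b. b \<in> t \<inter> B \<Longrightarrow> u b = 0" by (auto simp: c_def)
    then have "(\<Sum>v\<in>t \<inter> B. cscale (u v) v) = 0" by (intro sum.neutral) (auto simp: fun_eq_iff)
    then have "(\<Sum>v\<in>t \<inter> BW. cscale (u v) v) = 0" using s2 by simp
    then have "\<And>b. b \<in> t \<inter> BW \<Longrightarrow> u b = 0"
      using cfun.independentD[OF BW(1), of "t \<inter> BW" u] t by auto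
    with c0 v t show "u v = 0" by auto
  qed
qed

text \<open>Makes the choice in \<open>quotient_dim\<close> harmless: any two quotient bases have
  the same cardinality, by the exchange bound applied in both directions.\<close>

lemma quotient_dim_eq:
  assumes B: "quotient_basis V W B" and W: "cfun.subspace W"
  shows "quotient_dim V W = card B"
proof -
  have le: "card B \<le> card B'" if B: "quotient_basis V W B" and B': "quotient_basis V W B'" for B B'
  proof -
    obtain BW where BW: "BW \<subseteq> W" "cfun.independent BW" "W \<subseteq> cfun.span BW"
      using cfun.maximal_independent_subset by metis
    then have BW': "cfun.span BW = W" using W cfun.span_subspace by blast
    have ind: "cfun.independent (B \<union> BW)" "B \<inter> BW = {}"
      using independent_quotient_basis[OF B W BW(2) BW'] by auto
    \<comment> \<open>\<open>p\<close> fixes B and kills W, hence factors through V/W; the images of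
      B' then span B without help from W.\<close>
    obtain p where p: "\<forall>x\<in>B \<union> BW. p x = (if x \<in> B then x else 0)"
      and lin: "Vector_Spaces.linear cscale cscale p"
      using cfun_pair.linear_independent_extend[OF ind(1), of "\<lambda>x. if x \<in> B then x else 0"] by auto
    have p0: "p w = 0" if "w \<in> W" for w
      using cfun_pair.linear_eq_0_on_span[OF lin, of BW w] that BW' p ind(2) by force
    have "B \<subseteq> cfun.span (p ` B')"
    proof
      fix b assume b: "b \<in> B"
      then have "b \<in> cfun.span (B' \<union> W)" using B B' by (auto simp: quotient_basis_def)
      then have "p b \<in> p ` cfun.span (B' \<union> W)" by simp
      also have "p ` cfun.span (B' \<union> W) = cfun.span (p ` (B' \<union> W))"
        using cfun_pair.linear_span_image[OF lin] by metis
      also have "\<dots> \<subseteq> cfun.span (p ` B')"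
        using p0 by (intro cfun.span_minimal) (auto simp: cfun.span_zero intro: cfun.span_base)
      finally show "b \<in> cfun.span (p ` B')" using p b by simp
    qed
    moreover have "cfun.independent B" using ind cfun.independent_mono by blast
    moreover have f: "finite B'" using B' by (simp add: quotient_basis_def)
    ultimately have "card B \<le> card (p ` B')" using cfun.independent_span_bound by blast
    also have "\<dots> \<le> card B'" using f card_image_le by blast
    finally show ?thesis .
  qed
  have "quotient_basis V W (SOME B. quotient_basis V W B)" using B by (rule someI)
  then have "card (SOME B. quotient_basis V W B) = card B"
    using le[OF B] le[OF _ B] by (meson antisym)
  then show ?thesis using B by (auto simp: quotient_dim_def)
qed

text \<open>A basis of W is extended to one of V, and the added vectors form a quotient basis. The
  finite spanning set excludes the default value 0 of an infinite-dimensional quotient.\<close>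

lemma quotient_dim_pos_iff:
  assumes V: "finite F" "V \<subseteq> cfun.span F" and W: "cfun.subspace W" and WV: "W \<subseteq> V"
  shows "quotient_dim V W \<ge> 1 \<longleftrightarrow> W \<noteq> V"
proof -
  obtain BW where BW: "BW \<subseteq> W" "cfun.independent BW" "W \<subseteq> cfun.span BW"
    using cfun.maximal_independent_subset by metis
  then have BW': "cfun.span BW = W" using W cfun.span_subspace by blast
  obtain BV where BV: "BW \<subseteq> BV" "BV \<subseteq> V" "cfun.independent BV" "V \<subseteq> cfun.span BV"
    using cfun.maximal_independent_subset_extend[of BW V] BW WV by blast
  have finBV: "finite BV" using cfun.independent_span_bound[of F BV] BV V by auto
  have qb: "quotient_basis V W (BV - BW)"
    unfolding quotient_basis_def
  proof (intro conjI allI impI)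
    show "finite (BV - BW)" "BV - BW \<subseteq> V" using finBV BV by auto
    have "BV \<subseteq> (BV - BW) \<union> W" using BW by auto
    then show "V \<subseteq> cfun.span (BV - BW \<union> W)" using BV(4) cfun.span_mono by blast
    fix c assume "(\<Sum>b\<in>BV - BW. cscale (c b) b) \<in> W"
    moreover have "finite BW" using finBV BV finite_subset by blast
    ultimately obtain d where d: "(\<Sum>b\<in>BV - BW. cscale (c b) b) = (\<Sum>b\<in>BW. cscale (d b) b)"
      using BW' cfun.span_finite[of BW] by auto
    define u where "u b = (if b \<in> BW then - d b else c b)" for b
    have "(\<Sum>b\<in>BV. cscale (u b) b) = (\<Sum>b\<in>BV - BW. cscale (u b) b) + (\<Sum>b\<in>BW. cscale (u b) b)"
      using BV finBV by (intro sum.subset_diff) auto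
    also have "(\<Sum>b\<in>BV - BW. cscale (u b) b) = (\<Sum>b\<in>BV - BW. cscale (c b) b)"
      by (intro sum.cong) (auto simp: u_def)
    also have "(\<Sum>b\<in>BW. cscale (u b) b) = (\<Sum>b\<in>BW. - cscale (d b) b)"
      by (intro sum.cong) (auto simp: u_def fun_eq_iff)
    also have "(\<Sum>b\<in>BV - BW. cscale (c b) b) + (\<Sum>b\<in>BW. - cscale (d b) b) = 0"
      using d by (simp add: sum_negf)
    finally have "\<And>b. b \<in> BV \<Longrightarrow> u b = 0"
      using cfun.independentD[OF BV(3) finBV] by blast
    then show "\<forall>b\<in>BV - BW. c b = 0" unfolding u_def by (metis DiffE)
  qed
  have "quotient_dim V W = card (BV - BW)" by (rule quotient_dim_eq[OF qb W])
  moreover have "card (BV - BW) \<ge> 1 \<longleftrightarrow> \<not> BV \<subseteq> BW"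
    using finBV by (metis Diff_eq_empty_iff One_nat_def Suc_le_eq card_gt_0_iff finite_Diff)
  moreover have "BV \<subseteq> BW \<longleftrightarrow> W = V"
  proof
    assume "BV \<subseteq> BW" then show "W = V" using BV BW' WV by (metis subset_antisym)
  next
    assume "W = V"
    then have "BW = BV" using BV BW' cfun.spanning_subset_independent[of BW BV] by auto
    then show "BV \<subseteq> BW" by simp
  qed
  ultimately show ?thesis by auto
qed

section \<open>Additive functions as the dual of the complexification\<close>

text \<open>Vanishing off the carrier makes every homomorphism to the complex numbers a single
  function, so that \<open>cfun.dim\<close> measures the space of homomorphisms.\<close>

definition additive_functions :: "('a, 'b) monoid_scheme \<Rightarrow> ('a \<Rightarrow> complex) set" where
  "additive_functions A = {\<phi>. (\<forall>x. x \<notin> carrier A \<longrightarrow> \<phi> x = 0) \<and>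
     (\<forall>x\<in>carrier A. \<forall>y\<in>carrier A. \<phi> (x \<otimes>\<^bsub>A\<^esub> y) = \<phi> x + \<phi> y)}"

lemma subspace_additive_functions: "cfun.subspace (additive_functions A)"
  by (rule cfun.subspaceI) (auto simp: additive_functions_def algebra_simps)

lemma independent_delta: "cfun.independent (delta ` X)"
  unfolding cfun.independent_explicit_module
proof (intro allI impI)
  fix t u v assume t: "finite t" "t \<subseteq> delta ` X" "(\<Sum>v\<in>t. cscale (u v) v) = 0" "v \<in> t"
  then obtain x where x: "v = delta x" by auto
  have "0 = (\<Sum>w\<in>t. cscale (u w) w) x" using t by simp
  also have "\<dots> = (\<Sum>w\<in>t. if w = v then u v else 0)"
  proof (unfold sum_fun_apply, intro sum.cong refl)
    fix w assume "w \<in> t"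
    then obtain y where "w = delta y" using t(2) by auto
    then show "cscale (u w) w x = (if w = v then u v else 0)"
      using x by (cases "x = y") (auto simp: delta_def dest: fun_cong[of _ _ x])
  qed
  finally show "u v = 0" using t by simp
qed

lemma inj_delta: "inj delta"
  by (intro injI) (metis delta_def zero_neq_one)

text \<open>Additive functions on \<open>A\<close> are the linear functionals on \<open>A \<otimes> \<complex>\<close>.\<close>

lemma complexification_dim_eq_dim:
  fixes A :: "('a, 'b) monoid_scheme"
  assumes mult: "\<And>x y. x \<in> carrier A \<Longrightarrow> y \<in> carrier A \<Longrightarrow> x \<otimes>\<^bsub>A\<^esub> y \<in> carrier A"
    and T: "finite T" "T \<subseteq> carrier A"
    and det: "\<And>f. f \<in> additive_functions A \<Longrightarrow> (\<And>t. t \<in> T \<Longrightarrow> f t = 0) \<Longrightarrow> f = 0"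
  shows "complexification_dim A = cfun.dim (additive_functions A)"
proof -
  let ?V = "cfun.span (delta ` carrier A)"
  let ?R = "{delta (x \<otimes>\<^bsub>A\<^esub> y) - delta x - delta y | x y. x \<in> carrier A \<and> y \<in> carrier A}"
  let ?W = "cfun.span ?R"
  obtain T' \<phi> where T': "T' \<subseteq> T" and dp: "dual_points (additive_functions A) T' \<phi>"
    using dual_points_exist[OF subspace_additive_functions T(1) det] by blast
  have fT': "finite T'" using dp by (simp add: dual_points_def)
  have "quotient_basis ?V ?W (delta ` T')"
    unfolding quotient_basis_def
  proof (intro conjI allI impI)
    show "finite (delta ` T')" using fT' by simp
    show "delta ` T' \<subseteq> ?V" using T' T by (auto intro: cfun.span_base)
    show "?V \<subseteq> cfun.span (delta ` T' \<union> ?W)"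
    proof (rule cfun.span_minimal[OF _ cfun.subspace_span], rule ccontr)
      assume "\<not> delta ` carrier A \<subseteq> cfun.span (delta ` T' \<union> ?W)"
      then obtain a where a: "a \<in> carrier A" "delta a \<notin> cfun.span (delta ` T' \<union> ?W)" by auto
      obtain S where S: "S \<subseteq> delta ` T' \<union> ?W" "cfun.independent S" "delta ` T' \<union> ?W \<subseteq> cfun.span S"
        by (rule cfun.maximal_independent_subset)
      have "cfun.span S \<subseteq> cfun.span (delta ` T' \<union> ?W)" using S cfun.span_mono by blast
      then have da: "delta a \<notin> cfun.span S" using a by auto
      then have "cfun.independent (insert (delta a) S)" using S by (simp add: cfun.independent_insertI)
      \<comment> \<open>A functional that kills the relators and the points of T' but not
        \<open>delta a\<close> restricts to a nonzero additive function vanishing on T', against the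
        choice of T'.\<close>
      from cfun_dual.linear_independent_extend[OF this, of "\<lambda>x. if x = delta a then 1 else 0"]
      obtain \<Phi> where \<Phi>: "\<Phi> (delta a) = 1" "\<And>x. x \<in> S \<Longrightarrow> \<Phi> x = 0"
        and lin: "Vector_Spaces.linear cscale (*) \<Phi>"
        using da cfun.span_base by (metis insertCI)
      have \<Phi>0: "\<Phi> x = 0" if "x \<in> cfun.span S" for x
        using cfun_dual.linear_eq_0_on_span[OF lin, of S x] \<Phi>(2) that by auto
      define f where "f x = (if x \<in> carrier A then \<Phi> (delta x) else 0)" for x
      have add: "\<Phi> (delta (x \<otimes>\<^bsub>A\<^esub> y)) = \<Phi> (delta x) + \<Phi> (delta y)"
        if "x \<in> carrier A" "y \<in> carrier A" for x y
      proof -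
        have "delta (x \<otimes>\<^bsub>A\<^esub> y) - delta x - delta y \<in> cfun.span S"
          using that S(3) cfun.span_base[of _ ?R] by blast
        then have "\<Phi> (delta (x \<otimes>\<^bsub>A\<^esub> y) - delta x - delta y) = 0" by (rule \<Phi>0)
        then show ?thesis by (simp add: cfun_dual.linear_diff[OF lin] diff_eq_eq)
      qed
      have "f \<in> additive_functions A" using add mult by (auto simp: additive_functions_def f_def)
      moreover have "f t = 0" if "t \<in> T'" for t
        using \<Phi>0[of "delta t"] that S by (auto simp: f_def)
      ultimately have "f = 0" using dp by (auto simp: dual_points_def)
      then have "f a = 0" by simp
      then show False using a \<Phi>(1) by (simp add: f_def)
    qed
    fix c assume c: "(\<Sum>b\<in>delta ` T'. cscale (c b) b) \<in> ?W"
    show "\<forall>b\<in>delta ` T'. c b = 0"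
    proof
      fix b assume "b \<in> delta ` T'"
      then obtain t where t: "t \<in> T'" "b = delta t" by auto
      \<comment> \<open>The linear extension of the dual function at t kills all relators, hence
        \<open>?W\<close>, and reads off the coefficient of \<open>delta t\<close>.\<close>
      have "\<exists>\<Phi>. (\<forall>b\<in>delta ` carrier A. \<Phi> b = \<phi> t (the_inv delta b)) \<and> Vector_Spaces.linear cscale (*) \<Phi>"
        using cfun_dual.linear_independent_extend[OF independent_delta, of "carrier A" "\<lambda>b. \<phi> t (the_inv delta b)"]
        by auto
      then obtain \<Phi> where \<Phi>: "\<And>x. x \<in> carrier A \<Longrightarrow> \<Phi> (delta x) = \<phi> t x"
        and lin: "Vector_Spaces.linear cscale (*) \<Phi>"
        by (auto simp: the_inv_f_f[OF inj_delta])
      have \<phi>: "\<phi> t \<in> additive_functions A" using dp t by (auto simp: dual_points_def)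
      have "\<Phi> x = 0" if "x \<in> ?R" for x
        using that \<phi> by (auto simp: cfun_dual.linear_diff[OF lin] \<Phi> mult additive_functions_def)
      then have "\<Phi> (\<Sum>b\<in>delta ` T'. cscale (c b) b) = 0"
        using cfun_dual.linear_eq_0_on_span[OF lin _ c] by blast
      also have "\<Phi> (\<Sum>b\<in>delta ` T'. cscale (c b) b) = (\<Sum>b\<in>delta ` T'. c b * \<Phi> b)"
        by (simp add: cfun_dual.linear_sum[OF lin] cfun_dual.linear_scale[OF lin])
      also have "\<dots> = (\<Sum>s\<in>T'. c (delta s) * \<Phi> (delta s))"
        by (rule sum.reindex_cong[of delta]) (auto intro: inj_on_subset[OF inj_delta])
      also have "\<dots> = (\<Sum>s\<in>T'. if s = t then c b else 0)"
        using t dp T' T by (intro sum.cong) (auto simp: dual_points_def \<Phi> subset_iff)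
      finally show "c b = 0" using t fT' by simp
    qed
  qed
  then have "complexification_dim A = card (delta ` T')"
    unfolding complexification_dim_def by (rule quotient_dim_eq) (rule cfun.subspace_span)
  also have "\<dots> = card T'" by (rule card_image) (rule inj_on_subset[OF inj_delta], simp)
  also have "\<dots> = cfun.dim (additive_functions A)"
    using dual_points_basis(6)[OF subspace_additive_functions dp] by simp
  finally show ?thesis .
qed

section \<open>Hilbert's basis theorem for rings of functions\<close>

text \<open>Rings are subsets of a ring type here because they will consist of certain functions
  inside the ring of all functions on a space.\<close>

definition subring_set :: "'r::comm_ring_1 set \<Rightarrow> bool" where
  "subring_set A \<longleftrightarrow> 0 \<in> A \<and> 1 \<in> A \<and> (\<forall>a\<in>A. \<forall>b\<in>A. a + b \<in> A \<and> a * b \<in> A) \<and> (\<forall>a\<in>A. - a \<in> A)"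

definition ideal_of :: "'r::comm_ring_1 set \<Rightarrow> 'r set \<Rightarrow> bool" where
  "ideal_of A I \<longleftrightarrow> I \<subseteq> A \<and> 0 \<in> I \<and> (\<forall>a\<in>I. \<forall>b\<in>I. a + b \<in> I) \<and> (\<forall>a\<in>A. \<forall>b\<in>I. a * b \<in> I)"

definition noetherian_set :: "'r::comm_ring_1 set \<Rightarrow> bool" where
  "noetherian_set A \<longleftrightarrow>
     (\<forall>I :: nat \<Rightarrow> 'r set. (\<forall>n. ideal_of A (I n)) \<and> incseq I \<longrightarrow> (\<exists>N. \<forall>n\<ge>N. I n = I N))"

text \<open>The strict bound on the exponent lets \<open>p + a * t ^ d\<close> with \<open>p\<close>
  in this set be the general expression of degree at most d, with coefficient a on top.\<close>

definition adjoin_below :: "'r::comm_ring_1 set \<Rightarrow> 'r \<Rightarrow> nat \<Rightarrow> 'r set" where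
  "adjoin_below A t d = {\<Sum>i<d. a i * t ^ i | a. \<forall>i. a i \<in> A}"

definition adjoin :: "'r::comm_ring_1 set \<Rightarrow> 'r \<Rightarrow> 'r set" where
  "adjoin A t = (\<Union>d. adjoin_below A t d)"

text \<open>Coefficients in degree exactly d, zero included. They belong to expressions in
  \<open>t\<close>, not to ring elements, since \<open>t\<close> may be algebraic over
  \<open>A\<close>.\<close>

definition leading_ideal :: "'r::comm_ring_1 set \<Rightarrow> 'r \<Rightarrow> 'r set \<Rightarrow> nat \<Rightarrow> 'r set" where
  "leading_ideal A t I d = {a \<in> A. \<exists>p\<in>adjoin_below A t d. p + a * t ^ d \<in> I}"

context
  fixes A :: "'r::comm_ring_1 set" and t :: 'r
  assumes A: "subring_set A"
begin

lemma adjoin_below_0: "adjoin_below A t 0 = {0}"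
  using A by (auto simp: adjoin_below_def subring_set_def)

lemma adjoin_below_Suc: "adjoin_below A t (Suc d) = {p + a * t ^ d | p a. p \<in> adjoin_below A t d \<and> a \<in> A}"
proof (intro equalityI subsetI)
  fix x assume "x \<in> {p + a * t ^ d | p a. p \<in> adjoin_below A t d \<and> a \<in> A}"
  then obtain c a where c: "x = (\<Sum>i<d. c i * t ^ i) + a * t ^ d" "\<forall>i. c i \<in> A" "a \<in> A"
    unfolding adjoin_below_def by blast
  then have "x = (\<Sum>i<Suc d. (c(d := a)) i * t ^ i)" "\<forall>i. (c(d := a)) i \<in> A" by auto
  then show "x \<in> adjoin_below A t (Suc d)" unfolding adjoin_below_def by blast
next
  fix x assume "x \<in> adjoin_below A t (Suc d)"
  then obtain c where "x = (\<Sum>i<d. c i * t ^ i) + c d * t ^ d" "\<forall>i. c i \<in> A"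
    by (auto simp: adjoin_below_def)
  then show "x \<in> {p + a * t ^ d | p a. p \<in> adjoin_below A t d \<and> a \<in> A}"
    unfolding adjoin_below_def by blast
qed

text \<open>Splitting off the constant term instead of the top one is the form that the induction in
  \<open>adjoin_below_mult\<close> needs.\<close>

lemma adjoin_below_Suc': "adjoin_below A t (Suc d) = {a + t * p | p a. p \<in> adjoin_below A t d \<and> a \<in> A}"
proof (intro equalityI subsetI)
  fix x assume "x \<in> {a + t * p | p a. p \<in> adjoin_below A t d \<and> a \<in> A}"
  then obtain c a where c: "x = a + t * (\<Sum>i<d. c i * t ^ i)" "\<forall>i. c i \<in> A" "a \<in> A"
    unfolding adjoin_below_def by blast
  then have "x = (\<Sum>i<Suc d. case_nat a c i * t ^ i)"
    by (simp add: sum.lessThan_Suc_shift sum_distrib_left mult_ac del: sum.lessThan_Suc)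
  moreover have "\<forall>i. case_nat a c i \<in> A" using c by (auto split: nat.split)
  ultimately show "x \<in> adjoin_below A t (Suc d)" unfolding adjoin_below_def by blast
next
  fix x assume "x \<in> adjoin_below A t (Suc d)"
  then obtain c where c: "x = (\<Sum>i<Suc d. c i * t ^ i)" "\<forall>i. c i \<in> A"
    by (auto simp: adjoin_below_def)
  then have "x = c 0 + t * (\<Sum>i<d. c (Suc i) * t ^ i)"
    by (simp add: sum.lessThan_Suc_shift sum_distrib_left mult_ac del: sum.lessThan_Suc)
  with c(2) show "x \<in> {a + t * p | p a. p \<in> adjoin_below A t d \<and> a \<in> A}"
    unfolding adjoin_below_def by fastforce
qed

lemma adjoin_below_add: "p \<in> adjoin_below A t d \<Longrightarrow> q \<in> adjoin_below A t d \<Longrightarrow> p + q \<in> adjoin_below A t d"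
proof (induction d arbitrary: p q)
  case (Suc d)
  then obtain p' a q' b where "p = p' + a * t ^ d" "q = q' + b * t ^ d" "a \<in> A" "b \<in> A"
      "p' \<in> adjoin_below A t d" "q' \<in> adjoin_below A t d"
    unfolding adjoin_below_Suc by blast
  moreover from this have "p + q = (p' + q') + (a + b) * t ^ d" by (simp add: algebra_simps)
  moreover have "a + b \<in> A" using calculation A by (auto simp: subring_set_def)
  ultimately show ?case unfolding adjoin_below_Suc using Suc.IH by blast
qed (simp add: adjoin_below_0)

lemma adjoin_below_scale: "c \<in> A \<Longrightarrow> p \<in> adjoin_below A t d \<Longrightarrow> c * p \<in> adjoin_below A t d"
proof (induction d arbitrary: p)
  case (Suc d)
  then obtain p' a where "p = p' + a * t ^ d" "a \<in> A" "p' \<in> adjoin_below A t d"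
    unfolding adjoin_below_Suc by blast
  moreover from this have "c * p = c * p' + (c * a) * t ^ d" by (simp add: algebra_simps)
  moreover have "c * a \<in> A" using calculation A Suc.prems by (auto simp: subring_set_def)
  ultimately show ?case unfolding adjoin_below_Suc using Suc by blast
qed (simp add: adjoin_below_0)

lemma minus_one_in: "- 1 \<in> A"
  using A by (simp add: subring_set_def)

lemma adjoin_below_diff: "p \<in> adjoin_below A t d \<Longrightarrow> q \<in> adjoin_below A t d \<Longrightarrow> p - q \<in> adjoin_below A t d"
  using adjoin_below_add[of p d "- 1 * q"] adjoin_below_scale[OF minus_one_in, of q d] by simp

lemma adjoin_below_mono: "d \<le> e \<Longrightarrow> adjoin_below A t d \<subseteq> adjoin_below A t e"
proof (induction e rule: dec_induct)
  case (step e)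
  have "adjoin_below A t e \<subseteq> adjoin_below A t (Suc e)"
    unfolding adjoin_below_Suc using A by (force simp: subring_set_def)
  with step show ?case by blast
qed simp

lemma adjoin_below_shift: "p \<in> adjoin_below A t d \<Longrightarrow> t * p \<in> adjoin_below A t (Suc d)"
  unfolding adjoin_below_Suc' using A by (force simp: subring_set_def)

lemma adjoin_below_mult:
  "p \<in> adjoin_below A t d \<Longrightarrow> q \<in> adjoin_below A t e \<Longrightarrow> p * q \<in> adjoin_below A t (d + e)"
proof (induction d arbitrary: p)
  case 0
  have "0 \<in> adjoin_below A t e" using adjoin_below_mono[of 0 e] adjoin_below_0 by auto
  with 0 show ?case by (simp add: adjoin_below_0)
next
  case (Suc d)
  then obtain p' a where p: "p = a + t * p'" "p' \<in> adjoin_below A t d" "a \<in> A"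
    unfolding adjoin_below_Suc' by blast
  have "t * (p' * q) \<in> adjoin_below A t (Suc d + e)"
    using adjoin_below_shift[OF Suc.IH[OF p(2) Suc.prems(2)]] by simp
  moreover have "a * q \<in> adjoin_below A t (Suc d + e)"
    using adjoin_below_scale[OF p(3) Suc.prems(2)] adjoin_below_mono[of e "Suc d + e"] by auto
  ultimately have "a * q + t * (p' * q) \<in> adjoin_below A t (Suc d + e)" by (intro adjoin_below_add)
  then show ?case using p(1) by (simp add: algebra_simps)
qed

lemma adjoin_below_1: "adjoin_below A t 1 = A"
  by (simp add: adjoin_below_Suc adjoin_below_0)

lemma adjoin_superset: "A \<subseteq> adjoin A t"
  using adjoin_below_1 by (auto simp: adjoin_def)

lemma generator_in_adjoin: "t \<in> adjoin A t"
  using adjoin_below_shift[of 1 1] A adjoin_below_1 by (auto simp: adjoin_def subring_set_def)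

lemma subring_adjoin: "subring_set (adjoin A t)"
  unfolding subring_set_def
proof (intro conjI ballI)
  show "0 \<in> adjoin A t" "1 \<in> adjoin A t" using A adjoin_superset by (auto simp: subring_set_def)
  fix p assume "p \<in> adjoin A t"
  then obtain d where p: "p \<in> adjoin_below A t d" by (auto simp: adjoin_def)
  have "- p \<in> adjoin_below A t d" using adjoin_below_scale[OF minus_one_in p] by simp
  then show "- p \<in> adjoin A t" by (auto simp: adjoin_def)
  fix q assume "q \<in> adjoin A t"
  then obtain e where q: "q \<in> adjoin_below A t e" by (auto simp: adjoin_def)
  have "p \<in> adjoin_below A t (d + e)" "q \<in> adjoin_below A t (d + e)"
    using p q adjoin_below_mono[of d "d + e"] adjoin_below_mono[of e "d + e"] by auto
  then show "p + q \<in> adjoin A t" using adjoin_below_add by (auto simp: adjoin_def)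
  show "p * q \<in> adjoin A t" using adjoin_below_mult[OF p q] by (auto simp: adjoin_def)
qed

lemma ideal_diff: "ideal_of (adjoin A t) I \<Longrightarrow> p \<in> I \<Longrightarrow> q \<in> I \<Longrightarrow> p - q \<in> I"
  using adjoin_superset minus_one_in unfolding ideal_of_def
  by (metis diff_conv_add_uminus mult_minus1 subsetD)

lemma ideal_leading_ideal:
  assumes I: "ideal_of (adjoin A t) I"
  shows "ideal_of A (leading_ideal A t I d)"
  unfolding ideal_of_def
proof (intro conjI ballI)
  have z: "0 \<in> adjoin_below A t d" using adjoin_below_mono[of 0 d] adjoin_below_0 by auto
  show "leading_ideal A t I d \<subseteq> A" by (auto simp: leading_ideal_def)
  show "0 \<in> leading_ideal A t I d"
    using z I A by (auto simp: leading_ideal_def ideal_of_def subring_set_def intro!: bexI[of _ 0])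
  fix a b assume b: "b \<in> leading_ideal A t I d"
  then obtain q where q: "b \<in> A" "q \<in> adjoin_below A t d" "q + b * t ^ d \<in> I"
    by (auto simp: leading_ideal_def)
  {
    assume "a \<in> leading_ideal A t I d"
    then obtain p where p: "a \<in> A" "p \<in> adjoin_below A t d" "p + a * t ^ d \<in> I"
      by (auto simp: leading_ideal_def)
    have "(p + a * t ^ d) + (q + b * t ^ d) \<in> I" using p q I by (auto simp: ideal_of_def)
    then have "(p + q) + (a + b) * t ^ d \<in> I" by (simp add: algebra_simps)
    moreover have "a + b \<in> A" using A p q by (auto simp: subring_set_def)
    ultimately show "a + b \<in> leading_ideal A t I d"
      using p q adjoin_below_add by (auto simp: leading_ideal_def)
  }
  {
    assume a: "a \<in> A"
    have "a * (q + b * t ^ d) \<in> I" using a q I adjoin_superset by (auto simp: ideal_of_def)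
    then have "a * q + (a * b) * t ^ d \<in> I" by (simp add: algebra_simps)
    moreover have "a * b \<in> A" using A a q by (auto simp: subring_set_def)
    ultimately show "a * b \<in> leading_ideal A t I d"
      using a q adjoin_below_scale by (auto simp: leading_ideal_def)
  }
qed

lemma leading_ideal_mono: "I \<subseteq> J \<Longrightarrow> leading_ideal A t I d \<subseteq> leading_ideal A t J d"
  by (auto simp: leading_ideal_def)

text \<open>Multiplication by \<open>t\<close> stays in the ideal and shifts the degree while
  keeping the top coefficient.\<close>

lemma leading_ideal_mono_degree:
  assumes "ideal_of (adjoin A t) I" and "d \<le> e"
  shows "leading_ideal A t I d \<subseteq> leading_ideal A t I e"
  using assms(2)
proof (induction e rule: dec_induct)
  case (step e)
  have "leading_ideal A t I e \<subseteq> leading_ideal A t I (Suc e)"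
  proof
    fix a assume "a \<in> leading_ideal A t I e"
    then obtain p where p: "a \<in> A" "p \<in> adjoin_below A t e" "p + a * t ^ e \<in> I"
      by (auto simp: leading_ideal_def)
    have "t * (p + a * t ^ e) \<in> I" using p assms(1) generator_in_adjoin by (auto simp: ideal_of_def)
    then have "t * p + a * t ^ Suc e \<in> I" by (simp add: algebra_simps)
    with p adjoin_below_shift show "a \<in> leading_ideal A t I (Suc e)" by (auto simp: leading_ideal_def)
  qed
  with step show ?case by blast
qed simp

text \<open>Subtracting from an element of J an element of I with the same top coefficient leaves an
  element of J of smaller degree bound, which lies in I by induction.\<close>

lemma ideal_subset_if_leading_ideals:
  assumes I: "ideal_of (adjoin A t) I" and J: "ideal_of (adjoin A t) J" and "I \<subseteq> J"
    and L: "\<And>d. leading_ideal A t J d \<subseteq> leading_ideal A t I d"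
  shows "J \<subseteq> I"
proof -
  have "f \<in> I" if "f \<in> J" "f \<in> adjoin_below A t d" for f d
    using that
  proof (induction d arbitrary: f)
    case 0
    then show ?case using I by (simp add: adjoin_below_0 ideal_of_def)
  next
    case (Suc d)
    then obtain p a where f: "f = p + a * t ^ d" "p \<in> adjoin_below A t d" "a \<in> A"
      unfolding adjoin_below_Suc by blast
    then have "a \<in> leading_ideal A t J d" using Suc.prems by (auto simp: leading_ideal_def)
    then obtain q where q: "q \<in> adjoin_below A t d" "q + a * t ^ d \<in> I"
      using L by (auto simp: leading_ideal_def)
    have "f - (q + a * t ^ d) \<in> J" using ideal_diff[OF J] Suc.prems q assms(3) by blast
    then have "p - q \<in> J" using f by simp
    then have "p - q \<in> I" using Suc.IH adjoin_below_diff f q by blast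
    then have "(p - q) + (q + a * t ^ d) \<in> I" using I q unfolding ideal_of_def by blast
    then show ?case using f by simp
  qed
  then show ?thesis using J by (auto simp: ideal_of_def adjoin_def)
qed

text \<open>Hilbert's argument: the ideals of leading coefficients determine an ideal among those containing
  it. It does not matter that an element may have several representations as a polynomial in \<open>t\<close>.\<close>

theorem noetherian_adjoin:
  assumes N: "noetherian_set A"
  shows "noetherian_set (adjoin A t)"
  unfolding noetherian_set_def
proof (intro allI impI, elim conjE)
  fix I :: "nat \<Rightarrow> 'r set" assume I: "\<forall>n. ideal_of (adjoin A t) (I n)" and inc: "incseq I"
  define L where "L n d = leading_ideal A t (I n) d" for n d
  have Lid: "ideal_of A (L n d)" for n d using ideal_leading_ideal I by (simp add: L_def)
  have Lmono: "L n d \<subseteq> L n' d'" if "n \<le> n'" "d \<le> d'" for n n' d d'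
  proof -
    have "L n d \<subseteq> L n' d" using leading_ideal_mono inc that by (simp add: L_def incseq_def)
    also have "\<dots> \<subseteq> L n' d'" using leading_ideal_mono_degree I that by (simp add: L_def)
    finally show ?thesis .
  qed
  \<comment> \<open>The diagonal chain controls all degrees from N on at once; the finitely many
    smaller degrees are stabilised one by one, and K is a common bound.\<close>
  have "\<exists>N. \<forall>n\<ge>N. L n n = L N N"
    using N[unfolded noetherian_set_def, rule_format, of "\<lambda>n. L n n"] Lid Lmono by (auto simp: incseq_def)
  then obtain N where N0: "\<And>n. n \<ge> N \<Longrightarrow> L n n = L N N" by blast
  have "\<exists>M. \<forall>n\<ge>M. L n d = L M d" for d
    using N[unfolded noetherian_set_def, rule_format, of "\<lambda>n. L n d"] Lid Lmono by (auto simp: incseq_def)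
  then obtain M where M: "\<And>d n. n \<ge> M d \<Longrightarrow> L n d = L (M d) d" by metis
  define K where "K = Max (insert N (M ` {..<N}))"
  have KN: "N \<le> K" and KM: "\<And>d. d < N \<Longrightarrow> M d \<le> K" by (auto simp: K_def)
  \<comment> \<open>In degrees d at least N the ideal is squeezed between diagonal terms: L n d is
    contained in L e e for e the maximum of n and d, which equals L N N and is contained in L K
    d.\<close>
  have stable: "L n d = L K d" if "n \<ge> K" for n d
  proof (cases "d < N")
    case True
    then show ?thesis using M KM that by (metis order_trans)
  next
    case False
    have "L n d \<subseteq> L (max n d) (max n d)" by (rule Lmono) auto
    also have "\<dots> = L N N" using False by (intro N0) auto
    also have "\<dots> \<subseteq> L K d" using False KN by (intro Lmono) auto
    finally show ?thesis using Lmono[OF that order_refl] by blast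
  qed
  have "I n \<subseteq> I K" if "n \<ge> K" for n
  proof (rule ideal_subset_if_leading_ideals)
    show "ideal_of (adjoin A t) (I K)" "ideal_of (adjoin A t) (I n)" using I by auto
    show "I K \<subseteq> I n" using inc that by (simp add: incseq_def)
    show "leading_ideal A t (I n) d \<subseteq> leading_ideal A t (I K) d" for d
      using stable[OF that] by (simp add: L_def)
  qed
  then show "\<exists>N. \<forall>n\<ge>N. I n = I N" using inc by (meson incseq_def subset_antisym)
qed

end

lemma noetherian_adjoin_finite:
  fixes A :: "'r::comm_ring_1 set"
  assumes "finite T" and "subring_set A" and "noetherian_set A"
  obtains B where "subring_set B" "noetherian_set B" "A \<subseteq> B" "T \<subseteq> B"
proof -
  have "\<exists>B. subring_set B \<and> noetherian_set B \<and> A \<subseteq> B \<and> T \<subseteq> B"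
    using assms
  proof (induction T)
    case (insert t T)
    then obtain B where "subring_set B" "noetherian_set B" "A \<subseteq> B" "T \<subseteq> B" by blast
    then show ?case
      using subring_adjoin[of B t] noetherian_adjoin[of B t] adjoin_superset[of B t]
        generator_in_adjoin[of B t] by (intro exI[of _ "adjoin B t"]) auto
  qed blast
  then show thesis using that by blast
qed

definition constant_functions :: "('v \<Rightarrow> complex) set" where
  "constant_functions = range (\<lambda>c _. c)"

lemma subring_constant_functions: "subring_set (constant_functions :: ('v \<Rightarrow> complex) set)"
proof -
  have iff: "f \<in> constant_functions \<longleftrightarrow> (\<forall>x y. f x = f y)" for f :: "'v \<Rightarrow> complex"
  proof
    assume "\<forall>x y. f x = f y"
    then have "f = (\<lambda>_. f undefined)" by (metis ext)
    then show "f \<in> constant_functions" unfolding constant_functions_def by blast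
  qed (auto simp: constant_functions_def)
  show ?thesis unfolding subring_set_def
  proof (intro conjI ballI)
    show "(0 :: 'v \<Rightarrow> complex) \<in> constant_functions" "(1 :: 'v \<Rightarrow> complex) \<in> constant_functions"
      by (simp_all add: iff)
    fix a b :: "'v \<Rightarrow> complex" assume a: "a \<in> constant_functions" and b: "b \<in> constant_functions"
    have c: "a x = a y" "b x = b y" for x y using a b iff by blast+
    show "a + b \<in> constant_functions" "a * b \<in> constant_functions"
      unfolding iff plus_fun_apply times_fun_apply using c by metis+
  next
    fix a :: "'v \<Rightarrow> complex" assume "a \<in> constant_functions"
    then show "- a \<in> constant_functions" unfolding iff uminus_apply by metis
  qed
qed

text \<open>The constants form a field, so a nonzero ideal is everything and a chain jumps at most
  once.\<close>

lemma noetherian_constant_functions: "noetherian_set (constant_functions :: ('v \<Rightarrow> complex) set)"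
  unfolding noetherian_set_def
proof (intro allI impI, elim conjE)
  fix I :: "nat \<Rightarrow> ('v \<Rightarrow> complex) set"
  assume I: "\<forall>n. ideal_of constant_functions (I n)" and inc: "incseq I"
  show "\<exists>N. \<forall>n\<ge>N. I n = I N"
  proof (cases "\<exists>N. \<exists>f\<in>I N. f \<noteq> 0")
    case True
    then obtain N f where f: "f \<in> I N" "f \<noteq> 0" by blast
    have full: "I n = constant_functions" if "n \<ge> N" for n
    proof -
      have fn: "f \<in> I n" using f inc that by (auto simp: incseq_def)
      then obtain c where c: "f = (\<lambda>_. c)" using I unfolding ideal_of_def constant_functions_def by blast
      then have "c \<noteq> 0" using f(2) by (auto simp: fun_eq_iff)
      have "g \<in> I n" if g: "g \<in> constant_functions" for g
      proof -
        obtain d where d: "g = (\<lambda>_. d)" using g unfolding constant_functions_def by blast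
        have "(\<lambda>_. d / c) * f \<in> I n" using I fn unfolding ideal_of_def constant_functions_def by blast
        moreover have "(\<lambda>_. d / c) * f = g" using c d \<open>c \<noteq> 0\<close> by (auto simp: fun_eq_iff)
        ultimately show ?thesis by simp
      qed
      then show ?thesis using I by (auto simp: ideal_of_def)
    qed
    then show ?thesis by (metis order_refl)
  next
    case False
    then have "I n = {0}" for n using I by (auto simp: ideal_of_def)
    then show ?thesis by simp
  qed
qed

section \<open>Algebraic sets\<close>

text \<open>The coordinates are extended to linear functionals on the whole function space, because
  \<open>polynomial_functions\<close> lives there and not on the span.\<close>

lemma finite_span_coordinates:
  fixes B :: "('x \<Rightarrow> complex) set"
  assumes "finite B" and ind: "cfun.independent B"
  obtains x where "\<And>b. Vector_Spaces.linear cscale (*) (x b)"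
    "\<And>v. v \<in> cfun.span B \<Longrightarrow> v = (\<Sum>b\<in>B. cscale (x b v) b)"
proof -
  have "\<exists>\<phi>. Vector_Spaces.linear cscale (*) \<phi> \<and> (\<forall>b'\<in>B. \<phi> b' = (if b' = b then 1 else 0))" for b
    using cfun_dual.linear_independent_extend[OF ind, of "\<lambda>b'. if b' = b then 1 else 0"] by blast
  then obtain x where lin: "\<And>b. Vector_Spaces.linear cscale (*) (x b)"
    and x: "\<And>b b'. b' \<in> B \<Longrightarrow> x b b' = (if b' = b then 1 else 0)"
    by metis
  have "v = (\<Sum>b\<in>B. cscale (x b v) b)" if v: "v \<in> cfun.span B" for v
  proof -
    obtain c where c: "v = (\<Sum>b\<in>B. cscale (c b) b)"
      using v unfolding cfun.span_finite[OF assms(1)] by blast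
    have "x b v = c b" if "b \<in> B" for b
    proof -
      have "x b v = (\<Sum>b'\<in>B. c b' * x b b')"
        by (simp add: c cfun_dual.linear_sum[OF lin] cfun_dual.linear_scale[OF lin])
      also have "\<dots> = (\<Sum>b'\<in>B. if b' = b then c b else 0)" by (intro sum.cong) (auto simp: x)
      finally show ?thesis using that assms(1) by simp
    qed
    then show ?thesis using c by simp
  qed
  with lin that show thesis by blast
qed

lemma polynomial_functions_compose_linear:
  assumes "Vector_Spaces.linear cscale cscale L" and "p \<in> polynomial_functions"
  shows "(\<lambda>v. p (L v)) \<in> polynomial_functions"
  using assms(2)
proof induction
  case (linear \<phi>)
  have "Vector_Spaces.linear cscale (*) (\<lambda>v. \<phi> (L v))"
    using Vector_Spaces.linear_compose[OF assms(1) linear] by (simp add: o_def)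
  then show ?case by (rule polynomial_functions.linear)
qed (auto intro: polynomial_functions.intros)

lemma polynomial_functions_sum:
  "(\<And>i. i \<in> S \<Longrightarrow> p i \<in> polynomial_functions) \<Longrightarrow> (\<lambda>v. \<Sum>i\<in>S. p i v) \<in> polynomial_functions"
  by (induction S rule: infinite_finite_induct) (auto intro: polynomial_functions.intros)

lemma polynomial_functions_prod:
  "(\<And>i. i \<in> S \<Longrightarrow> p i \<in> polynomial_functions) \<Longrightarrow> (\<lambda>v. \<Prod>i\<in>S. p i v) \<in> polynomial_functions"
  by (induction S rule: infinite_finite_induct) (auto intro: polynomial_functions.intros)

text \<open>R is obtained from the constants by adjoining the finitely many coordinates. Agreement
  is claimed on V alone, where every linear functional is a combination of coordinates; off V the
  ambient functionals are far more numerous.\<close>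

lemma polynomial_functions_noetherian:
  fixes F :: "('x \<Rightarrow> complex) set"
  assumes "finite F" and "V \<subseteq> cfun.span F"
  obtains R where "subring_set R" "noetherian_set R"
    "\<And>p. p \<in> polynomial_functions \<Longrightarrow> \<exists>q\<in>R. \<forall>v\<in>V. p v = q v"
proof -
  obtain B where B: "B \<subseteq> F" "cfun.independent B" "F \<subseteq> cfun.span B"
    by (rule cfun.maximal_independent_subset)
  have fB: "finite B" using B assms finite_subset by blast
  have VB: "V \<subseteq> cfun.span B" using assms B cfun.span_minimal[OF B(3)] by blast
  obtain x where x: "\<And>b. Vector_Spaces.linear cscale (*) (x b)"
    "\<And>v. v \<in> cfun.span B \<Longrightarrow> v = (\<Sum>b\<in>B. cscale (x b v) b)"
    by (rule finite_span_coordinates[OF fB B(2)]) blast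
  have "\<exists>R. subring_set R \<and> noetherian_set R \<and> constant_functions \<subseteq> R \<and> x ` B \<subseteq> R"
    using noetherian_adjoin_finite[OF finite_imageI[OF fB] subring_constant_functions
      noetherian_constant_functions] by metis
  then obtain R' where R': "subring_set R'" "noetherian_set R'" "constant_functions \<subseteq> R'" "x ` B \<subseteq> R'"
    by blast
  have sumR: "(\<And>i. i \<in> S \<Longrightarrow> f i \<in> R') \<Longrightarrow> sum f S \<in> R'" for f :: "('x \<Rightarrow> complex) \<Rightarrow> _" and S
    using R'(1) by (induction S rule: infinite_finite_induct) (auto simp: subring_set_def)
  have "\<exists>q\<in>R'. \<forall>v\<in>V. p v = q v" if "p \<in> polynomial_functions" for p
    using that
  proof induction
    case (const c)
    have "(\<lambda>_. c) \<in> R'" using R'(3) by (auto simp: constant_functions_def)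
    then show ?case by (intro bexI[of _ "\<lambda>_. c"]) auto
  next
    case (linear \<phi>)
    let ?q = "\<Sum>b\<in>B. (\<lambda>_. \<phi> b) * x b"
    have "?q \<in> R'" using R' by (intro sumR) (auto simp: subring_set_def constant_functions_def)
    moreover have "\<phi> v = ?q v" if "v \<in> V" for v
    proof -
      have "\<phi> v = \<phi> (\<Sum>b\<in>B. cscale (x b v) b)" using x(2) VB that by auto
      also have "\<dots> = (\<Sum>b\<in>B. x b v * \<phi> b)"
        by (simp add: cfun_dual.linear_sum[OF linear] cfun_dual.linear_scale[OF linear])
      finally show ?thesis by (simp add: sum_fun_apply mult.commute)
    qed
    ultimately show ?case by blast
  next
    case (add p q)
    then obtain p' q' where "p' \<in> R'" "\<forall>v\<in>V. p v = p' v" "q' \<in> R'" "\<forall>v\<in>V. q v = q' v" by blast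
    then show ?case using R'(1) by (intro bexI[of _ "p' + q'"]) (auto simp: subring_set_def)
  next
    case (mult p q)
    then obtain p' q' where "p' \<in> R'" "\<forall>v\<in>V. p v = p' v" "q' \<in> R'" "\<forall>v\<in>V. q v = q' v" by blast
    then show ?case using R'(1) by (intro bexI[of _ "p' * q'"]) (auto simp: subring_set_def)
  qed
  with R' that show thesis by blast
qed


section \<open>Closed sets, the chain condition and irreducible components\<close>

lemma algebraic_subset: "algebraic_set V Z \<Longrightarrow> Z \<subseteq> V"
  by (auto simp: algebraic_set_def)

lemma algebraic_zeros: "P \<subseteq> polynomial_functions \<Longrightarrow> algebraic_set V {v \<in> V. \<forall>p\<in>P. p v = 0}"
  by (auto simp: algebraic_set_def)

lemma algebraic_self: "algebraic_set V V"
  using algebraic_zeros[of "{}" V] by simp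

lemma algebraic_empty: "algebraic_set V {}"
  using algebraic_zeros[of "{\<lambda>_. 1}" V] polynomial_functions.const by auto

lemma algebraic_Int:
  assumes "algebraic_set V Z" "algebraic_set V W"
  shows "algebraic_set V (Z \<inter> W)"
proof -
  obtain P Q where "P \<subseteq> polynomial_functions" "Z = {v \<in> V. \<forall>p\<in>P. p v = 0}"
    "Q \<subseteq> polynomial_functions" "W = {v \<in> V. \<forall>p\<in>Q. p v = 0}"
    using assms by (auto simp: algebraic_set_def)
  then have "P \<union> Q \<subseteq> polynomial_functions \<and> Z \<inter> W = {v \<in> V. \<forall>p\<in>P \<union> Q. p v = 0}" by blast
  then show ?thesis unfolding algebraic_set_def by blast
qed

lemma algebraic_Un:
  assumes "algebraic_set V Z" "algebraic_set V W"
  shows "algebraic_set V (Z \<union> W)"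
proof -
  obtain P Q where P: "P \<subseteq> polynomial_functions" "Z = {v \<in> V. \<forall>p\<in>P. p v = 0}"
    and Q: "Q \<subseteq> polynomial_functions" "W = {v \<in> V. \<forall>p\<in>Q. p v = 0}"
    using assms by (auto simp: algebraic_set_def)
  let ?R = "{\<lambda>v. p v * q v | p q. p \<in> P \<and> q \<in> Q}"
  have "?R \<subseteq> polynomial_functions" using P Q by (auto intro: polynomial_functions.mult)
  moreover have "Z \<union> W = {v \<in> V. \<forall>r\<in>?R. r v = 0}"
  proof (intro equalityI subsetI)
    fix v assume v: "v \<in> {v \<in> V. \<forall>r\<in>?R. r v = 0}"
    then have "v \<in> V" and r: "\<And>r. r \<in> ?R \<Longrightarrow> r v = 0" by auto
    have "p v = 0 \<or> q v = 0" if "p \<in> P" "q \<in> Q" for p q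
      using r[of "\<lambda>v. p v * q v"] that by auto
    then show "v \<in> Z \<union> W" using \<open>v \<in> V\<close> P Q by blast
  qed (use P Q in auto)
  ultimately show ?thesis unfolding algebraic_set_def by blast
qed

lemma algebraic_Union: "finite F \<Longrightarrow> (\<And>Z. Z \<in> F \<Longrightarrow> algebraic_set V Z) \<Longrightarrow> algebraic_set V (\<Union>F)"
  by (induction F rule: finite_induct) (auto intro: algebraic_Un algebraic_empty)

text \<open>A closed set is recovered from its ideal of vanishing functions in a noetherian ring R,
  and these ideals ascend.\<close>

lemma algebraic_descending_chain:
  assumes "finite F" "V \<subseteq> cfun.span F" and Z: "\<And>n. algebraic_set V (Z n)" and dec: "decseq Z"
  shows "\<exists>N. \<forall>n\<ge>N. Z n = Z N"
proof -
  obtain R where R: "subring_set R" "noetherian_set R"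
    "\<And>p. p \<in> polynomial_functions \<Longrightarrow> \<exists>q\<in>R. \<forall>v\<in>V. p v = q v"
    using polynomial_functions_noetherian[OF assms(1,2)] by metis
  define I where "I n = {q \<in> R. \<forall>v\<in>Z n. q v = 0}" for n
  have "ideal_of R (I n)" for n using R(1) by (auto simp: ideal_of_def I_def subring_set_def)
  moreover have "incseq I" using dec unfolding incseq_def decseq_def I_def by blast
  ultimately obtain N where N: "\<And>n. n \<ge> N \<Longrightarrow> I n = I N"
    using R(2) unfolding noetherian_set_def by metis
  have ZI: "Z n = {v \<in> V. \<forall>q\<in>I n. q v = 0}" for n
  proof (intro equalityI subsetI)
    fix v assume "v \<in> Z n"
    then show "v \<in> {v \<in> V. \<forall>q\<in>I n. q v = 0}" using algebraic_subset[OF Z] by (auto simp: I_def)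
  next
    fix v assume v: "v \<in> {v \<in> V. \<forall>q\<in>I n. q v = 0}"
    obtain P where P: "P \<subseteq> polynomial_functions" "Z n = {v \<in> V. \<forall>p\<in>P. p v = 0}"
      using Z[of n] by (auto simp: algebraic_set_def)
    have "p v = 0" if p: "p \<in> P" for p
    proof -
      obtain q where q: "q \<in> R" "\<forall>v\<in>V. p v = q v" using R(3) P(1) p by blast
      then have "q \<in> I n" using P(2) p by (auto simp: I_def)
      then show ?thesis using v q by auto
    qed
    then show "v \<in> Z n" using P v by auto
  qed
  have "Z n = Z N" if "n \<ge> N" for n by (subst (1 2) ZI) (simp add: N[OF that])
  then show ?thesis by blast
qed

text \<open>Noetherian induction on closed subsets. The empty set is the union of no pieces, since
  irreducible sets are nonempty.\<close>

lemma irreducible_decomposition: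
  assumes "finite F" "V \<subseteq> cfun.span F" and "algebraic_set V Z"
  obtains S where "finite S" "\<And>W. W \<in> S \<Longrightarrow> irreducible_set V W" "Z = \<Union>S"
proof -
  let ?r = "{(Z', Z). algebraic_set V Z' \<and> algebraic_set V Z \<and> Z' \<subset> Z}"
  have wf: "wf ?r"
    unfolding wf_iff_no_infinite_down_chain
  proof
    assume "\<exists>f. \<forall>i. (f (Suc i), f i) \<in> ?r"
    then obtain f where "\<forall>i. (f (Suc i), f i) \<in> ?r" by (rule exE)
    then have f: "\<And>i. algebraic_set V (f i)" "\<And>i. f (Suc i) \<subset> f i" by auto
    have "decseq f" using f(2) by (intro decseq_SucI) auto
    obtain N where "\<forall>n\<ge>N. f n = f N"
      using algebraic_descending_chain[OF assms(1,2) f(1) \<open>decseq f\<close>] by (rule exE)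
    then have "f (Suc N) = f N" by (meson le_Suc_eq order_refl)
    then show False using f(2)[of N] by simp
  qed
  have "\<exists>S. finite S \<and> (\<forall>W\<in>S. irreducible_set V W) \<and> Z = \<Union>S"
    using assms(3)
  proof (induction Z rule: wf_induct_rule[OF wf])
    case (1 Z)
    consider "Z = {}" | "irreducible_set V Z" | "Z \<noteq> {}" "\<not> irreducible_set V Z" by blast
    then show ?case
    proof cases
      case 1
      then show ?thesis by (intro exI[of _ "{}"]) auto
    next
      case 2
      then show ?thesis by (intro exI[of _ "{Z}"]) auto
    next
      case 3
      then obtain Z1 Z2 where Z12: "algebraic_set V Z1" "algebraic_set V Z2" "Z = Z1 \<union> Z2" "Z \<noteq> Z1" "Z \<noteq> Z2"
        using 1(2) unfolding irreducible_set_def by metis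
      then have "(Z1, Z) \<in> ?r" "(Z2, Z) \<in> ?r" using 1(2) by auto
      then obtain S1 S2 where "finite S1 \<and> (\<forall>W\<in>S1. irreducible_set V W) \<and> Z1 = \<Union>S1"
        "finite S2 \<and> (\<forall>W\<in>S2. irreducible_set V W) \<and> Z2 = \<Union>S2"
        using 1(1)[of Z1] 1(1)[of Z2] Z12(1,2) by blast
      then show ?thesis using Z12(3) by (intro exI[of _ "S1 \<union> S2"]) auto
    qed
  qed
  then show thesis using that by blast
qed

lemma irreducible_algebraic: "irreducible_set V Z \<Longrightarrow> algebraic_set V Z"
  and irreducible_nonempty: "irreducible_set V Z \<Longrightarrow> Z \<noteq> {}"
  by (auto simp: irreducible_set_def)

lemma irreducible_split:
  assumes "irreducible_set V Z" "algebraic_set V Z1" "algebraic_set V Z2" "Z = Z1 \<union> Z2"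
  shows "Z = Z1 \<or> Z = Z2"
  using assms unfolding irreducible_set_def by blast

lemma irreducible_subset_Un:
  assumes "irreducible_set V Z" "algebraic_set V W1" "algebraic_set V W2" "Z \<subseteq> W1 \<union> W2"
  shows "Z \<subseteq> W1 \<or> Z \<subseteq> W2"
proof -
  have "algebraic_set V (Z \<inter> W1)" "algebraic_set V (Z \<inter> W2)" "Z = (Z \<inter> W1) \<union> (Z \<inter> W2)"
    using assms by (auto intro: algebraic_Int irreducible_algebraic)
  then have "Z = Z \<inter> W1 \<or> Z = Z \<inter> W2" using assms(1) unfolding irreducible_set_def by blast
  then show ?thesis by blast
qed

lemma irreducible_subset_Union:
  assumes "irreducible_set V Z" "finite S" "\<And>W. W \<in> S \<Longrightarrow> algebraic_set V W" "Z \<subseteq> \<Union>S"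
  shows "\<exists>W\<in>S. Z \<subseteq> W"
  using assms(2-)
proof (induction S rule: finite_induct)
  case empty
  then show ?case using irreducible_nonempty[OF assms(1)] by auto
next
  case (insert W S)
  then have "Z \<subseteq> W \<or> Z \<subseteq> \<Union>S"
    by (intro irreducible_subset_Un[OF assms(1)] algebraic_Union) auto
  then show ?case using insert by blast
qed

text \<open>A component lies in one of the finitely many pieces of a decomposition and equals it by
  maximality.\<close>

lemma finite_irreducible_components:
  assumes "finite F" "V \<subseteq> cfun.span F" and "algebraic_set V R"
  shows "finite (irreducible_components V R)"
proof -
  obtain S where S: "finite S" "\<And>W. W \<in> S \<Longrightarrow> irreducible_set V W" "R = \<Union>S"
    using irreducible_decomposition[OF assms] by metis
  have "irreducible_components V R \<subseteq> S"
  proof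
    fix Z assume Z: "Z \<in> irreducible_components V R"
    then obtain W where "W \<in> S" "Z \<subseteq> W"
      using irreducible_subset_Union[of V Z S] S irreducible_algebraic
      by (auto simp: irreducible_components_def)
    moreover have "W = Z"
      using Z calculation S unfolding irreducible_components_def by blast
    ultimately show "Z \<in> S" by simp
  qed
  then show ?thesis using S(1) finite_subset by blast
qed

section \<open>Linear subspaces and dimension\<close>

text \<open>Reduces the irreducibility of a linear subspace to the absence of zero divisors among
  polynomials in one variable.\<close>

lemma polynomial_on_line:
  assumes "p \<in> polynomial_functions"
  shows "\<exists>P. \<forall>t. p (v + cscale t (w - v)) = poly P t"
  using assms
proof induction
  case (const c)
  show ?case by (intro exI[of _ "[:c:]"]) simp
next
  case (linear \<phi>)
  have "\<phi> (v + cscale t (w - v)) = poly [:\<phi> v, \<phi> w - \<phi> v:] t" for t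
    unfolding cfun_dual.linear_add[OF linear] cfun_dual.linear_scale[OF linear] cfun_dual.linear_diff[OF linear]
    by simp
  then show ?case by blast
next
  case (add p q)
  then obtain P Q where "\<forall>t. p (v + cscale t (w - v)) = poly P t" "\<forall>t. q (v + cscale t (w - v)) = poly Q t"
    by blast
  then have "p (v + cscale t (w - v)) + q (v + cscale t (w - v)) = poly (P + Q) t" for t
    by (simp only: poly_add)
  then show ?case by blast
next
  case (mult p q)
  then obtain P Q where "\<forall>t. p (v + cscale t (w - v)) = poly P t" "\<forall>t. q (v + cscale t (w - v)) = poly Q t"
    by blast
  then have "p (v + cscale t (w - v)) * q (v + cscale t (w - v)) = poly (P * Q) t" for t
    by (simp only: poly_mult)
  then show ?case by blast
qed

text \<open>Join a point outside Z1 to a point outside Z2 by a line, which stays in U. Equations p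
  and q violated at the two ends have a product vanishing along the line, so one of them is zero
  along it, although p is nonzero at t = 0 and q at t = 1.\<close>

lemma irreducible_subspace:
  assumes U: "cfun.subspace U" and alg: "algebraic_set V U"
  shows "irreducible_set V U"
  unfolding irreducible_set_def
proof (intro conjI allI impI alg; (elim conjE)?)
  show "U \<noteq> {}" using U cfun.subspace_0 by auto
next
  fix Z1 Z2 assume "algebraic_set V Z1" "algebraic_set V Z2" and UZ: "U = Z1 \<union> Z2"
  then obtain P Q where P: "P \<subseteq> polynomial_functions" "Z1 = {v \<in> V. \<forall>p\<in>P. p v = 0}"
    and Q: "Q \<subseteq> polynomial_functions" "Z2 = {v \<in> V. \<forall>p\<in>Q. p v = 0}"
    by (auto simp: algebraic_set_def)
  show "U = Z1 \<or> U = Z2"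
  proof (rule ccontr)
    assume "\<not> (U = Z1 \<or> U = Z2)"
    then obtain v w where v: "v \<in> U" "v \<notin> Z1" and w: "w \<in> U" "w \<notin> Z2" using UZ by blast
    have "v \<in> V" "w \<in> V" using v w algebraic_subset[OF alg] by auto
    then obtain p q where p: "p \<in> P" "p v \<noteq> 0" and q: "q \<in> Q" "q w \<noteq> 0"
      using v(2) w(2) P(2) Q(2) by auto
    have pq: "p \<in> polynomial_functions" "q \<in> polynomial_functions" using p q P Q by auto
    obtain P' Q' where P': "\<And>t. p (v + cscale t (w - v)) = poly P' t"
      and Q': "\<And>t. q (v + cscale t (w - v)) = poly Q' t"
      using polynomial_on_line[OF pq(1)] polynomial_on_line[OF pq(2)] by metis
    have "poly (P' * Q') t = 0" for t
    proof -
      have "v + cscale t (w - v) \<in> U"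
        using U v w by (intro cfun.subspace_add cfun.subspace_scale cfun.subspace_diff) auto
      then have "p (v + cscale t (w - v)) = 0 \<or> q (v + cscale t (w - v)) = 0"
        using UZ P Q p q by blast
      then show ?thesis using P' Q' by auto
    qed
    then have "P' * Q' = 0" using poly_all_0_iff_0 by blast
    then have "P' = 0 \<or> Q' = 0" by simp
    moreover have "v + cscale 0 (w - v) = v" "v + cscale 1 (w - v) = w" by (auto simp: fun_eq_iff)
    ultimately show False using p q P'[of 0] Q'[of 1] by auto
  qed
qed

lemma zariski_dim_ge:
  assumes "\<And>i. i \<le> n \<Longrightarrow> irreducible_set V (C i) \<and> C i \<subseteq> Z" "\<And>i. i < n \<Longrightarrow> C i \<subset> C (Suc i)"
  shows "enat n \<le> zariski_dim V Z"
  unfolding zariski_dim_def using assms by (intro Sup_upper) blast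

text \<open>Nonempty sets cannot grow strictly inside a point. The empty set is covered too: its
  dimension is a supremum over no chains, which is 0.\<close>

lemma zariski_dim_subset_zero:
  assumes "Z \<subseteq> {0}"
  shows "zariski_dim V Z = 0"
proof -
  have "x = 0" if x: "x \<in> {enat n | n. \<exists>C :: nat \<Rightarrow> ('a \<Rightarrow> complex) set.
       (\<forall>i\<le>n. irreducible_set V (C i) \<and> C i \<subseteq> Z) \<and> (\<forall>i<n. C i \<subset> C (Suc i))}" for x
  proof -
    obtain n C where C: "x = enat n" "\<And>i. i \<le> n \<Longrightarrow> irreducible_set V (C i) \<and> C i \<subseteq> Z"
       "\<And>i. i < n \<Longrightarrow> C i \<subset> C (Suc i)"
      using x by blast
    have "n = 0"
    proof (rule ccontr)
      assume "n \<noteq> 0"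
      then have "C 0 \<noteq> {}" "C 1 \<subseteq> {0}" "C 0 \<subset> C 1"
        using C(2)[of 0] C(2)[of 1] C(3)[of 0] irreducible_nonempty assms by auto
      then show False by blast
    qed
    then show ?thesis using C(1) by (simp add: zero_enat_def)
  qed
  then show ?thesis unfolding zariski_dim_def
    by (metis (mono_tags, lifting) Sup_least le_zero_eq)
qed


section \<open>Transport along a linear embedding with closed image\<close>

text \<open>Both \<open>i\<close> and its left inverse \<open>r\<close> are linear on the full
  function spaces, so polynomial functions can be composed with either. For groups they come from a
  projection and its section.\<close>

locale linear_embedding =
  fixes V1 :: "('x \<Rightarrow> complex) set" and V2 :: "('y \<Rightarrow> complex) set"
    and i :: "('x \<Rightarrow> complex) \<Rightarrow> 'y \<Rightarrow> complex" and r :: "('y \<Rightarrow> complex) \<Rightarrow> 'x \<Rightarrow> complex"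
  assumes linear_i: "Vector_Spaces.linear cscale cscale i"
    and linear_r: "Vector_Spaces.linear cscale cscale r"
    and i_V: "i ` V1 \<subseteq> V2" and r_V: "r ` V2 \<subseteq> V1" and r_i: "v \<in> V1 \<Longrightarrow> r (i v) = v"
    and algebraic_image: "algebraic_set V2 (i ` V1)"
begin

text \<open>Equations travel back along \<open>i\<close> and forward along \<open>r\<close>. In the
  forward direction they cut out the image only inside \<open>i\<close> applied to
  \<open>V1\<close>, which is why that set has to be closed.\<close>

lemma algebraic_image_iff:
  assumes "Z \<subseteq> V1"
  shows "algebraic_set V2 (i ` Z) \<longleftrightarrow> algebraic_set V1 Z"
proof
  assume "algebraic_set V2 (i ` Z)"
  then obtain P where P: "P \<subseteq> polynomial_functions" "i ` Z = {v \<in> V2. \<forall>p\<in>P. p v = 0}"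
    by (auto simp: algebraic_set_def)
  let ?Q = "(\<lambda>p v. p (i v)) ` P"
  have "?Q \<subseteq> polynomial_functions"
    using P(1) polynomial_functions_compose_linear[OF linear_i] by auto
  moreover have "Z = {v \<in> V1. \<forall>p\<in>?Q. p v = 0}"
  proof (intro equalityI subsetI)
    fix v assume "v \<in> Z"
    then have "v \<in> V1" "i v \<in> {v \<in> V2. \<forall>p\<in>P. p v = 0}" using assms P(2) by auto
    then show "v \<in> {v \<in> V1. \<forall>p\<in>?Q. p v = 0}" by auto
  next
    fix v assume v: "v \<in> {v \<in> V1. \<forall>p\<in>?Q. p v = 0}"
    then have "i v \<in> i ` Z" using P(2) i_V by auto
    then obtain z where "z \<in> Z" "i v = i z" by auto
    then have "v = z" using r_i[of v] r_i[of z] v assms by auto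
    with \<open>z \<in> Z\<close> show "v \<in> Z" by simp
  qed
  ultimately show "algebraic_set V1 Z" unfolding algebraic_set_def by blast
next
  assume "algebraic_set V1 Z"
  then obtain P where P: "P \<subseteq> polynomial_functions" "Z = {v \<in> V1. \<forall>p\<in>P. p v = 0}"
    by (auto simp: algebraic_set_def)
  let ?Q = "(\<lambda>p v. p (r v)) ` P"
  have Q: "?Q \<subseteq> polynomial_functions"
    using P(1) polynomial_functions_compose_linear[OF linear_r] by auto
  have "i ` Z = i ` V1 \<inter> {v \<in> V2. \<forall>p\<in>?Q. p v = 0}"
    using P(2) i_V r_i by auto
  then show "algebraic_set V2 (i ` Z)"
    using algebraic_Int[OF algebraic_image algebraic_zeros[OF Q]] by simp
qed

lemma subset_image: "Z \<subseteq> i ` V1 \<Longrightarrow> r ` Z \<subseteq> V1 \<and> i ` r ` Z = Z"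
  using r_i i_V r_V by (force simp: image_iff)

lemma r_image: "Z \<subseteq> V1 \<Longrightarrow> r ` i ` Z = Z"
  using r_i by (force simp: image_iff subset_iff)

lemma irreducible_image_iff:
  assumes "Z \<subseteq> V1"
  shows "irreducible_set V2 (i ` Z) \<longleftrightarrow> irreducible_set V1 Z"
proof
  assume irr: "irreducible_set V2 (i ` Z)"
  show "irreducible_set V1 Z"
    unfolding irreducible_set_def
  proof (intro conjI allI impI; (elim conjE)?)
    show "algebraic_set V1 Z" "Z \<noteq> {}"
      using irr algebraic_image_iff[OF assms] by (auto simp: irreducible_set_def)
    fix Z1 Z2 assume Z: "algebraic_set V1 Z1" "algebraic_set V1 Z2" "Z = Z1 \<union> Z2"
    have sub: "Z1 \<subseteq> V1" "Z2 \<subseteq> V1" using Z algebraic_subset by auto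
    have "i ` Z = i ` Z1 \<union> i ` Z2" using Z by auto
    then have "i ` Z = i ` Z1 \<or> i ` Z = i ` Z2"
      using Z(1,2) algebraic_image_iff[OF sub(1)] algebraic_image_iff[OF sub(2)]
      by (intro irreducible_split[OF irr]) simp_all
    then show "Z = Z1 \<or> Z = Z2" using r_image assms sub by metis
  qed
next
  assume irr: "irreducible_set V1 Z"
  show "irreducible_set V2 (i ` Z)"
    unfolding irreducible_set_def
  proof (intro conjI allI impI; (elim conjE)?)
    show "algebraic_set V2 (i ` Z)" "i ` Z \<noteq> {}"
      using irr algebraic_image_iff[OF assms] by (auto simp: irreducible_set_def)
    fix Z1 Z2 assume Z: "algebraic_set V2 Z1" "algebraic_set V2 Z2" "i ` Z = Z1 \<union> Z2"
    have "Z1 \<subseteq> i ` V1" "Z2 \<subseteq> i ` V1" using Z(3) assms by auto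
    then have sub: "r ` Z1 \<subseteq> V1" "i ` r ` Z1 = Z1" "r ` Z2 \<subseteq> V1" "i ` r ` Z2 = Z2"
      using subset_image by auto
    have "r ` i ` Z = r ` Z1 \<union> r ` Z2" using Z(3) by (simp add: image_Un)
    then have "Z = r ` Z1 \<union> r ` Z2" using r_image[OF assms] by simp
    moreover have "algebraic_set V1 (r ` Z1)" "algebraic_set V1 (r ` Z2)"
      using algebraic_image_iff[OF sub(1)] algebraic_image_iff[OF sub(3)] sub(2,4) Z by auto
    ultimately have "Z = r ` Z1 \<or> Z = r ` Z2" by (intro irreducible_split[OF irr])
    then show "i ` Z = Z1 \<or> i ` Z = Z2" using sub(2,4) by auto
  qed
qed

lemma zariski_dim_image:
  assumes "Z \<subseteq> V1"
  shows "zariski_dim V2 (i ` Z) = zariski_dim V1 Z"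
proof -
  have "(\<exists>C. (\<forall>k\<le>n. irreducible_set V2 (C k) \<and> C k \<subseteq> i ` Z) \<and> (\<forall>k<n. C k \<subset> C (Suc k))) \<longleftrightarrow>
        (\<exists>C. (\<forall>k\<le>n. irreducible_set V1 (C k) \<and> C k \<subseteq> Z) \<and> (\<forall>k<n. C k \<subset> C (Suc k)))" for n :: nat
  proof
    assume "\<exists>C. (\<forall>k\<le>n. irreducible_set V2 (C k) \<and> C k \<subseteq> i ` Z) \<and> (\<forall>k<n. C k \<subset> C (Suc k))"
    then obtain C where C: "\<And>k. k \<le> n \<Longrightarrow> irreducible_set V2 (C k)" "\<And>k. k \<le> n \<Longrightarrow> C k \<subseteq> i ` Z"
      "\<And>k. k < n \<Longrightarrow> C k \<subset> C (Suc k)" by blast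
    have sub: "r ` C k \<subseteq> V1" "i ` r ` C k = C k" "r ` C k \<subseteq> Z" if "k \<le> n" for k
    proof -
      have "C k \<subseteq> i ` V1" using C(2)[OF that] assms by auto
      then show "r ` C k \<subseteq> V1" "i ` r ` C k = C k" using subset_image by auto
      show "r ` C k \<subseteq> Z" using C(2)[OF that] r_image[OF assms] by blast
    qed
    have "irreducible_set V1 (r ` C k)" if "k \<le> n" for k
      using irreducible_image_iff[OF sub(1)[OF that]] sub(2)[OF that] C(1)[OF that] by simp
    moreover have "r ` C k \<subset> r ` C (Suc k)" if "k < n" for k
      using C(3)[OF that] sub(2)[of k] sub(2)[of "Suc k"] that
      by (metis Suc_leI image_mono less_imp_le psubset_eq)
    ultimately show "\<exists>C. (\<forall>k\<le>n. irreducible_set V1 (C k) \<and> C k \<subseteq> Z) \<and> (\<forall>k<n. C k \<subset> C (Suc k))"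
      using sub(3) by (intro exI[of _ "\<lambda>k. r ` C k"]) auto
  next
    assume "\<exists>C. (\<forall>k\<le>n. irreducible_set V1 (C k) \<and> C k \<subseteq> Z) \<and> (\<forall>k<n. C k \<subset> C (Suc k))"
    then obtain C where C: "\<And>k. k \<le> n \<Longrightarrow> irreducible_set V1 (C k)" "\<And>k. k \<le> n \<Longrightarrow> C k \<subseteq> Z"
      "\<And>k. k < n \<Longrightarrow> C k \<subset> C (Suc k)" by blast
    have sub: "C k \<subseteq> V1" if "k \<le> n" for k using C(2)[OF that] assms by auto
    have "irreducible_set V2 (i ` C k)" if "k \<le> n" for k
      using irreducible_image_iff[OF sub[OF that]] C(1)[OF that] by simp
    moreover have "i ` C k \<subset> i ` C (Suc k)" if "k < n" for k
      using C(3)[OF that] r_image[OF sub[of k]] r_image[OF sub[of "Suc k"]] that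
      by (metis Suc_leI image_mono less_imp_le psubset_eq)
    moreover have "i ` C k \<subseteq> i ` Z" if "k \<le> n" for k using C(2)[OF that] by blast
    ultimately show "\<exists>C. (\<forall>k\<le>n. irreducible_set V2 (C k) \<and> C k \<subseteq> i ` Z) \<and> (\<forall>k<n. C k \<subset> C (Suc k))"
      by (intro exI[of _ "\<lambda>k. i ` C k"]) auto
  qed
  then show ?thesis unfolding zariski_dim_def by presburger
qed

lemma inj_on_image_Pow: "inj_on (image i) (Pow V1)"
  by (metis PowD inj_onI r_image)

end

section \<open>Components of a union of two embedded pieces\<close>

definition components_of_dim :: "('x \<Rightarrow> complex) set \<Rightarrow> ('x \<Rightarrow> complex) set \<Rightarrow> nat \<Rightarrow> ('x \<Rightarrow> complex) set set" where
  "components_of_dim V R m = {Z \<in> irreducible_components V R. zariski_dim V Z = enat m}"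

lemma components_of_dim_subset: "components_of_dim V R m \<subseteq> Pow V"
  by (auto simp: components_of_dim_def irreducible_components_def irreducible_set_def algebraic_set_def)

text \<open>A positive-dimensional component of \<open>i1 ` R1\<close> is not contained in the other piece,
  as both meet in the origin only.\<close>

lemma components_of_dim_union_half:
  assumes e1: "linear_embedding V1 V i1 r1" and e2: "linear_embedding V2 V i2 r2"
    and R: "R1 \<subseteq> V1" "R2 \<subseteq> V2" "algebraic_set V1 R1" "algebraic_set V2 R2"
    and int: "i1 ` V1 \<inter> i2 ` V2 \<subseteq> {0}" and m: "m \<ge> 1"
  shows "{Z \<in> components_of_dim V (i1 ` R1 \<union> i2 ` R2) m. Z \<subseteq> i1 ` R1} = image i1 ` components_of_dim V1 R1 m"
proof -
  interpret e1: linear_embedding V1 V i1 r1 by (rule e1)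
  interpret e2: linear_embedding V2 V i2 r2 by (rule e2)
  have alg: "algebraic_set V (i1 ` R1)" "algebraic_set V (i2 ` R2)"
    using R e1.algebraic_image_iff e2.algebraic_image_iff by auto
  show ?thesis
  proof (intro equalityI subsetI)
    fix Z assume "Z \<in> {Z \<in> components_of_dim V (i1 ` R1 \<union> i2 ` R2) m. Z \<subseteq> i1 ` R1}"
    then have Z: "irreducible_set V Z" "Z \<subseteq> i1 ` R1" "zariski_dim V Z = enat m"
      "\<And>Z'. irreducible_set V Z' \<Longrightarrow> Z \<subseteq> Z' \<Longrightarrow> Z' \<subseteq> i1 ` R1 \<union> i2 ` R2 \<Longrightarrow> Z' = Z"
      by (auto simp: components_of_dim_def irreducible_components_def)
    have "Z \<subseteq> i1 ` V1" using Z(2) R(1) by blast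
    then have Y: "r1 ` Z \<subseteq> V1" "i1 ` r1 ` Z = Z" using e1.subset_image by auto
    have "r1 ` Z \<subseteq> R1" using Z(2) e1.r_image[OF R(1)] by blast
    moreover have "irreducible_set V1 (r1 ` Z)" using e1.irreducible_image_iff[OF Y(1)] Y(2) Z(1) by simp
    moreover have "Z' = r1 ` Z" if Z': "irreducible_set V1 Z'" "r1 ` Z \<subseteq> Z'" "Z' \<subseteq> R1" for Z'
    proof -
      have "Z' \<subseteq> V1" using Z' R by auto
      moreover have "i1 ` Z' = Z"
      proof (rule Z(4))
        show "irreducible_set V (i1 ` Z')" using e1.irreducible_image_iff[of Z'] Z' R by auto
        show "Z \<subseteq> i1 ` Z'" using Y(2) Z'(2) by blast
        show "i1 ` Z' \<subseteq> i1 ` R1 \<union> i2 ` R2" using Z'(3) by blast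
      qed
      ultimately show ?thesis using e1.r_image by blast
    qed
    moreover have "zariski_dim V1 (r1 ` Z) = enat m" using e1.zariski_dim_image[OF Y(1)] Y(2) Z(3) by simp
    ultimately have "r1 ` Z \<in> components_of_dim V1 R1 m"
      unfolding components_of_dim_def irreducible_components_def by auto
    then show "Z \<in> image i1 ` components_of_dim V1 R1 m" using Y(2) by (metis imageI)
  next
    fix Z assume "Z \<in> image i1 ` components_of_dim V1 R1 m"
    then obtain Y where Y: "Z = i1 ` Y" "irreducible_set V1 Y" "Y \<subseteq> R1" "zariski_dim V1 Y = enat m"
      and max: "\<And>Z'. irreducible_set V1 Z' \<Longrightarrow> Y \<subseteq> Z' \<Longrightarrow> Z' \<subseteq> R1 \<Longrightarrow> Z' = Y"
      by (auto simp: components_of_dim_def irreducible_components_def)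
    have YV: "Y \<subseteq> V1" using Y R by auto
    have dim: "zariski_dim V Z = enat m" using e1.zariski_dim_image[OF YV] Y by simp
    have irr: "irreducible_set V Z" using e1.irreducible_image_iff[OF YV] Y by simp
    have "Z' = Z" if Z': "irreducible_set V Z'" "Z \<subseteq> Z'" "Z' \<subseteq> i1 ` R1 \<union> i2 ` R2" for Z'
    proof -
      have "\<not> Z' \<subseteq> i2 ` R2"
      proof
        assume "Z' \<subseteq> i2 ` R2"
        then have "Z \<subseteq> {0}" using Z'(2) Y(1) YV R int by blast
        then have "zariski_dim V Z = 0" by (rule zariski_dim_subset_zero)
        then show False using dim m by (simp add: zero_enat_def)
      qed
      then have sub: "Z' \<subseteq> i1 ` R1" using irreducible_subset_Un[OF Z'(1) alg Z'(3)] by blast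
      then have "Z' \<subseteq> i1 ` V1" using R by auto
      then have Y': "r1 ` Z' \<subseteq> V1" "i1 ` r1 ` Z' = Z'" using e1.subset_image by auto
      have "r1 ` Z' = Y"
      proof (rule max)
        show "irreducible_set V1 (r1 ` Z')" using e1.irreducible_image_iff[OF Y'(1)] Y'(2) Z'(1) by simp
        show "Y \<subseteq> r1 ` Z'" using Z'(2) Y(1) e1.r_image[OF YV] by blast
        show "r1 ` Z' \<subseteq> R1" using sub e1.r_image[OF R(1)] by blast
      qed
      then show ?thesis using Y' Y(1) by simp
    qed
    then show "Z \<in> {Z \<in> components_of_dim V (i1 ` R1 \<union> i2 ` R2) m. Z \<subseteq> i1 ` R1}"
      using irr dim Y(1,3) unfolding components_of_dim_def irreducible_components_def by blast
  qed
qed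

text \<open>By irreducibility a component lies in one piece, and one lying in both would be
  contained in the origin. For m = 0 the count can fail, as {0} may be a component on both
  sides.\<close>

lemma card_components_of_dim_union:
  assumes e1: "linear_embedding V1 V i1 r1" and e2: "linear_embedding V2 V i2 r2"
    and R: "R1 \<subseteq> V1" "R2 \<subseteq> V2" "algebraic_set V1 R1" "algebraic_set V2 R2"
    and int: "i1 ` V1 \<inter> i2 ` V2 \<subseteq> {0}" and m: "m \<ge> 1"
    and fin: "finite (components_of_dim V1 R1 m)" "finite (components_of_dim V2 R2 m)"
  shows "card (components_of_dim V (i1 ` R1 \<union> i2 ` R2) m) =
    card (components_of_dim V1 R1 m) + card (components_of_dim V2 R2 m)"
proof -
  interpret e1: linear_embedding V1 V i1 r1 by (rule e1)
  interpret e2: linear_embedding V2 V i2 r2 by (rule e2)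
  let ?C = "components_of_dim V (i1 ` R1 \<union> i2 ` R2) m"
  have alg: "algebraic_set V (i1 ` R1)" "algebraic_set V (i2 ` R2)"
    using R e1.algebraic_image_iff e2.algebraic_image_iff by auto
  have 1: "{Z \<in> ?C. Z \<subseteq> i1 ` R1} = image i1 ` components_of_dim V1 R1 m"
    by (rule components_of_dim_union_half[OF e1 e2 R int m])
  have "{Z \<in> components_of_dim V (i2 ` R2 \<union> i1 ` R1) m. Z \<subseteq> i2 ` R2} = image i2 ` components_of_dim V2 R2 m"
    using int by (intro components_of_dim_union_half[OF e2 e1 R(2,1,4,3) _ m]) auto
  then have 2: "{Z \<in> ?C. Z \<subseteq> i2 ` R2} = image i2 ` components_of_dim V2 R2 m" by (simp add: Un_commute)
  have "Z \<subseteq> i1 ` R1 \<or> Z \<subseteq> i2 ` R2" if "Z \<in> ?C" for Z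
    using that irreducible_subset_Un[OF _ alg]
    unfolding components_of_dim_def irreducible_components_def by blast
  then have "?C = {Z \<in> ?C. Z \<subseteq> i1 ` R1} \<union> {Z \<in> ?C. Z \<subseteq> i2 ` R2}" by blast
  then have C: "?C = image i1 ` components_of_dim V1 R1 m \<union> image i2 ` components_of_dim V2 R2 m"
    unfolding 1 2 .
  have "image i1 ` components_of_dim V1 R1 m \<inter> image i2 ` components_of_dim V2 R2 m = {}"
  proof (rule ccontr)
    assume "image i1 ` components_of_dim V1 R1 m \<inter> image i2 ` components_of_dim V2 R2 m \<noteq> {}"
    then obtain Z where "Z \<in> ?C" "Z \<subseteq> i1 ` R1" "Z \<subseteq> i2 ` R2" unfolding 1[symmetric] 2[symmetric] by blast
    then have "Z \<subseteq> i1 ` V1" "Z \<subseteq> i2 ` V2" "zariski_dim V Z = enat m"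
      using R(1,2) unfolding components_of_dim_def by blast+
    then have "Z \<subseteq> {0}" "zariski_dim V Z = enat m" using int by auto
    then show False using zariski_dim_subset_zero[of Z V] m by (simp add: zero_enat_def)
  qed
  then have "card ?C = card (image i1 ` components_of_dim V1 R1 m) + card (image i2 ` components_of_dim V2 R2 m)"
    unfolding C using fin by (intro card_Un_disjoint) auto
  then show ?thesis
    using card_image[OF inj_on_subset[OF e1.inj_on_image_Pow components_of_dim_subset]]
      card_image[OF inj_on_subset[OF e2.inj_on_image_Pow components_of_dim_subset]] by simp
qed

section \<open>The lower central series\<close>

abbreviation commutator :: "('a, 'b) monoid_scheme \<Rightarrow> 'a \<Rightarrow> 'a \<Rightarrow> 'a" where
  "commutator G x y \<equiv> x \<otimes>\<^bsub>G\<^esub> y \<otimes>\<^bsub>G\<^esub> inv\<^bsub>G\<^esub> x \<otimes>\<^bsub>G\<^esub> inv\<^bsub>G\<^esub> y"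

lemma lower_central_1: "k \<le> 1 \<Longrightarrow> lower_central G k = carrier G"
  by (cases k) auto

lemma lower_central_Suc:
  "k \<ge> 1 \<Longrightarrow> lower_central G (Suc k) = commutator_subgroup G (lower_central G k) (carrier G)"
  by (cases k) auto

lemma (in group) commutator_conj:
  assumes "x \<in> carrier G" "y \<in> carrier G" "g \<in> carrier G"
  shows "g \<otimes> commutator G x y \<otimes> inv g = commutator G (g \<otimes> x \<otimes> inv g) (g \<otimes> y \<otimes> inv g)"
proof -
  have c: "inv g \<otimes> (g \<otimes> z) = z" if "z \<in> carrier G" for z
    using assms that by (simp add: m_assoc[symmetric])
  show ?thesis using assms by (simp add: m_assoc inv_mult_group c)
qed

text \<open>Together with \<open>commutator_mult_right\<close>: up to conjugation the commutator is
  multiplicative in each argument. Conjugation is invisible on graded pieces, so there it becomes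
  bilinear.\<close>

lemma (in group) commutator_mult_left:
  assumes "x \<in> carrier G" "y \<in> carrier G" "z \<in> carrier G"
  shows "commutator G (x \<otimes> y) z = (x \<otimes> commutator G y z \<otimes> inv x) \<otimes> commutator G x z"
proof -
  have c: "inv g \<otimes> (g \<otimes> w) = w" "g \<otimes> (inv g \<otimes> w) = w" if "g \<in> carrier G" "w \<in> carrier G" for g w
    using that by (simp_all add: m_assoc[symmetric])
  show ?thesis using assms by (simp add: m_assoc inv_mult_group c)
qed

lemma (in group) commutator_mult_right:
  assumes "x \<in> carrier G" "y \<in> carrier G" "z \<in> carrier G"
  shows "commutator G x (y \<otimes> z) = commutator G x y \<otimes> (y \<otimes> commutator G x z \<otimes> inv y)"
proof -
  have c: "inv g \<otimes> (g \<otimes> w) = w" "g \<otimes> (inv g \<otimes> w) = w" if "g \<in> carrier G" "w \<in> carrier G" for g w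
    using that by (simp_all add: m_assoc[symmetric])
  show ?thesis using assms by (simp add: m_assoc inv_mult_group c)
qed

lemma (in group) commutator_subgroup_normal:
  assumes H: "H \<lhd> G"
  shows "commutator_subgroup G H (carrier G) \<lhd> G"
  unfolding commutator_subgroup_def
proof (rule normal_generateI)
  interpret H: normal H G by (rule H)
  show "(\<Union>h\<in>H. \<Union>k\<in>carrier G. {commutator G h k}) \<subseteq> carrier G"
    using H.subset by auto
  fix c g assume "c \<in> (\<Union>h\<in>H. \<Union>k\<in>carrier G. {commutator G h k})" and g: "g \<in> carrier G"
  then obtain h k where hk: "h \<in> H" "k \<in> carrier G" "c = commutator G h k" by auto
  then have "h \<in> carrier G" using H.subset by auto
  then have "g \<otimes> c \<otimes> inv g = commutator G (g \<otimes> h \<otimes> inv g) (g \<otimes> k \<otimes> inv g)"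
    unfolding hk(3) using hk(2) g by (rule commutator_conj)
  moreover have "g \<otimes> h \<otimes> inv g \<in> H" using H.inv_op_closed2 g hk by auto
  moreover have "g \<otimes> k \<otimes> inv g \<in> carrier G" using g hk by auto
  ultimately show "g \<otimes> c \<otimes> inv g \<in> (\<Union>h\<in>H. \<Union>k\<in>carrier G. {commutator G h k})" by blast
qed

lemma (in group) lower_central_normal: "lower_central G k \<lhd> G"
proof (induction k)
  case 0
  then show ?case by (simp add: normal_self)
next
  case (Suc k)
  then show ?case using commutator_subgroup_normal normal_self by (cases k) auto
qed

lemma (in group) lower_central_subgroup: "subgroup (lower_central G k) G"
  using lower_central_normal normal_imp_subgroup by blast

lemma (in group) lower_central_subset: "lower_central G k \<subseteq> carrier G"
  using lower_central_subgroup subgroup.subset by blast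

lemma (in group) commutator_in_lower_central:
  assumes "k \<ge> 1" "h \<in> lower_central G k" "g \<in> carrier G"
  shows "commutator G h g \<in> lower_central G (Suc k)"
  unfolding lower_central_Suc[OF assms(1)] commutator_subgroup_def
  by (rule generate.incl) (use assms in blast)

text \<open>By normality, since [h, g] is the product of h and a conjugate of its inverse.\<close>

lemma (in group) lower_central_antimono: "lower_central G (Suc k) \<subseteq> lower_central G k"
proof (cases "k \<ge> 1")
  case True
  interpret N: normal "lower_central G k" G by (rule lower_central_normal)
  show ?thesis
    unfolding lower_central_Suc[OF True] commutator_subgroup_def
  proof (rule generate_subgroup_incl[OF _ lower_central_subgroup], clarsimp)
    fix h g assume hg: "h \<in> lower_central G k" "g \<in> carrier G"
    then have "h \<otimes> (g \<otimes> inv h \<otimes> inv g) \<in> lower_central G k"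
      using N.inv_op_closed2 by auto
    then show "commutator G h g \<in> lower_central G k"
      using hg lower_central_subset[of k] by (auto simp: m_assoc subset_iff)
  qed
qed (use lower_central_subset in \<open>auto simp: lower_central_1\<close>)

lemma (in group_hom) hom_commutator:
  "x \<in> carrier G \<Longrightarrow> y \<in> carrier G \<Longrightarrow> h (commutator G x y) = commutator H (h x) (h y)"
  by simp

text \<open>The second argument is the image of \<open>G\<close> rather than all of
  \<open>H\<close>. Hence one formula yields the inclusion for every homomorphism and equality for
  surjective ones.\<close>

lemma (in group_hom) lower_central_image_Suc:
  assumes "k \<ge> 1"
  shows "h ` lower_central G (Suc k) = commutator_subgroup H (h ` lower_central G k) (h ` carrier G)"
proof -
  let ?C = "\<Union>x\<in>lower_central G k. \<Union>y\<in>carrier G. {commutator G x y}"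
  have C: "?C \<subseteq> carrier G" using G.lower_central_subset by fastforce
  have "h (commutator G x y) = commutator H (h x) (h y)" if "x \<in> lower_central G k" "y \<in> carrier G" for x y
    using hom_commutator that G.lower_central_subset by blast
  then have "h ` ?C = (\<Union>x\<in>h ` lower_central G k. \<Union>y\<in>h ` carrier G. {commutator H x y})"
    by (auto simp: image_UN)
  then show ?thesis
    unfolding lower_central_Suc[OF assms] commutator_subgroup_def by (simp only: generate_img[OF C, symmetric])
qed

lemma (in group_hom) lower_central_image: "h ` lower_central G k \<subseteq> lower_central H k"
proof (induction k)
  case (Suc k)
  show ?case
  proof (cases "k \<ge> 1")
    case True
    have "h ` carrier G \<subseteq> carrier H" by auto
    with Suc show ?thesis
      unfolding lower_central_image_Suc[OF True] lower_central_Suc[OF True, of H] commutator_subgroup_def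
      by (intro H.mono_generate UN_mono) auto
  qed (auto simp: lower_central_1)
qed auto

lemma (in group_hom) lower_central_image_surj:
  assumes surj: "h ` carrier G = carrier H"
  shows "h ` lower_central G k = lower_central H k"
proof (induction k)
  case (Suc k)
  then show ?case
    using surj lower_central_image_Suc[of k] lower_central_Suc[of k H]
    by (cases "k \<ge> 1") (auto simp: lower_central_1)
qed (use surj in auto)

definition second_derived :: "('a, 'b) monoid_scheme \<Rightarrow> 'a set" where
  "second_derived G = derived G (derived G (carrier G))"

lemma (in group) second_derived_normal: "second_derived G \<lhd> G"
  unfolding second_derived_def by (intro derived_is_normal normal_self)

lemma (in group_hom) second_derived_image: "h ` second_derived G \<subseteq> second_derived H"
proof -
  have "h ` derived G (carrier G) = derived H (h ` carrier G)" by (rule derived_img[symmetric]) simp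
  also have "\<dots> \<subseteq> derived H (carrier H)" by (rule H.mono_derived) auto
  finally have 1: "h ` derived G (carrier G) \<subseteq> derived H (carrier H)" .
  have "h ` second_derived G = derived H (h ` derived G (carrier G))"
    unfolding second_derived_def by (rule derived_img[symmetric]) (rule G.derived_in_carrier, simp)
  also have "\<dots> \<subseteq> second_derived H"
    unfolding second_derived_def by (rule H.mono_derived[OF 1])
  finally show ?thesis .
qed

section \<open>Chen ranks by linear functionals\<close>

text \<open>The linear functionals on \<open>gr\<^sub>k(G/G'') \<otimes> \<complex>\<close>, pulled back to \<open>\<Gamma>\<^sub>k(G)\<close>.\<close>

definition chen_functionals :: "('a, 'b) monoid_scheme \<Rightarrow> nat \<Rightarrow> ('a \<Rightarrow> complex) set" where
  "chen_functionals G k = {\<phi> \<in> additive_functions (G\<lparr>carrier := lower_central G k\<rparr>).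
     (\<forall>x\<in>lower_central G (Suc k). \<phi> x = 0) \<and> (\<forall>x\<in>lower_central G k \<inter> second_derived G. \<phi> x = 0)}"

lemma subspace_chen_functionals: "cfun.subspace (chen_functionals G k)"
  by (rule cfun.subspaceI) (auto simp: chen_functionals_def additive_functions_def algebra_simps)

text \<open>Values off the k-th term are left free, so that the property applies directly to the map
  taking h to \<open>\<phi> (commutator G h g)\<close>, as the induction on k requires.\<close>

definition determines_additive :: "('a, 'b) monoid_scheme \<Rightarrow> nat \<Rightarrow> 'a set \<Rightarrow> bool" where
  "determines_additive G k T \<longleftrightarrow> (\<forall>\<phi> :: 'a \<Rightarrow> complex.
     (\<forall>x\<in>lower_central G k. \<forall>y\<in>lower_central G k. \<phi> (x \<otimes>\<^bsub>G\<^esub> y) = \<phi> x + \<phi> y) \<and>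
     (\<forall>x\<in>lower_central G (Suc k). \<phi> x = 0) \<and> (\<forall>x\<in>T. \<phi> x = 0) \<longrightarrow> (\<forall>x\<in>lower_central G k. \<phi> x = 0))"

lemma determines_additiveD:
  fixes \<phi> :: "'a \<Rightarrow> complex" and G :: "('a, 'b) monoid_scheme"
  assumes "determines_additive G k T"
    and "\<And>x y. x \<in> lower_central G k \<Longrightarrow> y \<in> lower_central G k \<Longrightarrow> \<phi> (x \<otimes>\<^bsub>G\<^esub> y) = \<phi> x + \<phi> y"
    and "\<And>x. x \<in> lower_central G (Suc k) \<Longrightarrow> \<phi> x = 0" and "\<And>x. x \<in> T \<Longrightarrow> \<phi> x = 0"
  shows "\<forall>x\<in>lower_central G k. \<phi> x = 0"
  using assms unfolding determines_additive_def by blast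

text \<open>By bilinearity of \<open>(h, g) \<mapsto> \<phi> [h, g]\<close>, iterated commutators of generators suffice.\<close>

lemma (in group) additive_lower_central_determined:
  assumes S: "finite S" "S \<subseteq> carrier G" "generate G S = carrier G" and k: "k \<ge> 1"
  shows "\<exists>T. finite T \<and> T \<subseteq> lower_central G k \<and> determines_additive G k T"
  using k
proof (induction k rule: dec_induct)
  case base
  have "\<phi> x = 0" if add: "\<forall>x\<in>carrier G. \<forall>y\<in>carrier G. \<phi> (x \<otimes> y) = \<phi> x + \<phi> y"
    and z: "\<forall>x\<in>S. \<phi> x = 0" and x: "x \<in> carrier G" for \<phi> :: "'a \<Rightarrow> complex" and x
  proof -
    have one: "\<phi> \<one> = 0" using add[rule_format, of \<one> \<one>] by simp
    have inv: "\<phi> (inv y) = - \<phi> y" if "y \<in> carrier G" for y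
      using add[rule_format, of y "inv y"] that one by (simp add: eq_neg_iff_add_eq_0 add.commute)
    have "x \<in> generate G S" using x S by simp
    then show ?thesis
      by induction (use S one inv z add generate_in_carrier[OF S(2)] in auto)
  qed
  then show ?case using S unfolding determines_additive_def
    by (intro exI[of _ S]) (auto simp: lower_central_1)
next
  case (step k)
  then obtain T where T: "finite T" "T \<subseteq> lower_central G k" "determines_additive G k T"
    by blast
  have k: "k \<ge> 1" "Suc k \<ge> 1" using step by auto
  have sub: "x \<in> carrier G" if "x \<in> lower_central G j" for x j
    using lower_central_subset that by blast
  define T' where "T' = (\<Union>h\<in>T. \<Union>s\<in>S. {commutator G h s})"
  have "\<phi> x = 0" if add: "\<forall>x\<in>lower_central G (Suc k). \<forall>y\<in>lower_central G (Suc k). \<phi> (x \<otimes> y) = \<phi> x + \<phi> y"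
    and z2: "\<forall>x\<in>lower_central G (Suc (Suc k)). \<phi> x = 0" and z: "\<forall>x\<in>T'. \<phi> x = 0"
    and x: "x \<in> lower_central G (Suc k)" for \<phi> :: "'a \<Rightarrow> complex" and x
  proof -
    interpret L: subgroup "lower_central G (Suc k)" G by (rule lower_central_subgroup)
    have one: "\<phi> \<one> = 0" using add[rule_format, of \<one> \<one>] L.one_closed by simp
    have inv: "\<phi> (inv y) = - \<phi> y" if "y \<in> lower_central G (Suc k)" for y
      using add[rule_format, of y "inv y"] that one sub by (simp add: eq_neg_iff_add_eq_0 add.commute)
    \<comment> \<open>A conjugate of c differs from c by the inverse of [c, g], which lies one term
      further down, where \<open>\<phi>\<close> vanishes.\<close>
    have conj: "\<phi> (g \<otimes> c \<otimes> inv g) = \<phi> c" and conj_in: "g \<otimes> c \<otimes> inv g \<in> lower_central G (Suc k)"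
      if c: "c \<in> lower_central G (Suc k)" and g: "g \<in> carrier G" for c g
    proof -
      have cg: "commutator G c g \<in> lower_central G (Suc (Suc k))"
        using commutator_in_lower_central[OF k(2) c g] .
      then have cg': "commutator G c g \<in> lower_central G (Suc k)" using lower_central_antimono by blast
      have "inv (commutator G c g) = g \<otimes> c \<otimes> inv g \<otimes> inv c"
        using sub[OF c] g by (simp add: inv_mult_group m_assoc)
      then have eq: "g \<otimes> c \<otimes> inv g = inv (commutator G c g) \<otimes> c"
        using sub[OF c] g by (simp add: m_assoc)
      show "\<phi> (g \<otimes> c \<otimes> inv g) = \<phi> c"
        unfolding eq using add c cg cg' inv z2 by simp
      show "g \<otimes> c \<otimes> inv g \<in> lower_central G (Suc k)" unfolding eq using c cg' by simp
    qed
    have comm_in: "commutator G h g \<in> lower_central G (Suc k)" if "h \<in> lower_central G k" "g \<in> carrier G" for h g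
      using commutator_in_lower_central k(1) that by blast
    have right: "\<phi> (commutator G h (g \<otimes> g')) = \<phi> (commutator G h g) + \<phi> (commutator G h g')"
      if "h \<in> lower_central G k" "g \<in> carrier G" "g' \<in> carrier G" for h g g'
      using that commutator_mult_right[OF sub[OF that(1)] that(2,3)] conj conj_in comm_in add by simp
    have left: "\<phi> (commutator G (h \<otimes> h') g) = \<phi> (commutator G h g) + \<phi> (commutator G h' g)"
      if "h \<in> lower_central G k" "h' \<in> lower_central G k" "g \<in> carrier G" for h h' g
      using that commutator_mult_left[OF sub[OF that(1)] sub[OF that(2)] that(3)] conj conj_in comm_in add sub by simp
    have T0: "\<phi> (commutator G h g) = 0" if h: "h \<in> T" and g: "g \<in> carrier G" for h g
    proof -
      have hk: "h \<in> lower_central G k" using h T by auto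
      have c1: "\<phi> (commutator G h \<one>) = 0" using right[OF hk one_closed one_closed] by simp
      have "g \<in> generate G S" using g S by simp
      then show ?thesis
      proof induction
        case (incl s)
        then show ?case using z h by (auto simp: T'_def)
      next
        case (inv s)
        then have s: "s \<in> carrier G" using S by auto
        have "\<phi> (commutator G h s) = 0" using z h inv by (auto simp: T'_def)
        then show ?case using right[OF hk s inv_closed[OF s]] c1 s by simp
      next
        case (eng a b)
        then show ?case using right[OF hk] generate_in_carrier[OF S(2)] by simp
      qed (rule c1)
    qed
    have all0: "\<phi> (commutator G h g) = 0" if "h \<in> lower_central G k" "g \<in> carrier G" for h g
    proof -
      \<comment> \<open>For fixed g the map from h to \<open>\<phi>\<close> of [h, g] is additive on
        the k-th term, vanishes on the next one because commutators then drop two terms, and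
        vanishes on T by \<open>T0\<close>. The induction hypothesis on T applies to it.\<close>
      have "\<forall>h\<in>lower_central G k. \<phi> (commutator G h g) = 0"
      proof (rule determines_additiveD[OF T(3), of "\<lambda>h. \<phi> (commutator G h g)"])
        fix x assume "x \<in> lower_central G (Suc k)"
        then show "\<phi> (commutator G x g) = 0"
          using commutator_in_lower_central[OF k(2)] that z2 by blast
      qed (use left T0 that in auto)
      then show ?thesis using that by blast
    qed
    have C: "(\<Union>h\<in>lower_central G k. \<Union>g\<in>carrier G. {commutator G h g}) \<subseteq> lower_central G (Suc k)"
      using comm_in by blast
    have "x \<in> generate G (\<Union>h\<in>lower_central G k. \<Union>g\<in>carrier G. {commutator G h g})"
      using x unfolding lower_central_Suc[OF k(1)] commutator_subgroup_def .
    then have "x \<in> lower_central G (Suc k) \<and> \<phi> x = 0"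
    proof induction
      case one
      then show ?case using \<open>\<phi> \<one> = 0\<close> L.one_closed by simp
    next
      case (incl c)
      then show ?case using all0 C by blast
    next
      case (inv c)
      then have "c \<in> lower_central G (Suc k)" "\<phi> c = 0" using all0 C by blast+
      then show ?case using \<open>\<And>y. y \<in> lower_central G (Suc k) \<Longrightarrow> \<phi> (inv y) = - \<phi> y\<close> by simp
    next
      case (eng a b)
      then show ?case using add by simp
    qed
    then show ?thesis by simp
  qed
  then have "determines_additive G (Suc k) T'" unfolding determines_additive_def by blast
  moreover have "finite T'" using T S by (auto simp: T'_def)
  moreover have "T' \<subseteq> lower_central G (Suc k)"
    using T(2) S(2) commutator_in_lower_central[OF k(1)] unfolding T'_def by blast
  ultimately show ?case by (intro exI[of _ T']) blast
qed

lemma chen_functionals_determined: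
  assumes "finitely_generated_group G" and k: "k \<ge> 1"
  obtains T where "finite T" "T \<subseteq> lower_central G k"
    "\<And>\<phi>. \<phi> \<in> chen_functionals G k \<Longrightarrow> (\<And>t. t \<in> T \<Longrightarrow> \<phi> t = 0) \<Longrightarrow> \<phi> = 0"
proof -
  obtain S where G: "group G" and S: "finite S" "S \<subseteq> carrier G" "generate G S = carrier G"
    using assms by (auto simp: finitely_generated_group_def)
  interpret group G by (rule G)
  obtain T where T: "finite T" "T \<subseteq> lower_central G k" "determines_additive G k T"
    using additive_lower_central_determined[OF S k] by blast
  have "\<phi> = 0" if \<phi>: "\<phi> \<in> chen_functionals G k" and z: "\<And>t. t \<in> T \<Longrightarrow> \<phi> t = 0" for \<phi>
  proof
    fix x
    have "\<forall>x\<in>lower_central G k. \<phi> x = 0"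
      by (rule determines_additiveD[OF T(3)])
        (use \<phi> z in \<open>auto simp: chen_functionals_def additive_functions_def\<close>)
    then show "\<phi> x = 0 x"
      using \<phi> by (cases "x \<in> lower_central G k") (auto simp: chen_functionals_def additive_functions_def)
  qed
  with T that show thesis by blast
qed

lemma chen_functionals_finite_span:
  assumes "finitely_generated_group G" and "k \<ge> 1"
  obtains B where "finite B" "cfun.span B = chen_functionals G k"
proof -
  obtain T where T: "finite T" "T \<subseteq> lower_central G k"
    "\<And>\<phi>. \<phi> \<in> chen_functionals G k \<Longrightarrow> (\<And>t. t \<in> T \<Longrightarrow> \<phi> t = 0) \<Longrightarrow> \<phi> = 0"
    using chen_functionals_determined[OF assms] by blast
  show thesis using span_finite_if_determined[OF subspace_chen_functionals T(1,3)] that by blast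
qed


section \<open>Comparison with the definition of the Chen ranks\<close>

text \<open>Spares the handling of cosets of cosets: additive functions on A become additive
  functions on X that are constant on the fibres of \<open>\<tau>\<close>. It serves for X the k-th
  lower central term of G and A the k-th graded piece of G/G''.\<close>

lemma dim_additive_functions_surj:
  fixes A :: "('b, 'c) monoid_scheme" and m :: "'a \<Rightarrow> 'a \<Rightarrow> 'a"
  assumes surj: "\<tau> ` X = carrier A"
    and m: "\<And>x y. x \<in> X \<Longrightarrow> y \<in> X \<Longrightarrow> m x y \<in> X \<and> \<tau> (m x y) = \<tau> x \<otimes>\<^bsub>A\<^esub> \<tau> y"
    and D: "\<And>\<phi>. \<phi> \<in> D \<longleftrightarrow> (\<forall>x. x \<notin> X \<longrightarrow> \<phi> x = 0) \<and> (\<forall>x\<in>X. \<forall>y\<in>X. \<phi> (m x y) = \<phi> x + \<phi> y) \<and>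
      (\<forall>x\<in>X. \<forall>y\<in>X. \<tau> x = \<tau> y \<longrightarrow> \<phi> x = \<phi> y)"
    and T: "finite T" "T \<subseteq> X" "\<And>\<phi>. \<phi> \<in> D \<Longrightarrow> (\<And>t. t \<in> T \<Longrightarrow> \<phi> t = 0) \<Longrightarrow> \<phi> = 0"
  shows "complexification_dim A = cfun.dim D"
proof -
  let ?A = "additive_functions A"
  define L where "L f x = (if x \<in> X then f (\<tau> x) else 0)" for f :: "'b \<Rightarrow> complex" and x
  have lin: "Vector_Spaces.linear cscale cscale L"
    by (rule linear_cscaleI) (auto simp: L_def fun_eq_iff)
  have LD: "L f \<in> D" if "f \<in> ?A" for f
  proof -
    have "\<tau> x \<in> carrier A" if "x \<in> X" for x using surj that by blast
    then show ?thesis using that m by (auto simp: D L_def additive_functions_def)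
  qed
  have inj: "f = 0" if f: "f \<in> ?A" and z: "\<And>x. x \<in> X \<Longrightarrow> L f x = 0" for f
  proof
    fix y
    show "f y = 0 y"
    proof (cases "y \<in> carrier A")
      case True
      then obtain x where "x \<in> X" "y = \<tau> x" using surj by blast
      then show ?thesis using z[of x] by (simp add: L_def)
    qed (use f in \<open>auto simp: additive_functions_def\<close>)
  qed
  have "complexification_dim A = cfun.dim ?A"
  proof (rule complexification_dim_eq_dim)
    show "finite (\<tau> ` T)" "\<tau> ` T \<subseteq> carrier A" using T surj by auto
    fix x y assume "x \<in> carrier A" "y \<in> carrier A"
    then obtain x' y' where "x' \<in> X" "y' \<in> X" "x = \<tau> x'" "y = \<tau> y'" using surj by blast
    then show "x \<otimes>\<^bsub>A\<^esub> y \<in> carrier A" using m[of x' y'] surj by (metis imageI)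
  next
    fix f assume f: "f \<in> ?A" and z: "\<And>t. t \<in> \<tau> ` T \<Longrightarrow> f t = 0"
    have "L f = 0" using T(3)[OF LD[OF f]] z T(2) by (auto simp: L_def)
    then show "f = 0" using inj[OF f] by simp
  qed
  also have "\<dots> = cfun.dim (L ` ?A)"
  proof (rule dim_linear_image[OF lin subspace_additive_functions, symmetric])
    show "inj_on L ?A"
    proof (rule inj_onI)
      fix f g assume fg: "f \<in> ?A" "g \<in> ?A" "L f = L g"
      have "f - g \<in> ?A" by (rule cfun.subspace_diff[OF subspace_additive_functions fg(1,2)])
      moreover have "L (f - g) x = 0" for x
        using fun_cong[OF fg(3), of x] by (simp add: L_def split: if_splits)
      ultimately have "f - g = 0" using inj[of "f - g"] by blast
      then show "f = g" by simp
    qed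
  qed
  also have "L ` ?A = D"
  proof (intro equalityI subsetI)
    fix \<phi> assume \<phi>: "\<phi> \<in> D"
    have \<phi>_0: "\<forall>x. x \<notin> X \<longrightarrow> \<phi> x = 0" and \<phi>_add: "\<forall>x\<in>X. \<forall>y\<in>X. \<phi> (m x y) = \<phi> x + \<phi> y"
      using \<phi>[unfolded D] by (rule conjunct1, rule conjunct1[OF conjunct2])
    \<comment> \<open>A section of \<open>\<tau>\<close>. The composite of \<open>\<phi>\<close>
      with it does not depend on the choices, as \<open>\<phi>\<close> is constant on
      fibres.\<close>
    define s where "s y = (SOME x. x \<in> X \<and> \<tau> x = y)" for y
    have s: "s y \<in> X" "\<tau> (s y) = y" if "y \<in> carrier A" for y
    proof -
      have "y \<in> \<tau> ` X" using that surj by simp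
      then have "\<exists>x. x \<in> X \<and> \<tau> x = y" by auto
      from someI_ex[OF this] show "s y \<in> X" "\<tau> (s y) = y" by (simp_all add: s_def)
    qed
    define f where "f y = (if y \<in> carrier A then \<phi> (s y) else 0)" for y
    have f\<tau>: "f (\<tau> x) = \<phi> x" if "x \<in> X" for x
    proof -
      have t: "\<tau> x \<in> carrier A" using that surj by blast
      have c: "\<forall>x\<in>X. \<forall>y\<in>X. \<tau> x = \<tau> y \<longrightarrow> \<phi> x = \<phi> y" using \<phi> unfolding D by (elim conjE)
      have "\<phi> (s (\<tau> x)) = \<phi> x" by (rule c[rule_format, OF s(1)[OF t] that s(2)[OF t]])
      then show ?thesis using t by (simp add: f_def)
    qed
    have "f \<in> ?A"
      unfolding additive_functions_def
    proof (intro CollectI conjI ballI allI impI)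
      fix x y assume "x \<in> carrier A" "y \<in> carrier A"
      then obtain x' y' where "x' \<in> X" "y' \<in> X" "x = \<tau> x'" "y = \<tau> y'" using surj by blast
      moreover from this have "f (x \<otimes>\<^bsub>A\<^esub> y) = \<phi> (m x' y')" using f\<tau>[of "m x' y'"] m[of x' y'] by simp
      moreover have "\<phi> (m x' y') = \<phi> x' + \<phi> y'" using \<phi>_add \<open>x' \<in> X\<close> \<open>y' \<in> X\<close> by blast
      ultimately show "f (x \<otimes>\<^bsub>A\<^esub> y) = f x + f y" by (simp only: f\<tau>)
    qed (simp add: f_def)
    moreover have "\<phi> = L f"
    proof
      fix x
      show "\<phi> x = L f x"
      proof (cases "x \<in> X")
        case False
        then have "\<phi> x = 0" using \<phi>_0 by simp
        with False show ?thesis by (simp add: L_def)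
      qed (simp add: L_def f\<tau>)
    qed
    ultimately show "\<phi> \<in> L ` ?A" by blast
  qed (use LD in auto)
  finally show ?thesis .
qed

text \<open>Lower central terms map onto lower central terms under the projection to G/G'', so
  \<open>\<tau>\<close> is onto the graded piece. Its kernel is the product of the (k+1)-st term
  with the part of the k-th term in G'', which are the two vanishing conditions of
  \<open>chen_functionals\<close>.\<close>

theorem chen_rank_eq_dim:
  fixes G :: "('a, 'b) monoid_scheme" (structure)
  assumes fg: "finitely_generated_group G" and k: "k \<ge> 1"
  shows "chen_rank G k = cfun.dim (chen_functionals G k)"
proof -
  interpret group G using fg by (simp add: finitely_generated_group_def)
  define N where "N = second_derived G"
  define K where "K = G Mod N"
  define M where "M = lower_central K (Suc k)"
  define A where "A = K\<lparr>carrier := lower_central K k\<rparr> Mod M"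
  define X where "X = lower_central G k"
  define \<pi> where "\<pi> g = N #> g" for g
  define \<tau> where "\<tau> g = M #>\<^bsub>K\<^esub> \<pi> g" for g
  interpret N: normal N G unfolding N_def by (rule second_derived_normal)
  interpret K: group K unfolding K_def by (rule N.factorgroup_is_group)
  interpret \<pi>: group_hom G K \<pi>
    by unfold_locales (simp add: K_def \<pi>_def[abs_def] N.r_coset_hom_Mod)
  have \<pi>_surj: "\<pi> ` carrier G = carrier K" by (simp add: K_def carrier_FactGroup \<pi>_def[abs_def])
  interpret M: normal M K unfolding M_def by (rule K.lower_central_normal)
  have sub: "X \<subseteq> carrier G" unfolding X_def by (rule lower_central_subset)
  have \<pi>X: "\<pi> ` X = lower_central K k" "\<pi> ` lower_central G (Suc k) = M"
    unfolding X_def M_def using \<pi>.lower_central_image_surj[OF \<pi>_surj] by auto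
  have carA: "carrier A = (\<lambda>x. M #>\<^bsub>K\<^esub> x) ` lower_central K k"
    by (simp add: A_def carrier_FactGroup r_coset_def)
  have multA: "x \<otimes>\<^bsub>A\<^esub> y = x <#>\<^bsub>K\<^esub> y" for x y
    by (simp add: A_def)
  interpret X: subgroup X G unfolding X_def by (rule lower_central_subgroup)
  have \<tau>_eq: "\<exists>n\<in>X \<inter> N. \<exists>s\<in>lower_central G (Suc k). x = n \<otimes> s \<otimes> y"
    if "x \<in> X" "y \<in> X" "\<tau> x = \<tau> y" for x y
  proof -
    have xy: "x \<in> carrier G" "y \<in> carrier G" using that sub by auto
    have "\<pi> x \<in> M #>\<^bsub>K\<^esub> \<pi> y"
      using K.rcos_self[OF _ M.subgroup_axioms, of "\<pi> x"] that(3) xy by (simp add: \<tau>_def)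
    then have "\<pi> x \<otimes>\<^bsub>K\<^esub> inv\<^bsub>K\<^esub> \<pi> y \<in> M"
      using M.rcos_module_imp[OF K.is_group] xy by simp
    then have "\<pi> (x \<otimes> inv y) \<in> \<pi> ` lower_central G (Suc k)" using xy \<pi>X by simp
    then obtain s where s: "s \<in> lower_central G (Suc k)" "\<pi> (x \<otimes> inv y) = \<pi> s" by auto
    have sc: "s \<in> carrier G" "s \<in> X" using s lower_central_subset lower_central_antimono unfolding X_def by blast+
    have "x \<otimes> inv y \<in> N #> s"
      using rcos_self[OF _ N.subgroup_axioms, of "x \<otimes> inv y"] s(2) xy by (simp add: \<pi>_def)
    \<comment> \<open>Modular law: the remaining factor lies in N, and also in X because s
      does.\<close>
    then have "x \<otimes> inv y \<otimes> inv s \<in> N" using N.rcos_module_imp[OF is_group sc(1)] by simp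
    moreover have "x \<otimes> inv y \<otimes> inv s \<in> X" using that sc by simp
    moreover have "x = (x \<otimes> inv y \<otimes> inv s) \<otimes> s \<otimes> y" using xy sc by (simp add: m_assoc)
    ultimately show ?thesis using s(1) by blast
  qed
  obtain T where T: "finite T" "T \<subseteq> X"
    "\<And>\<phi>. \<phi> \<in> chen_functionals G k \<Longrightarrow> (\<And>t. t \<in> T \<Longrightarrow> \<phi> t = 0) \<Longrightarrow> \<phi> = 0"
    using chen_functionals_determined[OF fg k] unfolding X_def by blast
  have "complexification_dim A = cfun.dim (chen_functionals G k)"
  proof (rule dim_additive_functions_surj[where m = "(\<otimes>)" and \<tau> = \<tau> and X = X and T = T])
    show "\<tau> ` X = carrier A" unfolding carA \<pi>X(1)[symmetric] by (auto simp: \<tau>_def)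
    fix x y assume xy: "x \<in> X" "y \<in> X"
    then have "x \<in> carrier G" "y \<in> carrier G" using sub by auto
    then have "\<tau> (x \<otimes> y) = \<tau> x \<otimes>\<^bsub>A\<^esub> \<tau> y" by (simp add: multA \<tau>_def M.rcos_sum)
    with xy show "x \<otimes> y \<in> X \<and> \<tau> (x \<otimes> y) = \<tau> x \<otimes>\<^bsub>A\<^esub> \<tau> y" by simp
  next
    fix \<phi> :: "'a \<Rightarrow> complex"
    have "(\<forall>x\<in>lower_central G (Suc k). \<phi> x = 0) \<and> (\<forall>x\<in>X \<inter> N. \<phi> x = 0) \<longleftrightarrow>
        (\<forall>x\<in>X. \<forall>y\<in>X. \<tau> x = \<tau> y \<longrightarrow> \<phi> x = \<phi> y)"
      if add: "\<forall>x\<in>X. \<forall>y\<in>X. \<phi> (x \<otimes> y) = \<phi> x + \<phi> y"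
    proof (intro iffI ballI impI)
      fix x y assume z: "(\<forall>x\<in>lower_central G (Suc k). \<phi> x = 0) \<and> (\<forall>x\<in>X \<inter> N. \<phi> x = 0)"
        and xy: "x \<in> X" "y \<in> X" "\<tau> x = \<tau> y"
      obtain n s where ns: "n \<in> X \<inter> N" "s \<in> lower_central G (Suc k)" "x = n \<otimes> s \<otimes> y"
        using \<tau>_eq[OF xy] by blast
      have "s \<in> X" using ns lower_central_antimono unfolding X_def by blast
      then show "\<phi> x = \<phi> y" using ns z add xy by simp
    next
      assume c: "\<forall>x\<in>X. \<forall>y\<in>X. \<tau> x = \<tau> y \<longrightarrow> \<phi> x = \<phi> y"
      have one: "\<phi> \<one> = 0" using add[rule_format, of \<one> \<one>] X.one_closed by simp
      have \<tau>1: "\<tau> \<one> = M" using M.subset by (simp add: \<tau>_def)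
      have "\<phi> x = 0" if "x \<in> X" "\<pi> x \<in> M" for x
        using c[rule_format, of x \<one>] that M.rcos_const[OF K.is_group that(2)] one \<tau>1 X.one_closed
        by (simp add: \<tau>_def)
      moreover have "\<pi> x \<in> M" if "x \<in> lower_central G (Suc k)" for x using that \<pi>X by blast
      moreover have "\<pi> x \<in> M" if "x \<in> N" for x
      proof -
        have "\<pi> x = \<one>\<^bsub>K\<^esub>" using N.rcos_const[OF is_group that] by (simp add: \<pi>_def K_def)
        then show ?thesis using M.one_closed by simp
      qed
      moreover have "lower_central G (Suc k) \<subseteq> X" unfolding X_def by (rule lower_central_antimono)
      ultimately show "(\<forall>x\<in>lower_central G (Suc k). \<phi> x = 0) \<and> (\<forall>x\<in>X \<inter> N. \<phi> x = 0)" by blast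
    qed
    then show "\<phi> \<in> chen_functionals G k \<longleftrightarrow> (\<forall>x. x \<notin> X \<longrightarrow> \<phi> x = 0) \<and>
        (\<forall>x\<in>X. \<forall>y\<in>X. \<phi> (x \<otimes> y) = \<phi> x + \<phi> y) \<and> (\<forall>x\<in>X. \<forall>y\<in>X. \<tau> x = \<tau> y \<longrightarrow> \<phi> x = \<phi> y)"
      unfolding chen_functionals_def additive_functions_def X_def N_def by auto
  qed (use T in auto)
  then show ?thesis
    unfolding chen_rank_def gr_dim_def A_def M_def K_def N_def second_derived_def .
qed

section \<open>Functoriality of the Chen functionals\<close>

definition chen_pullback ::
    "('a, 'c) monoid_scheme \<Rightarrow> nat \<Rightarrow> ('a \<Rightarrow> 'b) \<Rightarrow> ('b \<Rightarrow> complex) \<Rightarrow> 'a \<Rightarrow> complex" where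
  "chen_pullback G k f \<phi> = (\<lambda>g. if g \<in> lower_central G k then \<phi> (f g) else 0)"

lemma linear_chen_pullback: "Vector_Spaces.linear cscale cscale (chen_pullback G k f)"
  by (rule linear_cscaleI) (auto simp: chen_pullback_def fun_eq_iff)

lemma (in group_hom) chen_pullback_in:
  assumes "\<phi> \<in> chen_functionals H k"
  shows "chen_pullback G k h \<phi> \<in> chen_functionals G k"
proof -
  interpret L: subgroup "lower_central G k" G by (rule G.lower_central_subgroup)
  have "h x \<in> lower_central H j" if "x \<in> lower_central G j" for x j
    using lower_central_image that by blast
  moreover have "h x \<in> second_derived H" if "x \<in> second_derived G" for x
    using second_derived_image that by blast
  moreover have "x \<in> carrier G" if "x \<in> lower_central G j" for x j
    using that G.lower_central_subset by blast
  moreover have "x \<in> lower_central G k" if "x \<in> lower_central G (Suc k)" for x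
    using that G.lower_central_antimono by blast
  ultimately show ?thesis
    using assms by (auto simp: chen_functionals_def additive_functions_def chen_pullback_def)
qed

text \<open>A surjection is onto on each lower central term, so a functional is recovered from its
  pullback.\<close>

lemma (in group_hom) inj_on_chen_pullback:
  assumes surj: "h ` carrier G = carrier H"
  shows "inj_on (chen_pullback G k h) (chen_functionals H k)"
proof (rule inj_onI, rule ext)
  fix \<phi> \<psi> x assume \<phi>: "\<phi> \<in> chen_functionals H k" "\<psi> \<in> chen_functionals H k"
    and eq: "chen_pullback G k h \<phi> = chen_pullback G k h \<psi>"
  show "\<phi> x = \<psi> x"
  proof (cases "x \<in> lower_central H k")
    case True
    then obtain g where "g \<in> lower_central G k" "x = h g" using lower_central_image_surj[OF surj] by blast
    then show ?thesis using fun_cong[OF eq, of g] by (simp add: chen_pullback_def)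
  qed (use \<phi> in \<open>auto simp: chen_functionals_def additive_functions_def\<close>)
qed

text \<open>Every pullback vanishes at \<open>w\<close>, which \<open>h\<close> kills;
  \<open>\<psi>\<close> does not. The pullbacks therefore form a proper subspace, with the Chen rank
  of \<open>H\<close> as dimension.\<close>

lemma (in group_hom) chen_rank_surj_less:
  assumes fg: "finitely_generated_group G" "finitely_generated_group H" and k: "k \<ge> 1"
    and surj: "h ` carrier G = carrier H"
    and \<psi>: "\<psi> \<in> chen_functionals G k" "w \<in> lower_central G k" "h w = \<one>\<^bsub>H\<^esub>" "\<psi> w \<noteq> 0"
  shows "chen_rank H k < chen_rank G k"
proof -
  let ?P = "chen_pullback G k h ` chen_functionals H k"
  obtain B where B: "finite B" "cfun.span B = chen_functionals G k"
    using chen_functionals_finite_span[OF fg(1) k] by blast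
  have "chen_pullback G k h \<phi> w = 0" if "\<phi> \<in> chen_functionals H k" for \<phi>
    using that \<psi>(2,3) subgroup.one_closed[OF H.lower_central_subgroup, of "Suc k"]
    by (simp add: chen_pullback_def chen_functionals_def)
  then have "\<psi> \<notin> ?P" using \<psi>(4) by auto
  then have "?P \<subset> chen_functionals G k" using chen_pullback_in \<psi>(1) by blast
  moreover have "cfun.subspace ?P"
    using cfun_pair.linear_subspace_image[OF linear_chen_pullback subspace_chen_functionals] .
  ultimately have "cfun.dim ?P < cfun.dim (chen_functionals G k)"
    using B dim_less by (metis order_refl)
  moreover have "cfun.dim ?P = cfun.dim (chen_functionals H k)"
    by (rule dim_linear_image[OF linear_chen_pullback subspace_chen_functionals inj_on_chen_pullback[OF surj]])
  ultimately show ?thesis using chen_rank_eq_dim[OF fg(1) k] chen_rank_eq_dim[OF fg(2) k] by simp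
qed

lemma chen_rank_pos:
  assumes "finitely_generated_group G" "k \<ge> 1" "\<psi> \<in> chen_functionals G k" "\<psi> \<noteq> 0"
  shows "chen_rank G k > 0"
proof -
  obtain B where B: "finite B" "cfun.span B = chen_functionals G k"
    using chen_functionals_finite_span[OF assms(1,2)] by blast
  have "cfun.dim {0 :: 'a \<Rightarrow> complex} < cfun.dim (chen_functionals G k)"
  proof (rule dim_less[OF cfun.subspace_single_0 _ B(1)])
    show "{0} \<subset> chen_functionals G k"
      using cfun.subspace_0[OF subspace_chen_functionals] assms(3,4) by blast
    show "chen_functionals G k \<subseteq> cfun.span B" using B(2) by simp
  qed
  then show ?thesis using chen_rank_eq_dim[OF assms(1,2)] by simp
qed

section \<open>Chen ranks of direct products\<close>

lemma finitely_generated_DirProd: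
  assumes "finitely_generated_group G1" "finitely_generated_group G2"
  shows "finitely_generated_group (G1 \<times>\<times> G2)"
proof -
  obtain S1 S2 where G: "group G1" "group G2" and S1: "finite S1" "S1 \<subseteq> carrier G1" "generate G1 S1 = carrier G1"
    and S2: "finite S2" "S2 \<subseteq> carrier G2" "generate G2 S2 = carrier G2"
    using assms by (auto simp: finitely_generated_group_def)
  interpret G1: group G1 by (rule G)
  interpret G2: group G2 by (rule G)
  interpret P: group "G1 \<times>\<times> G2" by (rule DirProd_group[OF G])
  interpret i1: group_hom G1 "G1 \<times>\<times> G2" "\<lambda>g. (g, \<one>\<^bsub>G2\<^esub>)"
    by unfold_locales (auto simp: hom_def)
  interpret i2: group_hom G2 "G1 \<times>\<times> G2" "\<lambda>g. (\<one>\<^bsub>G1\<^esub>, g)"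
    by unfold_locales (auto simp: hom_def)
  let ?S = "(\<lambda>g. (g, \<one>\<^bsub>G2\<^esub>)) ` S1 \<union> (\<lambda>g. (\<one>\<^bsub>G1\<^esub>, g)) ` S2"
  have S: "?S \<subseteq> carrier (G1 \<times>\<times> G2)" using S1 S2 by auto
  have "carrier (G1 \<times>\<times> G2) \<subseteq> generate (G1 \<times>\<times> G2) ?S"
  proof
    fix p assume "p \<in> carrier (G1 \<times>\<times> G2)"
    then obtain x y where p: "p = (x, y)" "x \<in> carrier G1" "y \<in> carrier G2" by auto
    have "(x, \<one>\<^bsub>G2\<^esub>) \<in> generate (G1 \<times>\<times> G2) ((\<lambda>g. (g, \<one>\<^bsub>G2\<^esub>)) ` S1)"
      using i1.generate_img[OF S1(2)] S1(3) p by auto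
    moreover have "(\<one>\<^bsub>G1\<^esub>, y) \<in> generate (G1 \<times>\<times> G2) ((\<lambda>g. (\<one>\<^bsub>G1\<^esub>, g)) ` S2)"
      using i2.generate_img[OF S2(2)] S2(3) p by auto
    ultimately have "(x, \<one>\<^bsub>G2\<^esub>) \<in> generate (G1 \<times>\<times> G2) ?S" "(\<one>\<^bsub>G1\<^esub>, y) \<in> generate (G1 \<times>\<times> G2) ?S"
      using P.mono_generate[of _ ?S] by blast+
    then have "(x, \<one>\<^bsub>G2\<^esub>) \<otimes>\<^bsub>G1 \<times>\<times> G2\<^esub> (\<one>\<^bsub>G1\<^esub>, y) \<in> generate (G1 \<times>\<times> G2) ?S"
      by (rule generate.eng)
    then show "p \<in> generate (G1 \<times>\<times> G2) ?S" using p by simp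
  qed
  then have "generate (G1 \<times>\<times> G2) ?S = carrier (G1 \<times>\<times> G2)" using P.generate_incl[OF S] by blast
  moreover have "finite ?S" using S1 S2 by simp
  ultimately show ?thesis using S P.is_group unfolding finitely_generated_group_def by blast
qed

text \<open>The space of functionals is the direct sum of its pullbacks along the projections:
  additivity splits the value at (x, y) into the values at (x, 1) and (1, y).\<close>

theorem chen_rank_DirProd:
  assumes fg: "finitely_generated_group G1" "finitely_generated_group G2" and k: "k \<ge> 1"
  shows "chen_rank (G1 \<times>\<times> G2) k = chen_rank G1 k + chen_rank G2 k"
proof -
  interpret G1: group G1 using fg by (simp add: finitely_generated_group_def)
  interpret G2: group G2 using fg by (simp add: finitely_generated_group_def)
  let ?P = "G1 \<times>\<times> G2"
  interpret P: group ?P by (rule DirProd_group) unfold_locales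
  interpret i1: group_hom G1 ?P "\<lambda>g. (g, \<one>\<^bsub>G2\<^esub>)" by unfold_locales (auto simp: hom_def)
  interpret i2: group_hom G2 ?P "\<lambda>g. (\<one>\<^bsub>G1\<^esub>, g)" by unfold_locales (auto simp: hom_def)
  interpret p1: group_hom ?P G1 fst by unfold_locales (auto simp: hom_def)
  interpret p2: group_hom ?P G2 snd by unfold_locales (auto simp: hom_def)
  have surj: "fst ` carrier ?P = carrier G1" "snd ` carrier ?P = carrier G2" by force+
  let ?D = "chen_functionals ?P k"
  let ?D1 = "chen_pullback ?P k fst ` chen_functionals G1 k"
  let ?D2 = "chen_pullback ?P k snd ` chen_functionals G2 k"
  have dims: "cfun.dim ?D1 = chen_rank G1 k" "cfun.dim ?D2 = chen_rank G2 k"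
    using dim_linear_image[OF linear_chen_pullback subspace_chen_functionals p1.inj_on_chen_pullback[OF surj(1)]]
      dim_linear_image[OF linear_chen_pullback subspace_chen_functionals p2.inj_on_chen_pullback[OF surj(2)]]
      chen_rank_eq_dim[OF fg(1) k] chen_rank_eq_dim[OF fg(2) k] by auto
  have sub: "cfun.subspace ?D1" "cfun.subspace ?D2"
    using cfun_pair.linear_subspace_image[OF linear_chen_pullback subspace_chen_functionals] by auto
  have D12: "?D1 \<subseteq> ?D" "?D2 \<subseteq> ?D" using p1.chen_pullback_in p2.chen_pullback_in by auto
  obtain B where B: "finite B" "cfun.span B = ?D"
    using chen_functionals_finite_span[OF finitely_generated_DirProd[OF fg] k] by blast
  \<comment> \<open>Projection followed by inclusion is an endomorphism of the product, so it
    preserves the lower central term.\<close>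
  have 1: "(fst g, \<one>\<^bsub>G2\<^esub>) \<in> lower_central ?P k" "fst g \<in> lower_central G1 k" if "g \<in> lower_central ?P k" for g
    using p1.lower_central_image i1.lower_central_image that by blast+
  have 2: "(\<one>\<^bsub>G1\<^esub>, snd g) \<in> lower_central ?P k" "snd g \<in> lower_central G2 k" if "g \<in> lower_central ?P k" for g
    using p2.lower_central_image i2.lower_central_image that by blast+
  have fun_one: "\<phi> \<one>\<^bsub>H\<^esub> = 0" if "\<phi> \<in> chen_functionals H k" "group H"
    for \<phi> :: "'z \<Rightarrow> complex" and H :: "('z, 'w) monoid_scheme"
    using that subgroup.one_closed[OF group.lower_central_subgroup, of H "Suc k"]
    by (simp add: chen_functionals_def)
  have int: "?D1 \<inter> ?D2 \<subseteq> {0}"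
  proof
    fix f assume f: "f \<in> ?D1 \<inter> ?D2"
    then obtain \<phi> \<psi> where \<phi>: "f = chen_pullback ?P k fst \<phi>" "\<phi> \<in> chen_functionals G1 k"
      "f = chen_pullback ?P k snd \<psi>" "\<psi> \<in> chen_functionals G2 k" by blast
    have "f g = 0" for g
    proof (cases "g \<in> lower_central ?P k")
      case True
      then have "f g = \<phi> (fst g)" using \<phi>(1) by (simp add: chen_pullback_def)
      also have "\<dots> = f (fst g, \<one>\<^bsub>G2\<^esub>)" using \<phi>(1) 1(1)[OF True] by (simp add: chen_pullback_def)
      also have "\<dots> = \<psi> \<one>\<^bsub>G2\<^esub>" using \<phi>(3) 1(1)[OF True] by (simp add: chen_pullback_def)
      also have "\<dots> = 0" using fun_one \<phi>(4) G2.is_group by blast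
      finally show ?thesis .
    qed (simp add: \<phi>(1) chen_pullback_def)
    then show "f \<in> {0}" by (auto simp: fun_eq_iff)
  qed
  have "?D = {x + y | x y. x \<in> ?D1 \<and> y \<in> ?D2}"
  proof (intro equalityI subsetI)
    fix f assume f: "f \<in> ?D"
    let ?f1 = "chen_pullback G1 k (\<lambda>g. (g, \<one>\<^bsub>G2\<^esub>)) f" and ?f2 = "chen_pullback G2 k (\<lambda>g. (\<one>\<^bsub>G1\<^esub>, g)) f"
    have "f = chen_pullback ?P k fst ?f1 + chen_pullback ?P k snd ?f2"
    proof
      fix g
      show "f g = (chen_pullback ?P k fst ?f1 + chen_pullback ?P k snd ?f2) g"
      proof (cases "g \<in> lower_central ?P k")
        case True
        then have "fst g \<in> carrier G1" "snd g \<in> carrier G2" using P.lower_central_subset[of k] by auto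
        then have "(fst g, \<one>\<^bsub>G2\<^esub>) \<otimes>\<^bsub>?P\<^esub> (\<one>\<^bsub>G1\<^esub>, snd g) = g" by simp
        then have "f g = f ((fst g, \<one>\<^bsub>G2\<^esub>) \<otimes>\<^bsub>?P\<^esub> (\<one>\<^bsub>G1\<^esub>, snd g))" by (simp only:)
        also have "\<dots> = f (fst g, \<one>\<^bsub>G2\<^esub>) + f (\<one>\<^bsub>G1\<^esub>, snd g)"
        proof -
          have "\<forall>x\<in>lower_central ?P k. \<forall>y\<in>lower_central ?P k. f (x \<otimes>\<^bsub>?P\<^esub> y) = f x + f y"
            using f unfolding chen_functionals_def additive_functions_def by simp
          then show ?thesis using 1(1)[OF True] 2(1)[OF True] by blast
        qed
        finally show ?thesis using 1[OF True] 2[OF True] True by (simp add: chen_pullback_def)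
      next
        case False
        then have "f g = 0" using f by (cases g) (simp add: chen_functionals_def additive_functions_def)
        with False show ?thesis by (simp add: chen_pullback_def)
      qed
    qed
    moreover have "?f1 \<in> chen_functionals G1 k" "?f2 \<in> chen_functionals G2 k"
      using i1.chen_pullback_in[OF f] i2.chen_pullback_in[OF f] by auto
    ultimately show "f \<in> {x + y | x y. x \<in> ?D1 \<and> y \<in> ?D2}" by blast
  next
    fix f assume "f \<in> {x + y | x y. x \<in> ?D1 \<and> y \<in> ?D2}"
    then obtain x y where xy: "f = x + y" "x \<in> ?D1" "y \<in> ?D2" by (elim CollectE exE conjE)
    have "x + y \<in> ?D"
      by (rule cfun.subspace_add[OF subspace_chen_functionals subsetD[OF D12(1) xy(2)] subsetD[OF D12(2) xy(3)]])
    then show "f \<in> ?D" by (simp only: xy(1))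
  qed
  then have "cfun.dim ?D = cfun.dim ?D1 + cfun.dim ?D2"
    using sub D12 B int by (intro dim_direct_sum[where F = B and F' = B]) auto
  then show ?thesis
    using dims chen_rank_eq_dim[OF finitely_generated_DirProd[OF fg] k] by simp
qed

section \<open>Resonance varieties\<close>

text \<open>The right-hand side is the bar coboundary of the 1-cochain \<open>c\<close>, written on
  group elements instead of lists.\<close>

definition cup_exact :: "('a, 'b) monoid_scheme \<Rightarrow> ('a list \<Rightarrow> complex) \<Rightarrow> ('a list \<Rightarrow> complex) \<Rightarrow> bool" where
  "cup_exact G a u \<longleftrightarrow> (\<exists>c. \<forall>x\<in>carrier G. \<forall>y\<in>carrier G. a [x] * u [y] = c x + c y - c (x \<otimes>\<^bsub>G\<^esub> y))"

lemma H1_iff: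
  fixes G :: "('a, 'b) monoid_scheme"
  shows "f \<in> H1 G \<longleftrightarrow> (\<forall>xs. f xs \<noteq> 0 \<longrightarrow> length xs = 1 \<and> set xs \<subseteq> carrier G) \<and>
    (\<forall>x\<in>carrier G. \<forall>y\<in>carrier G. f [x \<otimes>\<^bsub>G\<^esub> y] = f [x] + f [y])"
proof -
  have "coboundary G 1 f xs = 0 \<longleftrightarrow>
      (\<forall>x\<in>carrier G. \<forall>y\<in>carrier G. xs = [x, y] \<longrightarrow> f [x \<otimes>\<^bsub>G\<^esub> y] = f [x] + f [y])" for xs
    by (auto simp: coboundary_def length_Suc_conv eval_nat_numeral)
      (auto simp: algebra_simps)
  then have "coboundary G 1 f = 0 \<longleftrightarrow>
      (\<forall>x\<in>carrier G. \<forall>y\<in>carrier G. f [x \<otimes>\<^bsub>G\<^esub> y] = f [x] + f [y])"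
    unfolding fun_eq_iff by auto
  then show ?thesis unfolding H1_def cocycles_def cochains_def by auto
qed

lemma H1_zero_outside: "f \<in> H1 G \<Longrightarrow> \<not> (length xs = 1 \<and> set xs \<subseteq> carrier G) \<Longrightarrow> f xs = 0"
  by (auto simp: H1_iff)

lemma H1_add: "f \<in> H1 G \<Longrightarrow> x \<in> carrier G \<Longrightarrow> y \<in> carrier G \<Longrightarrow> f [x \<otimes>\<^bsub>G\<^esub> y] = f [x] + f [y]"
  by (auto simp: H1_iff)

lemma H1_eqI:
  assumes "f \<in> H1 G" "g \<in> H1 G" "\<And>x. x \<in> carrier G \<Longrightarrow> f [x] = g [x]"
  shows "f = g"
proof
  fix xs
  show "f xs = g xs"
  proof (cases "length xs = 1 \<and> set xs \<subseteq> carrier G")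
    case True
    then obtain x where "xs = [x]" "x \<in> carrier G" by (cases xs) auto
    then show ?thesis using assms by simp
  next
    case False
    then show ?thesis using H1_zero_outside[OF assms(1) False] H1_zero_outside[OF assms(2) False] by simp
  qed
qed

lemma subspace_H1: "cfun.subspace (H1 G)"
proof (rule cfun.subspaceI)
  fix f g assume fg: "f \<in> H1 G" "g \<in> H1 G"
  show "f + g \<in> H1 G"
    unfolding H1_iff
  proof (intro conjI allI ballI impI)
    fix xs assume "(f + g) xs \<noteq> 0"
    then have "f xs \<noteq> 0 \<or> g xs \<noteq> 0" by auto
    then show "length xs = 1" "set xs \<subseteq> carrier G" using fg unfolding H1_iff by blast+
  qed (simp add: H1_add[OF fg(1)] H1_add[OF fg(2)])
qed (auto simp: H1_iff algebra_simps)

lemma (in group) H1_one: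
  assumes "f \<in> H1 G"
  shows "f [\<one>] = 0"
  using H1_add[OF assms one_closed one_closed] by simp

lemma (in group) H1_inv:
  assumes "f \<in> H1 G" "x \<in> carrier G"
  shows "f [inv x] = - f [x]"
  using H1_add[OF assms(1) assms(2) inv_closed[OF assms(2)]] H1_one[OF assms(1)] assms(2)
  by (simp add: eq_neg_iff_add_eq_0 add.commute)

lemma (in group) H1_zero_if_zero_on_generators:
  assumes "S \<subseteq> carrier G" "generate G S = carrier G" "f \<in> H1 G" "\<And>s. s \<in> S \<Longrightarrow> f [s] = 0"
  shows "f = 0"
proof (rule H1_eqI[OF assms(3)])
  show "0 \<in> H1 G" using subspace_H1 cfun.subspace_0 by blast
  fix x assume "x \<in> carrier G"
  then have "x \<in> generate G S" using assms by simp
  then have "f [x] = 0"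
  proof induction
    case (inv s)
    then show ?case using H1_inv[OF assms(3), of s] assms(1,4) by auto
  next
    case (eng x y)
    then show ?case using H1_add[OF assms(3)] generate_in_carrier[OF assms(1)] by simp
  qed (use H1_one assms in auto)
  then show "f [x] = 0 [x]" by simp
qed

lemma H1_finite_span:
  assumes "finitely_generated_group G"
  obtains F where "finite F" "H1 G \<subseteq> cfun.span F"
proof -
  obtain S where G: "group G" and S: "finite S" "S \<subseteq> carrier G" "generate G S = carrier G"
    using assms by (auto simp: finitely_generated_group_def)
  obtain B where "finite B" "cfun.span B = H1 G"
  proof (rule span_finite_if_determined[OF subspace_H1[of G], of "(\<lambda>s. [s]) ` S"])
    show "finite ((\<lambda>s. [s]) ` S)" using S by simp
    fix f assume "f \<in> H1 G" "\<And>t. t \<in> (\<lambda>s. [s]) ` S \<Longrightarrow> f t = 0"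
    then show "f = 0" using group.H1_zero_if_zero_on_generators[OF G S(2,3)] by blast
  qed blast
  then show thesis using that by blast
qed

lemma (in group) cup_coboundary_iff:
  assumes a: "a \<in> H1 G" and u: "u \<in> H1 G"
  shows "cup 1 a u \<in> coboundaries G 2 \<longleftrightarrow> cup_exact G a u"
proof
  assume "cup 1 a u \<in> coboundaries G 2"
  then obtain f where f: "cup 1 a u = coboundary G 1 f" by (auto simp: numeral_2_eq_2)
  have "a [x] * u [y] = f [x] + f [y] - f [x \<otimes>\<^bsub>G\<^esub> y]" if "x \<in> carrier G" "y \<in> carrier G" for x y
    using fun_cong[OF f, of "[x, y]"] that by (simp add: cup_def coboundary_def)
  then show "cup_exact G a u" unfolding cup_exact_def by (intro exI[of _ "\<lambda>x. f [x]"]) blast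
next
  assume "cup_exact G a u"
  then obtain c where c: "\<And>x y. x \<in> carrier G \<Longrightarrow> y \<in> carrier G \<Longrightarrow> a [x] * u [y] = c x + c y - c (x \<otimes>\<^bsub>G\<^esub> y)"
    unfolding cup_exact_def by blast
  define f where "f xs = (if length xs = 1 \<and> set xs \<subseteq> carrier G then c (hd xs) else 0)" for xs
  have "cup 1 a u xs = coboundary G 1 f xs" for xs
  proof (cases "length xs = 2 \<and> set xs \<subseteq> carrier G")
    case True
    then obtain x y where "xs = [x, y]" "x \<in> carrier G" "y \<in> carrier G"
      by (auto simp: length_Suc_conv eval_nat_numeral)
    then show ?thesis using c by (simp add: cup_def coboundary_def f_def)
  next
    case False
    \<comment> \<open>Off lists of length 2 over G one of the two factors is evaluated outside its
      support, matching the zero value of the coboundary.\<close>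
    have "a (take 1 xs) = 0 \<or> u (drop 1 xs) = 0"
    proof (rule ccontr)
      assume "\<not> ?thesis"
      then have "length (take 1 xs) = 1" "length (drop 1 xs) = 1"
        "set (take 1 xs) \<subseteq> carrier G" "set (drop 1 xs) \<subseteq> carrier G"
        using H1_zero_outside[OF a] H1_zero_outside[OF u] by blast+
      moreover have "set xs = set (take 1 xs) \<union> set (drop 1 xs)"
        by (metis append_take_drop_id set_append)
      ultimately have "length xs = 2" "set xs \<subseteq> carrier G" by (simp, blast)
      then show False using False by blast
    qed
    then show ?thesis using False by (auto simp: cup_def coboundary_def)
  qed
  moreover have "f \<in> cochains G 1" by (auto simp: cochains_def f_def)
  ultimately show "cup 1 a u \<in> coboundaries G 2" by (auto simp: numeral_2_eq_2 fun_eq_iff)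
qed

lemma linear_cup_right: "Vector_Spaces.linear cscale cscale (cup 1 a)"
  by (rule linear_cscaleI) (auto simp: cup_def fun_eq_iff algebra_simps)

lemma linear_cup_left: "Vector_Spaces.linear cscale cscale (\<lambda>a. cup 1 a u)"
  by (rule linear_cscaleI) (auto simp: cup_def fun_eq_iff algebra_simps)

lemma subspace_coboundaries: "cfun.subspace (coboundaries G (Suc n))"
proof -
  have "Vector_Spaces.linear cscale cscale (coboundary G n)"
    by (rule linear_cscaleI)
      (auto simp: coboundary_def fun_eq_iff algebra_simps sum.distrib sum_distrib_left sum_subtractf sum_negf)
  moreover have "cfun.subspace (cochains G n)"
  proof (rule cfun.subspaceI)
    fix f g assume fg: "f \<in> cochains G n" "g \<in> cochains G n"
    have "length xs = n \<and> set xs \<subseteq> carrier G" if "(f + g) xs \<noteq> 0" for xs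
    proof -
      have "f xs \<noteq> 0 \<or> g xs \<noteq> 0" using that by auto
      then show ?thesis using fg unfolding cochains_def by blast
    qed
    then show "f + g \<in> cochains G n" unfolding cochains_def by blast
  qed (auto simp: cochains_def)
  ultimately show ?thesis using cfun_pair.linear_subspace_image by simp
qed

text \<open>The primitive is -(r/2) times the square of a: expanding the square of a [x] + a [y]
  leaves just the cross term.\<close>

lemma cup_exact_self:
  assumes "a \<in> H1 G"
  shows "cup_exact G a (cscale r a)"
  unfolding cup_exact_def
proof (intro exI ballI)
  fix x y assume "x \<in> carrier G" "y \<in> carrier G"
  then show "a [x] * cscale r a [y] = - (r / 2) * (a [x])\<^sup>2 + - (r / 2) * (a [y])\<^sup>2 - - (r / 2) * (a [x \<otimes>\<^bsub>G\<^esub> y])\<^sup>2"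
    using H1_add[OF assms] by (simp add: power2_eq_square field_simps)
qed

text \<open>As \<open>a \<cup> a = 0\<close>, the complex \<open>(A, a)\<close> has cohomology in degree 1 iff \<open>a \<cup> u = 0\<close> for
  some \<open>u\<close> outside the line of \<open>a\<close>.\<close>

lemma resonance_iff:
  assumes fg: "finitely_generated_group G"
  shows "a \<in> resonance G \<longleftrightarrow> a \<in> H1 G \<and> (\<exists>u\<in>H1 G. cup_exact G a u \<and> u \<notin> cfun.span {a})"
proof (cases "a \<in> H1 G")
  case a: True
  interpret group G using fg by (simp add: finitely_generated_group_def)
  have V: "aomoto_cocycles G a 1 = {u \<in> H1 G. cup_exact G a u}"
    using cup_coboundary_iff[OF a] by (auto simp: aomoto_cocycles_def H1_def numeral_2_eq_2)
  \<comment> \<open>Degree-0 cocycles are constants, so multiplication by a sends them to the line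
    of a, which is just 0 when a = 0.\<close>
  have cup0: "cup 1 a v = cscale (v []) a" if "v \<in> cocycles G 0" for v
  proof
    fix xs
    have v: "v ys = 0" if "ys \<noteq> []" for ys
      using that \<open>v \<in> cocycles G 0\<close> by (auto simp: cocycles_def cochains_def)
    show "cup 1 a v xs = cscale (v []) a xs"
    proof (cases "length xs \<le> 1")
      case True
      then show ?thesis by (simp add: cup_def)
    next
      case False
      then show ?thesis using v[of "drop 1 xs"] H1_zero_outside[OF a, of xs] by (simp add: cup_def)
    qed
  qed
  have W: "aomoto_coboundaries G a 1 = cfun.span {a}"
  proof (intro equalityI subsetI)
    fix w assume "w \<in> aomoto_coboundaries G a 1"
    then obtain v where "v \<in> cocycles G 0" "w = cup 1 a v"
      using coboundaries_1[of G] by auto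
    then show "w \<in> cfun.span {a}" using cup0 by (simp add: cfun.span_scale cfun.span_base)
  next
    fix w assume "w \<in> cfun.span {a}"
    then obtain r where r: "w = cscale r a" by (auto simp: cfun.span_singleton)
    define v where "v xs = (if xs = [] then r else 0)" for xs :: "'a list"
    have "v \<in> cocycles G 0"
      by (auto simp: cocycles_def cochains_def v_def coboundary_def fun_eq_iff length_Suc_conv)
    moreover have "w = cup 1 a v + 0" using cup0[OF calculation] r by (simp add: v_def)
    moreover have "0 \<in> coboundaries G 1" by (subst coboundaries_1) simp
    ultimately show "w \<in> aomoto_coboundaries G a 1"
      unfolding One_nat_def aomoto_coboundaries.simps by blast
  qed
  obtain F where F: "finite F" "H1 G \<subseteq> cfun.span F" using H1_finite_span[OF fg] by blast
  have sub: "cfun.span {a} \<subseteq> {u \<in> H1 G. cup_exact G a u}"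
    using a cup_exact_self cfun.subspace_scale[OF subspace_H1] by (auto simp: cfun.span_singleton)
  have "aomoto_betti G a 1 \<ge> 1 \<longleftrightarrow> cfun.span {a} \<noteq> {u \<in> H1 G. cup_exact G a u}"
    unfolding aomoto_betti_def V W
    by (rule quotient_dim_pos_iff[OF F(1) _ cfun.subspace_span sub]) (use F(2) in blast)
  then show ?thesis using a sub by (auto simp: resonance_def)
qed (simp add: resonance_def)

text \<open>If \<open>a0\<close> is nonresonant, the products of \<open>a0\<close> with a complementary basis are independent in
  \<open>H\<^sup>2\<close>; the determinant of their dual coordinates vanishes on the resonance variety.\<close>

lemma resonance_separating_polynomial:
  assumes fg: "finitely_generated_group G" and a0: "a0 \<in> H1 G" "a0 \<notin> resonance G"
  shows "\<exists>p\<in>polynomial_functions. p a0 \<noteq> 0 \<and> (\<forall>a\<in>resonance G. p a = 0)"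
proof (cases "a0 = 0")
  case True
  \<comment> \<open>The zero class annihilates everything. It is thus nonresonant only if
    \<open>H1 G\<close> is 0, and then the resonance variety is empty and the constant 1
    separates.\<close>
  have "cup_exact G 0 u" for u by (auto simp: cup_exact_def intro!: exI[of _ "\<lambda>_. 0"])
  then have triv: "u = 0" if "u \<in> H1 G" for u
    using a0 that unfolding True resonance_iff[OF fg] by auto
  have "a \<notin> resonance G" for a
  proof
    assume "a \<in> resonance G"
    then obtain u where "u \<in> H1 G" "u \<notin> cfun.span {a}" unfolding resonance_iff[OF fg] by blast
    then show False using triv cfun.span_zero by metis
  qed
  then show ?thesis by (intro bexI[of _ "\<lambda>_. 1"]) (auto intro: polynomial_functions.const)
next
  case False
  interpret group G using fg by (simp add: finitely_generated_group_def)
  let ?W = "coboundaries G 2"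
  have W: "cfun.subspace ?W" unfolding numeral_2_eq_2 by (rule subspace_coboundaries)
  obtain F where F: "finite F" "H1 G \<subseteq> cfun.span F" using H1_finite_span[OF fg] by blast
  obtain BV where BV: "{a0} \<subseteq> BV" "BV \<subseteq> H1 G" "cfun.independent BV" "H1 G \<subseteq> cfun.span BV"
    using cfun.maximal_independent_subset_extend[of "{a0}" "H1 G"] a0 False by auto
  have finBV: "finite BV" using cfun.independent_span_bound[OF F(1) BV(3)] BV(2) F(2) by auto
  define B where "B = BV - {a0}"
  have B: "finite B" "B \<subseteq> H1 G" "cfun.independent B" "BV = insert a0 B" "a0 \<notin> B"
    using finBV BV cfun.independent_mono[OF BV(3), of "BV - {a0}"] by (auto simp: B_def)
  have a0B: "a0 \<notin> cfun.span B"
    using BV(3) B(4,5) by (simp add: cfun.independent_insert)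
  define m where "m = card B"
  obtain b where b: "bij_betw b {0..<m} B" using ex_bij_betw_nat_finite[OF B(1)] by (auto simp: m_def)
  have bB: "b j \<in> B" if "j < m" for j using b that by (auto simp: bij_betw_def)
  have spanB: "\<exists>c. x = (\<Sum>j<m. cscale (c j) (b j))" if "x \<in> cfun.span B" for x
  proof -
    obtain c where "x = (\<Sum>v\<in>B. cscale (c v) v)"
      using \<open>x \<in> cfun.span B\<close> unfolding cfun.span_finite[OF B(1)] by (rule imageE)
    also have "\<dots> = (\<Sum>j\<in>{0..<m}. cscale (c (b j)) (b j))"
      by (rule sum.reindex_bij_betw[OF b, symmetric])
    finally show ?thesis by (intro exI[of _ "\<lambda>j. c (b j)"]) (simp add: atLeast0LessThan)
  qed
  have indB: "c j = 0" if z: "(\<Sum>j<m. cscale (c j) (b j)) = 0" and "j < m" for c j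
  proof -
    have "(\<Sum>v\<in>B. cscale (c (the_inv_into {0..<m} b v)) v) = (\<Sum>j\<in>{0..<m}. cscale (c (the_inv_into {0..<m} b (b j))) (b j))"
      by (rule sum.reindex_bij_betw[OF b, symmetric])
    also have "\<dots> = (\<Sum>j\<in>{0..<m}. cscale (c j) (b j))"
      using b by (intro sum.cong) (auto simp: bij_betw_def the_inv_into_f_f)
    also have "\<dots> = 0" using z by (simp add: atLeast0LessThan)
    finally have "c (the_inv_into {0..<m} b (b j)) = 0"
      using cfun.independentD[OF B(3) B(1) subset_refl, of "\<lambda>v. c (the_inv_into {0..<m} b v)" "b j"]
        bB[OF \<open>j < m\<close>] by simp
    then show ?thesis using b \<open>j < m\<close> by (auto simp: bij_betw_def the_inv_into_f_f)
  qed
  have cup_sum: "cup 1 a (\<Sum>j<m. cscale (c j) (b j)) = (\<Sum>j<m. cscale (c j) (cup 1 a (b j)))" for a c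
    by (simp only: cfun_pair.linear_sum[OF linear_cup_right] cfun_pair.linear_scale[OF linear_cup_right])
  \<comment> \<open>The kernel of multiplication by the nonresonant class a0 is its own line, which
    meets the span of B in 0.\<close>
  have ind0: "c j = 0" if z: "(\<Sum>j<m. cscale (c j) (cup 1 a0 (b j))) \<in> ?W" and j: "j < m" for c j
  proof -
    let ?x = "\<Sum>j<m. cscale (c j) (b j)"
    have xB: "?x \<in> cfun.span B"
      using bB by (intro cfun.span_sum cfun.span_scale cfun.span_base) auto
    then have x: "?x \<in> H1 G" using cfun.span_minimal[OF B(2) subspace_H1] by blast
    have "cup_exact G a0 ?x" using z cup_coboundary_iff[OF a0(1) x] by (simp only: cup_sum)
    then have "?x \<in> cfun.span {a0}" using a0 x unfolding resonance_iff[OF fg] by blast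
    then obtain r where r: "?x = cscale r a0" unfolding cfun.span_singleton by (rule imageE)
    have "r = 0"
    proof (rule ccontr)
      assume "r \<noteq> 0"
      then have "a0 = cscale (1 / r) ?x" unfolding r by (auto simp: fun_eq_iff)
      then show False using a0B cfun.span_scale[OF xB] by metis
    qed
    then have "?x = 0" using r by (simp add: fun_eq_iff)
    then show ?thesis using indB j by blast
  qed
  define e where "e j = cup 1 a0 (b j)" for j
  \<comment> \<open>\<open>quotient_basis\<close> speaks of a set, so the products must be distinct;
    a coincidence would be a relation with coefficients 1 and -1.\<close>
  have inj_e: "inj_on e {..<m}"
  proof (rule inj_onI)
    fix i j assume ij: "i \<in> {..<m}" "j \<in> {..<m}" "e i = e j"
    show "i = j"
    proof (rule ccontr)
      assume "i \<noteq> j"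
      define c where "c k = (if k = i then 1 else if k = j then - 1 else 0 :: complex)" for k
      have "(\<Sum>k<m. cscale (c k) (e k)) = (\<Sum>k\<in>{i, j}. cscale (c k) (e k))"
        using ij by (intro sum.mono_neutral_right) (auto simp: c_def fun_eq_iff)
      also have "\<dots> = 0" using \<open>i \<noteq> j\<close> ij(3) by (simp add: c_def fun_eq_iff)
      finally have "(\<Sum>k<m. cscale (c k) (e k)) \<in> ?W" using cfun.subspace_0[OF W] by simp
      then have "c i = 0" using ind0[of c i] ij(1) by (simp add: e_def)
      then show False by (simp add: c_def)
    qed
  qed
  have qb: "quotient_basis (cfun.span (e ` {..<m})) ?W (e ` {..<m})"
    unfolding quotient_basis_def
  proof (intro conjI allI impI ballI)
    fix c v assume c: "(\<Sum>v\<in>e ` {..<m}. cscale (c v) v) \<in> ?W" and "v \<in> e ` {..<m}"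
    then obtain j where j: "j < m" "v = e j" by auto
    have "(\<Sum>v\<in>e ` {..<m}. cscale (c v) v) = (\<Sum>j<m. cscale (c (e j)) (e j))"
      by (rule sum.reindex_cong[OF inj_e]) auto
    then show "c v = 0" using c ind0[of "\<lambda>j. c (e j)" j] j by (simp add: e_def)
  qed (auto intro: cfun.span_base cfun.span_mono[THEN subsetD, rotated])
  obtain BW where BW: "BW \<subseteq> ?W" "cfun.independent BW" "?W \<subseteq> cfun.span BW"
    by (rule cfun.maximal_independent_subset)
  then have BW': "cfun.span BW = ?W" using W cfun.span_subspace by blast
  note ind = independent_quotient_basis[OF qb W BW(2) BW']
  \<comment> \<open>Functionals dual to the products a0 cup b_j, zero on coboundaries and defined on
    all cochains. The entries of \<open>M a\<close> are therefore linear in a, and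
    \<open>M a0\<close> is the identity.\<close>
  have "\<exists>\<xi>. Vector_Spaces.linear cscale (*) \<xi> \<and> (\<forall>w\<in>?W. \<xi> w = 0) \<and> (\<forall>j<m. \<xi> (e j) = (if i = j then 1 else 0))"
    if i: "i < m" for i
  proof -
    obtain \<xi> where \<xi>: "\<forall>x\<in>e ` {..<m} \<union> BW. \<xi> x = (if x = e i then 1 else 0)"
      and lin: "Vector_Spaces.linear cscale (*) \<xi>"
      using cfun_dual.linear_independent_extend[OF ind(1), of "\<lambda>x. if x = e i then 1 else 0"] by auto
    have "\<xi> w = 0" if "w \<in> ?W" for w
    proof (rule cfun_dual.linear_eq_0_on_span[OF lin])
      show "w \<in> cfun.span BW" using that BW' by simp
      show "\<xi> x = 0" if "x \<in> BW" for x using \<xi> ind(2) that i by auto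
    qed
    moreover have "\<xi> (e j) = (if i = j then 1 else 0)" if "j < m" for j
      using \<xi> that i inj_e by (auto simp: inj_on_def)
    ultimately show ?thesis using lin by blast
  qed
  then obtain \<xi> where \<xi>: "\<And>i. i < m \<Longrightarrow> Vector_Spaces.linear cscale (*) (\<xi> i)"
    "\<And>i w. i < m \<Longrightarrow> w \<in> ?W \<Longrightarrow> \<xi> i w = 0" "\<And>i j. i < m \<Longrightarrow> j < m \<Longrightarrow> \<xi> i (e j) = (if i = j then 1 else 0)"
    by metis
  have "cfun.independent {a0}" using False by simp
  then obtain l where l: "l a0 = 1" and lin_l: "Vector_Spaces.linear cscale (*) l"
    using cfun_dual.linear_independent_extend[of "{a0}" "\<lambda>_. 1"] by auto
  define M where "M a = mat m m (\<lambda>(i, j). \<xi> i (cup 1 a (b j)))" for a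
  \<comment> \<open>The factor \<open>l\<close> forces p to vanish at 0: if B is empty, the
    determinant is that of an empty matrix, namely 1, although 0 is then resonant.\<close>
  define p where "p a = Determinant.det (M a) * l a" for a
  have "p \<in> polynomial_functions"
  proof -
    have "(\<lambda>a. \<xi> i (cup 1 a (b j))) \<in> polynomial_functions" if "i < m" for i j
      using Vector_Spaces.linear_compose[OF linear_cup_left \<xi>(1)[OF that]]
      by (intro polynomial_functions.linear) (simp add: o_def)
    then have "(\<lambda>a. \<Sum>q | q permutes {0..<m}. signof q * (\<Prod>i = 0..<m. M a $$ (i, q i))) \<in> polynomial_functions"
      by (intro polynomial_functions_sum polynomial_functions.mult polynomial_functions.const
          polynomial_functions_prod) (auto simp: M_def permutes_in_image)
    moreover have "Determinant.det (M a) = (\<Sum>q | q permutes {0..<m}. signof q * (\<Prod>i = 0..<m. M a $$ (i, q i)))" for a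
      by (rule det_def') (simp add: M_def)
    ultimately show ?thesis
      unfolding p_def[abs_def] using polynomial_functions.linear[OF lin_l] by (auto intro: polynomial_functions.mult)
  qed
  moreover have "p a0 \<noteq> 0"
  proof -
    have "M a0 = 1\<^sub>m m" unfolding M_def using \<xi>(3) by (auto simp: e_def)
    then show ?thesis by (simp add: p_def l)
  qed
  moreover have "p a = 0" if aR: "a \<in> resonance G" for a
  proof (cases "a = 0")
    case True
    then show ?thesis by (simp add: p_def cfun_dual.linear_0[OF lin_l])
  next
    case a_nz: False
    obtain u where a: "a \<in> H1 G" and u: "u \<in> H1 G" "cup_exact G a u" "u \<notin> cfun.span {a}"
      using aR unfolding resonance_iff[OF fg] by blast
    have cupa: "cup 1 a a \<in> ?W"
      using cup_exact_self[OF a, of 1] cup_coboundary_iff[OF a a] by simp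
    have cupu: "cup 1 a u \<in> ?W" using cup_coboundary_iff[OF a u(1)] u(2) by simp
    obtain \<alpha> \<beta> where \<alpha>: "a - cscale \<alpha> a0 \<in> cfun.span B" and \<beta>: "u - cscale \<beta> a0 \<in> cfun.span B"
      using a u(1) BV(4) unfolding B(4) cfun.span_insert by blast
    \<comment> \<open>Both a and u are annihilated by a, and some nonzero combination of them has no
      a0-coordinate: a itself, or the one that eliminates this coordinate. Its coordinates in B form
      a kernel vector of \<open>M a\<close>.\<close>
    have "\<exists>x\<in>cfun.span B. x \<noteq> 0 \<and> cup 1 a x \<in> ?W"
    proof (cases "\<alpha> = 0")
      case True
      have "a - cscale \<alpha> a0 = a" using True by (auto simp: fun_eq_iff)
      then show ?thesis using \<alpha> a_nz cupa by (intro bexI[of _ a]) auto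
    next
      case False
      let ?x = "cscale \<beta> a - cscale \<alpha> u"
      have "?x = cscale \<beta> (a - cscale \<alpha> a0) - cscale \<alpha> (u - cscale \<beta> a0)"
        by (auto simp: fun_eq_iff algebra_simps)
      then have "?x \<in> cfun.span B"
        using cfun.span_diff[OF cfun.span_scale[OF \<alpha>] cfun.span_scale[OF \<beta>]] by metis
      moreover have "?x \<noteq> 0"
      proof
        assume "?x = 0"
        then have "u = cscale (\<beta> / \<alpha>) a" using False by (auto simp: fun_eq_iff field_simps)
        then show False using u(3) by (auto simp: cfun.span_singleton)
      qed
      moreover have "cup 1 a ?x \<in> ?W"
        unfolding cfun_pair.linear_diff[OF linear_cup_right] cfun_pair.linear_scale[OF linear_cup_right]
        by (intro cfun.subspace_diff[OF W] cfun.subspace_scale[OF W] cupa cupu)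
      ultimately show ?thesis by blast
    qed
    then obtain x where x: "x \<in> cfun.span B" "x \<noteq> 0" "cup 1 a x \<in> ?W" by blast
    obtain c where c: "x = (\<Sum>j<m. cscale (c j) (b j))" using spanB[OF x(1)] by blast
    obtain j where j: "j < m" "c j \<noteq> 0"
    proof (rule ccontr)
      assume "\<not> thesis"
      then have "\<And>j. j < m \<Longrightarrow> c j = 0" using that by blast
      then have "x = 0" unfolding c by (intro sum.neutral) (auto simp: fun_eq_iff)
      with x(2) show False by simp
    qed
    let ?v = "vec m c"
    have "?v \<noteq> 0\<^sub>v m" using j by (metis index_vec index_zero_vec(1))
    moreover have "M a *\<^sub>v ?v = 0\<^sub>v m"
    proof (rule eq_vecI)
      fix i assume "i < dim_vec (0\<^sub>v m :: complex vec)"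
      then have i: "i < m" by simp
      have "(M a *\<^sub>v ?v) $ i = (\<Sum>j<m. \<xi> i (cup 1 a (b j)) * c j)"
        using i by (simp add: M_def scalar_prod_def atLeast0LessThan)
      also have "\<dots> = \<xi> i (cup 1 a x)"
        unfolding c cup_sum cfun_dual.linear_sum[OF \<xi>(1)[OF i]] cfun_dual.linear_scale[OF \<xi>(1)[OF i]]
        by (simp add: mult.commute)
      also have "\<dots> = 0" using \<xi>(2)[OF i x(3)] .
      finally show "(M a *\<^sub>v ?v) $ i = 0\<^sub>v m $ i" using i by simp
    qed (simp add: M_def)
    moreover have "M a \<in> carrier_mat m m" by (simp add: M_def)
    ultimately have "Determinant.det (M a) = 0"
      using det_0_iff_vec_prod_zero_field[of "M a" m] by (metis vec_carrier)
    then show ?thesis by (simp add: p_def)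
  qed
  ultimately show ?thesis by blast
qed

text \<open>All polynomial functions vanishing on the resonance variety are taken as equations;
  separation at each nonresonant class shows that they cut out nothing more.\<close>

theorem algebraic_resonance:
  assumes fg: "finitely_generated_group G"
  shows "algebraic_set (H1 G) (resonance G)"
proof -
  let ?P = "{p \<in> polynomial_functions. \<forall>a\<in>resonance G. p a = 0}"
  have "resonance G = {a \<in> H1 G. \<forall>p\<in>?P. p a = 0}"
  proof (intro equalityI subsetI)
    fix a assume "a \<in> resonance G"
    then show "a \<in> {a \<in> H1 G. \<forall>p\<in>?P. p a = 0}" by (auto simp: resonance_def)
  next
    fix a assume a: "a \<in> {a \<in> H1 G. \<forall>p\<in>?P. p a = 0}"
    show "a \<in> resonance G"
    proof (rule ccontr)
      assume "a \<notin> resonance G"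
      then obtain p where "p \<in> ?P" "p a \<noteq> 0" using resonance_separating_polynomial[OF fg, of a] a by blast
      then show False using a by blast
    qed
  qed
  moreover have "?P \<subseteq> polynomial_functions" by blast
  ultimately show ?thesis unfolding algebraic_set_def by blast
qed


section \<open>Finiteness of the component counts\<close>

lemma zero_in_resonance_iff:
  assumes "finitely_generated_group G"
  shows "0 \<in> resonance G \<longleftrightarrow> H1 G \<noteq> {0}"
proof -
  have "cup_exact G 0 u" for u by (auto simp: cup_exact_def intro!: exI[of _ "\<lambda>_. 0"])
  then show ?thesis unfolding resonance_iff[OF assms]
    using cfun.subspace_0[OF subspace_H1[of G]] by auto
qed

lemma resonance_count_eq: "resonance_count G m = card (components_of_dim (H1 G) (resonance G) m)"
  by (simp add: resonance_count_def components_of_dim_def)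

lemma finite_components_resonance:
  assumes "finitely_generated_group G"
  shows "finite (irreducible_components (H1 G) (resonance G))"
proof -
  obtain F where "finite F" "H1 G \<subseteq> cfun.span F" using H1_finite_span[OF assms] by blast
  then show ?thesis using finite_irreducible_components algebraic_resonance[OF assms] by blast
qed

lemma finite_components_of_dim_resonance:
  assumes "finitely_generated_group G"
  shows "finite (components_of_dim (H1 G) (resonance G) m)"
  using finite_components_resonance[OF assms] by (simp add: components_of_dim_def)

text \<open>Finitely many components have finitely many dimensions. This makes the sum in the
  formula genuine, as a sum over an infinite index set is 0 by convention.\<close>

lemma finite_resonance_count_nonzero:
  assumes "finitely_generated_group G"
  shows "finite {m. resonance_count G m \<noteq> 0}"
proof -
  have "{m. resonance_count G m \<noteq> 0} \<subseteq>
      (\<lambda>Z. the_enat (zariski_dim (H1 G) Z)) ` irreducible_components (H1 G) (resonance G)"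
  proof
    fix m assume "m \<in> {m. resonance_count G m \<noteq> 0}"
    then have "components_of_dim (H1 G) (resonance G) m \<noteq> {}" by (auto simp: resonance_count_eq)
    then obtain Z where "Z \<in> irreducible_components (H1 G) (resonance G)" "zariski_dim (H1 G) Z = enat m"
      unfolding components_of_dim_def by blast
    then show "m \<in> (\<lambda>Z. the_enat (zariski_dim (H1 G) Z)) ` irreducible_components (H1 G) (resonance G)"
      by (intro image_eqI[of _ _ Z]) auto
  qed
  then show ?thesis using finite_components_resonance[OF assms] finite_surj by blast
qed

section \<open>Resonance of direct products\<close>

definition H1_pullback :: "('a, 'c) monoid_scheme \<Rightarrow> ('a \<Rightarrow> 'b) \<Rightarrow> ('b list \<Rightarrow> complex) \<Rightarrow> 'a list \<Rightarrow> complex" where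
  "H1_pullback G h f = (\<lambda>xs. if length xs = 1 \<and> set xs \<subseteq> carrier G then f (map h xs) else 0)"

lemma linear_H1_pullback: "Vector_Spaces.linear cscale cscale (H1_pullback G h)"
  by (rule linear_cscaleI) (auto simp: H1_pullback_def fun_eq_iff)

lemma H1_pullback_zero [simp]: "H1_pullback G h 0 = 0"
  by (auto simp: H1_pullback_def)

lemma H1_pullback_apply: "x \<in> carrier G \<Longrightarrow> H1_pullback G h f [x] = f [h x]"
  by (simp add: H1_pullback_def)

lemma (in group_hom) H1_pullback_in:
  assumes "f \<in> H1 H"
  shows "H1_pullback G h f \<in> H1 G"
  unfolding H1_iff using H1_add[OF assms] by (auto simp: H1_pullback_apply) (auto simp: H1_pullback_def split: if_splits)

lemma (in group_hom) cup_exact_pullback: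
  assumes "cup_exact H a u"
  shows "cup_exact G (H1_pullback G h a) (H1_pullback G h u)"
proof -
  obtain c where "\<And>x y. x \<in> carrier H \<Longrightarrow> y \<in> carrier H \<Longrightarrow> a [x] * u [y] = c x + c y - c (x \<otimes>\<^bsub>H\<^esub> y)"
    using assms unfolding cup_exact_def by blast
  then show ?thesis
    unfolding cup_exact_def by (intro exI[of _ "\<lambda>x. c (h x)"]) (simp add: H1_pullback_apply)
qed

text \<open>A retraction \<open>h\<close> of groups with section \<open>j\<close> embeds \<open>H\<^sup>1(H)\<close> as the classes \<open>f\<close> with \<open>f = f \<circ> j \<circ> h\<close>.\<close>

lemma H1_pullback_section:
  assumes "group_hom P G h" "group_hom G P j" and hj: "\<And>x. x \<in> carrier G \<Longrightarrow> h (j x) = x"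
    and f: "f \<in> H1 G"
  shows "H1_pullback G j (H1_pullback P h f) = f"
proof -
  interpret h: group_hom P G h by (rule assms)
  interpret j: group_hom G P j by (rule assms)
  show ?thesis
    using f by (intro H1_eqI[where G = G] j.H1_pullback_in h.H1_pullback_in) (auto simp: H1_pullback_apply hj)
qed

lemma linear_embedding_H1_pullback:
  assumes hom: "group_hom P G h" "group_hom G P j" and hj: "\<And>x. x \<in> carrier G \<Longrightarrow> h (j x) = x"
  shows "linear_embedding (H1 G) (H1 P) (H1_pullback P h) (H1_pullback G j)"
proof (rule linear_embedding.intro)
  interpret h: group_hom P G h by (rule hom)
  interpret j: group_hom G P j by (rule hom)
  show "H1_pullback P h ` H1 G \<subseteq> H1 P" "H1_pullback G j ` H1 P \<subseteq> H1 G"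
    using h.H1_pullback_in j.H1_pullback_in by auto
  let ?Q = "(\<lambda>x f. f [x] - f [j (h x)]) ` carrier P"
  have "?Q \<subseteq> polynomial_functions"
    by (auto intro!: polynomial_functions.linear linear_functionalI simp: algebra_simps)
  then have "algebraic_set (H1 P) {f \<in> H1 P. \<forall>q\<in>?Q. q f = 0}" by (rule algebraic_zeros)
  moreover have "H1_pullback P h ` H1 G = {f \<in> H1 P. \<forall>q\<in>?Q. q f = 0}"
  proof (intro equalityI subsetI)
    fix f assume "f \<in> H1_pullback P h ` H1 G"
    then obtain f' where "f' \<in> H1 G" "f = H1_pullback P h f'" by blast
    then show "f \<in> {f \<in> H1 P. \<forall>q\<in>?Q. q f = 0}" using h.H1_pullback_in hj by (auto simp: H1_pullback_apply)
  next
    fix f assume f: "f \<in> {f \<in> H1 P. \<forall>q\<in>?Q. q f = 0}"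
    then have "f = H1_pullback P h (H1_pullback G j f)"
      by (intro H1_eqI[where G = P] h.H1_pullback_in j.H1_pullback_in) (auto simp: H1_pullback_apply)
    moreover have "H1_pullback G j f \<in> H1 G" using f j.H1_pullback_in by blast
    ultimately show "f \<in> H1_pullback P h ` H1 G" by (rule image_eqI)
  qed
  ultimately show "algebraic_set (H1 P) (H1_pullback P h ` H1 G)" by simp
qed (auto intro: linear_H1_pullback H1_pullback_section[OF hom hj])

text \<open>Pulling back along the section \<open>j\<close> returns the original classes, so
  \<open>u\<close> cannot fall into the line of \<open>a\<close> after pullback.\<close>

lemma resonance_pullback:
  assumes fg: "finitely_generated_group P" "finitely_generated_group G"
    and hom: "group_hom P G h" "group_hom G P j" and hj: "\<And>x. x \<in> carrier G \<Longrightarrow> h (j x) = x"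
    and a: "a \<in> resonance G"
  shows "H1_pullback P h a \<in> resonance P"
proof -
  interpret h: group_hom P G h by (rule hom)
  obtain u where u: "a \<in> H1 G" "u \<in> H1 G" "cup_exact G a u" "u \<notin> cfun.span {a}"
    using a unfolding resonance_iff[OF fg(2)] by blast
  have "H1_pullback P h u \<notin> cfun.span {H1_pullback P h a}"
  proof
    assume "H1_pullback P h u \<in> cfun.span {H1_pullback P h a}"
    then obtain c where "H1_pullback P h u = cscale c (H1_pullback P h a)"
      unfolding cfun.span_singleton by (rule imageE)
    then have "H1_pullback G j (H1_pullback P h u) = cscale c (H1_pullback G j (H1_pullback P h a))"
      by (simp only: cfun_pair.linear_scale[OF linear_H1_pullback])
    then show False
      using u by (auto simp: H1_pullback_section[OF hom hj] cfun.span_singleton)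
  qed
  then show ?thesis
    unfolding resonance_iff[OF fg(1)] using h.H1_pullback_in h.cup_exact_pullback u by blast
qed

text \<open>The coboundary of c is symmetric on a commuting pair. This is the only obstruction used
  to show that a product is nonzero in cohomology.\<close>

lemma cup_exact_commuting:
  assumes "cup_exact G a u" "x \<in> carrier G" "y \<in> carrier G" "x \<otimes>\<^bsub>G\<^esub> y = y \<otimes>\<^bsub>G\<^esub> x"
  shows "a [x] * u [y] = a [y] * u [x]"
  using assms unfolding cup_exact_def by (metis add.commute)

context
  fixes G1 :: "('a, 'c) monoid_scheme" and G2 :: "('b, 'd) monoid_scheme"
  assumes fg1: "finitely_generated_group G1" and fg2: "finitely_generated_group G2"
begin

interpretation G1: group G1 using fg1 by (simp add: finitely_generated_group_def)
interpretation G2: group G2 using fg2 by (simp add: finitely_generated_group_def)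

interpretation P: group "G1 \<times>\<times> G2" by (rule DirProd_group) unfold_locales
interpretation j1: group_hom G1 "G1 \<times>\<times> G2" "\<lambda>g. (g, \<one>\<^bsub>G2\<^esub>)" by unfold_locales (auto simp: hom_def)
interpretation j2: group_hom G2 "G1 \<times>\<times> G2" "\<lambda>g. (\<one>\<^bsub>G1\<^esub>, g)" by unfold_locales (auto simp: hom_def)
interpretation p1: group_hom "G1 \<times>\<times> G2" G1 fst by unfold_locales (auto simp: hom_def)
interpretation p2: group_hom "G1 \<times>\<times> G2" G2 snd by unfold_locales (auto simp: hom_def)

abbreviation (input) "i1 \<equiv> H1_pullback (G1 \<times>\<times> G2) fst"
abbreviation (input) "i2 \<equiv> H1_pullback (G1 \<times>\<times> G2) snd"
abbreviation (input) "r1 \<equiv> H1_pullback G1 (\<lambda>g. (g, \<one>\<^bsub>G2\<^esub>))"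
abbreviation (input) "r2 \<equiv> H1_pullback G2 (\<lambda>g. (\<one>\<^bsub>G1\<^esub>, g))"

lemma H1_DirProd_apply:
  assumes "f \<in> H1 (G1 \<times>\<times> G2)" "x \<in> carrier G1" "y \<in> carrier G2"
  shows "f [(x, y)] = f [(x, \<one>\<^bsub>G2\<^esub>)] + f [(\<one>\<^bsub>G1\<^esub>, y)]"
  using H1_add[OF assms(1), of "(x, \<one>\<^bsub>G2\<^esub>)" "(\<one>\<^bsub>G1\<^esub>, y)"] assms by simp

lemma H1_DirProd_split:
  assumes f: "f \<in> H1 (G1 \<times>\<times> G2)"
  shows "f = i1 (r1 f) + i2 (r2 f)"
proof (rule H1_eqI[OF f])
  show "i1 (r1 f) + i2 (r2 f) \<in> H1 (G1 \<times>\<times> G2)"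
    using f j1.H1_pullback_in p1.H1_pullback_in j2.H1_pullback_in p2.H1_pullback_in
    by (intro cfun.subspace_add[OF subspace_H1]) auto
  fix g assume "g \<in> carrier (G1 \<times>\<times> G2)"
  then obtain x y where g: "g = (x, y)" "x \<in> carrier G1" "y \<in> carrier G2" by auto
  have "(i1 (r1 f) + i2 (r2 f)) [g] = f [(x, \<one>\<^bsub>G2\<^esub>)] + f [(\<one>\<^bsub>G1\<^esub>, y)]"
    using g by (simp add: H1_pullback_apply)
  then show "f [g] = (i1 (r1 f) + i2 (r2 f)) [g]"
    using H1_DirProd_apply[OF f g(2,3)] unfolding g(1) by (simp only:)
qed

lemma embedding1: "linear_embedding (H1 G1) (H1 (G1 \<times>\<times> G2)) i1 r1"
  by (rule linear_embedding_H1_pullback[OF p1.group_hom_axioms j1.group_hom_axioms]) simp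

lemma embedding2: "linear_embedding (H1 G2) (H1 (G1 \<times>\<times> G2)) i2 r2"
  by (rule linear_embedding_H1_pullback[OF p2.group_hom_axioms j2.group_hom_axioms]) simp

lemma embeddings_meet: "i1 ` H1 G1 \<inter> i2 ` H1 G2 \<subseteq> {0}"
proof
  fix f assume "f \<in> i1 ` H1 G1 \<inter> i2 ` H1 G2"
  then obtain f1 f2 where f: "f = i1 f1" "f1 \<in> H1 G1" "f = i2 f2" "f2 \<in> H1 G2" by blast
  have "f = 0"
  proof (rule H1_eqI[where G = "G1 \<times>\<times> G2"])
    show "f \<in> H1 (G1 \<times>\<times> G2)" using f p1.H1_pullback_in by blast
    show "0 \<in> H1 (G1 \<times>\<times> G2)" by (rule cfun.subspace_0[OF subspace_H1])
    fix g assume "g \<in> carrier (G1 \<times>\<times> G2)"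
    then obtain x y where g: "g = (x, y)" "x \<in> carrier G1" "y \<in> carrier G2" by auto
    have "f [g] = f1 [x]" using f(1) g by (simp add: H1_pullback_apply)
    also have "\<dots> = i1 f1 [(x, \<one>\<^bsub>G2\<^esub>)]" using g by (simp add: H1_pullback_apply)
    also have "\<dots> = i2 f2 [(x, \<one>\<^bsub>G2\<^esub>)]" using f by simp
    also have "\<dots> = 0" using g G2.H1_one[OF f(4)] by (simp add: H1_pullback_apply)
    finally show "f [g] = 0 [g]" by simp
  qed
  then show "f \<in> {0}" by simp
qed

text \<open>Write the classes as (a, b) and (u, v). The commuting pairs (x, 1), (1, y) give a(x)
  v(y) = b(y) u(x). If a and b are both nonzero, this forces u = c a and v = c b with one constant
  c, so no resonance. If exactly one of them is zero, so is the matching component of (u, v), and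
  the problem lives in the other factor.\<close>

lemma resonance_DirProd: "resonance (G1 \<times>\<times> G2) = i1 ` resonance G1 \<union> i2 ` resonance G2"
proof (intro equalityI subsetI)
  note fg = finitely_generated_DirProd[OF fg1 fg2]
  fix \<alpha> assume "\<alpha> \<in> i1 ` resonance G1 \<union> i2 ` resonance G2"
  then show "\<alpha> \<in> resonance (G1 \<times>\<times> G2)"
    using resonance_pullback[OF fg fg1 p1.group_hom_axioms j1.group_hom_axioms]
      resonance_pullback[OF fg fg2 p2.group_hom_axioms j2.group_hom_axioms] by auto
next
  note fg = finitely_generated_DirProd[OF fg1 fg2]
  fix \<alpha> assume "\<alpha> \<in> resonance (G1 \<times>\<times> G2)"
  then obtain \<upsilon> where \<alpha>: "\<alpha> \<in> H1 (G1 \<times>\<times> G2)" and \<upsilon>: "\<upsilon> \<in> H1 (G1 \<times>\<times> G2)"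
    and ex: "cup_exact (G1 \<times>\<times> G2) \<alpha> \<upsilon>" and span: "\<upsilon> \<notin> cfun.span {\<alpha>}"
    unfolding resonance_iff[OF fg] by blast
  define a b u v where "a = r1 \<alpha>" and "b = r2 \<alpha>" and "u = r1 \<upsilon>" and "v = r2 \<upsilon>"
  have H1: "a \<in> H1 G1" "u \<in> H1 G1" "b \<in> H1 G2" "v \<in> H1 G2"
    unfolding a_def b_def u_def v_def using \<alpha> \<upsilon> j1.H1_pullback_in j2.H1_pullback_in by auto
  have \<alpha>_eq: "\<alpha> = i1 a + i2 b" and \<upsilon>_eq: "\<upsilon> = i1 u + i2 v"
    unfolding a_def b_def u_def v_def using H1_DirProd_split \<alpha> \<upsilon> by auto
  have ex1: "cup_exact G1 a u" and ex2: "cup_exact G2 b v"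
    unfolding a_def b_def u_def v_def using j1.cup_exact_pullback[OF ex] j2.cup_exact_pullback[OF ex] by auto
  have sym: "a [x] * v [y] = b [y] * u [x]" if "x \<in> carrier G1" "y \<in> carrier G2" for x y
    using cup_exact_commuting[OF ex, of "(x, \<one>\<^bsub>G2\<^esub>)" "(\<one>\<^bsub>G1\<^esub>, y)"] that
    by (simp add: a_def b_def u_def v_def H1_pullback_apply)
  have i0: "i1 0 = 0" "i2 0 = 0" by simp_all
  have nz: "\<exists>x\<in>carrier G. f [x] \<noteq> 0" if "f \<in> H1 G" "f \<noteq> 0" for f :: "'z list \<Rightarrow> complex" and G :: "('z, 'w) monoid_scheme"
    using H1_eqI[OF that(1) cfun.subspace_0[OF subspace_H1]] that(2) by fastforce
  have scale1: "i1 (cscale c f) = cscale c (i1 f)" for c f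
    by (rule cfun_pair.linear_scale[OF linear_H1_pullback])
  have scale2: "i2 (cscale c f) = cscale c (i2 f)" for c f
    by (rule cfun_pair.linear_scale[OF linear_H1_pullback])
  show "\<alpha> \<in> i1 ` resonance G1 \<union> i2 ` resonance G2"
  proof (cases "a = 0")
    case a0: True
    \<comment> \<open>Even the origin needs an argument: it belongs to the resonance variety of a
      factor only if that factor has nonzero \<open>H1\<close>.\<close>
    show ?thesis
    proof (cases "b = 0")
      case True
      then have \<alpha>0: "\<alpha> = 0" using \<alpha>_eq a0 i0 by simp
      then have "\<upsilon> \<noteq> 0" using span cfun.span_zero by metis
      then have "u \<noteq> 0 \<or> v \<noteq> 0" using \<upsilon>_eq i0 by auto
      then have "0 \<in> resonance G1 \<or> 0 \<in> resonance G2"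
        using zero_in_resonance_iff[OF fg1] zero_in_resonance_iff[OF fg2] H1 by blast
      then have "i1 0 \<in> i1 ` resonance G1 \<or> i2 0 \<in> i2 ` resonance G2" by blast
      then show ?thesis using \<alpha>0 i0 by auto
    next
      case False
      then obtain y where y: "y \<in> carrier G2" "b [y] \<noteq> 0" using nz H1 by blast
      have "u [x] = 0" if "x \<in> carrier G1" for x using sym[OF that y(1)] y(2) a0 by simp
      then have "u = 0" using nz H1 by blast
      then have \<upsilon>2: "\<upsilon> = i2 v" using \<upsilon>_eq i0 by simp
      have \<alpha>2: "\<alpha> = i2 b" using \<alpha>_eq i0 a0 by simp
      have "v \<notin> cfun.span {b}"
        using span unfolding \<upsilon>2 \<alpha>2 by (auto simp: cfun.span_singleton scale2)
      then have "b \<in> resonance G2" unfolding resonance_iff[OF fg2] using H1 ex2 by blast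
      then show ?thesis using \<alpha>2 by blast
    qed
  next
    case a_nz: False
    then obtain x0 where x0: "x0 \<in> carrier G1" "a [x0] \<noteq> 0" using nz H1 by blast
    show ?thesis
    proof (cases "b = 0")
      case True
      then have "v [y] = 0" if "y \<in> carrier G2" for y using sym[OF x0(1) that] x0 by simp
      then have "v = 0" using nz H1 by blast
      then have \<upsilon>1: "\<upsilon> = i1 u" using \<upsilon>_eq i0 by simp
      have \<alpha>1: "\<alpha> = i1 a" using \<alpha>_eq i0 True by simp
      have "u \<notin> cfun.span {a}"
        using span unfolding \<upsilon>1 \<alpha>1 by (auto simp: cfun.span_singleton scale1)
      then have "a \<in> resonance G1" unfolding resonance_iff[OF fg1] using H1 ex1 by blast
      then show ?thesis using \<alpha>1 by blast
    next
      case False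
      then obtain y0 where y0: "y0 \<in> carrier G2" "b [y0] \<noteq> 0" using nz H1 by blast
      define c where "c = u [x0] / a [x0]"
      have v: "v = cscale c b"
      proof (rule H1_eqI[OF H1(4) cfun.subspace_scale[OF subspace_H1 H1(3)]])
        fix y assume "y \<in> carrier G2"
        then show "v [y] = cscale c b [y]" using sym[OF x0(1)] x0(2) by (simp add: c_def field_simps)
      qed
      have u: "u = cscale c a"
      proof (rule H1_eqI[OF H1(2) cfun.subspace_scale[OF subspace_H1 H1(1)]])
        fix x assume "x \<in> carrier G1"
        then show "u [x] = cscale c a [x]" using sym[OF _ y0(1), of x] y0(2) unfolding v by (simp add: mult_ac)
      qed
      have "\<upsilon> = cscale c \<alpha>"
        unfolding \<upsilon>_eq \<alpha>_eq u v scale1 scale2 by (auto simp: fun_eq_iff algebra_simps)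
      then show ?thesis using span by (auto simp: cfun.span_singleton)
    qed
  qed
qed

lemma resonance_count_DirProd:
  assumes "m \<ge> 1"
  shows "resonance_count (G1 \<times>\<times> G2) m = resonance_count G1 m + resonance_count G2 m"
  unfolding resonance_count_eq resonance_DirProd
  by (intro card_components_of_dim_union[OF embedding1 embedding2] algebraic_resonance fg1 fg2
      embeddings_meet assms finite_components_of_dim_resonance) (auto simp: resonance_def)

theorem chen_ranks_formula_DirProd:
  assumes "chen_ranks_formula G1" "chen_ranks_formula G2"
  shows "chen_ranks_formula (G1 \<times>\<times> G2)"
  unfolding chen_ranks_formula_def
proof (rule eventually_elim2[OF assms(1)[unfolded chen_ranks_formula_def]
    eventually_conj[OF assms(2)[unfolded chen_ranks_formula_def] eventually_ge_at_top[of 1]]], elim conjE)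
  fix k :: nat
  let ?I1 = "{m. m \<ge> 2 \<and> resonance_count G1 m \<noteq> 0}" and ?I2 = "{m. m \<ge> 2 \<and> resonance_count G2 m \<noteq> 0}"
  let ?\<theta> = "\<lambda>m. chen_rank (free_group {..<m}) k"
  assume k: "k \<ge> 1" and 1: "chen_rank G1 k = (\<Sum>m\<in>?I1. resonance_count G1 m * ?\<theta> m)"
    and 2: "chen_rank G2 k = (\<Sum>m\<in>?I2. resonance_count G2 m * ?\<theta> m)"
  have fin: "finite (?I1 \<union> ?I2)"
    using finite_resonance_count_nonzero[OF fg1] finite_resonance_count_nonzero[OF fg2]
    by (auto intro: finite_subset[rotated])
  \<comment> \<open>Counts are natural numbers and cannot cancel, so the support for the product is
    exactly the union. Both sums are then extended to it by zero terms.\<close>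
  have I: "{m. m \<ge> 2 \<and> resonance_count (G1 \<times>\<times> G2) m \<noteq> 0} = ?I1 \<union> ?I2"
    using resonance_count_DirProd by auto
  have "chen_rank (G1 \<times>\<times> G2) k = chen_rank G1 k + chen_rank G2 k"
    by (rule chen_rank_DirProd[OF fg1 fg2 k])
  also have "chen_rank G1 k = (\<Sum>m\<in>?I1 \<union> ?I2. resonance_count G1 m * ?\<theta> m)"
    unfolding 1 using fin by (intro sum.mono_neutral_left) auto
  also have "chen_rank G2 k = (\<Sum>m\<in>?I1 \<union> ?I2. resonance_count G2 m * ?\<theta> m)"
    unfolding 2 using fin by (intro sum.mono_neutral_left) auto
  also have "(\<Sum>m\<in>?I1 \<union> ?I2. resonance_count G1 m * ?\<theta> m) + (\<Sum>m\<in>?I1 \<union> ?I2. resonance_count G2 m * ?\<theta> m) =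
      (\<Sum>m\<in>?I1 \<union> ?I2. resonance_count (G1 \<times>\<times> G2) m * ?\<theta> m)"
    unfolding sum.distrib[symmetric] using resonance_count_DirProd
    by (intro sum.cong) (auto simp: algebra_simps)
  finally show "chen_rank (G1 \<times>\<times> G2) k =
      (\<Sum>m | m \<ge> 2 \<and> resonance_count (G1 \<times>\<times> G2) m \<noteq> 0. resonance_count (G1 \<times>\<times> G2) m * ?\<theta> m)"
    unfolding I .
qed

end

section \<open>Presented monoids\<close>

text \<open>\<open>word_cong\<close> restricts just the endpoints of a rewriting path to words over
  \<open>A\<close>; \<open>R_words\<close> keeps the intermediate words there as well.\<close>

locale word_presentation =
  fixes A :: "'x set" and R :: "('x list \<times> 'x list) set"
  assumes R_words: "R \<subseteq> lists A \<times> lists A"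
begin

abbreviation cls :: "'x list \<Rightarrow> 'x list set" where
  "cls w \<equiv> word_cong A R `` {w}"

abbreviation (input) steps :: "('x list \<times> 'x list) set" where
  "steps \<equiv> word_step A R \<union> (word_step A R)\<inverse>"

lemma equiv_word_cong: "equiv (lists A) (word_cong A R)"
proof -
  have "sym (steps\<^sup>*)" by (rule sym_rtrancl) (auto simp: sym_def)
  then show ?thesis
    unfolding word_cong_def by (intro equivI) (auto simp: refl_on_def sym_def trans_def)
qed

lemma word_step_context:
  assumes "(u, v) \<in> word_step A R" "p \<in> lists A" "q \<in> lists A"
  shows "(p @ u @ q, p @ v @ q) \<in> word_step A R"
proof -
  obtain p' q' u' v' where 1: "u = p' @ u' @ q'" "v = p' @ v' @ q'" "p' \<in> lists A" "q' \<in> lists A" "(u', v') \<in> R"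
    using assms(1) by (auto simp: word_step_def)
  have "p @ u @ q = (p @ p') @ u' @ (q' @ q)" "p @ v @ q = (p @ p') @ v' @ (q' @ q)" using 1 by simp_all
  moreover have "p @ p' \<in> lists A" "q' @ q \<in> lists A" using 1 assms by auto
  ultimately show ?thesis using 1(5) unfolding word_step_def by blast
qed

lemma steps_context:
  assumes "(u, v) \<in> steps\<^sup>*" "p \<in> lists A" "q \<in> lists A"
  shows "(p @ u @ q, p @ v @ q) \<in> steps\<^sup>*"
  using assms(1)
proof induction
  case (step y z)
  then have "(p @ y @ q, p @ z @ q) \<in> steps" using word_step_context assms(2,3) by blast
  with step.IH show ?case by (rule rtrancl_into_rtrancl)
qed simp

lemma word_cong_append:
  assumes "(u, u') \<in> word_cong A R" "(v, v') \<in> word_cong A R"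
  shows "(u @ v, u' @ v') \<in> word_cong A R"
proof -
  have w: "u \<in> lists A" "u' \<in> lists A" "v \<in> lists A" "v' \<in> lists A"
    and s: "(u, u') \<in> steps\<^sup>*" "(v, v') \<in> steps\<^sup>*"
    using assms by (auto simp: word_cong_def)
  have "(u @ v, u' @ v) \<in> steps\<^sup>*" using steps_context[OF s(1), of "[]" v] w by simp
  moreover have "(u' @ v, u' @ v') \<in> steps\<^sup>*" using steps_context[OF s(2), of u' "[]"] w by simp
  ultimately have "(u @ v, u' @ v') \<in> steps\<^sup>*" by (rule rtrancl_trans)
  with w show ?thesis by (simp add: word_cong_def)
qed

lemma relation_word_cong: "(u, v) \<in> R \<Longrightarrow> (u, v) \<in> word_cong A R"
proof -
  assume uv: "(u, v) \<in> R"
  then have "(u, v) \<in> word_step A R" unfolding word_step_def by (force intro: exI[of _ "[]"])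
  then show ?thesis using uv R_words by (auto simp: word_cong_def)
qed

lemma cls_relation: "(u, v) \<in> R \<Longrightarrow> cls u = cls v"
  using equiv_class_eq[OF equiv_word_cong] relation_word_cong by blast

lemma in_carrier: "w \<in> lists A \<Longrightarrow> cls w \<in> carrier (presented_monoid A R)"
  by (simp add: presented_monoid_def quotientI)

lemma carrier_cases:
  assumes "X \<in> carrier (presented_monoid A R)"
  obtains w where "w \<in> lists A" "X = cls w"
proof -
  have "X \<in> lists A // word_cong A R" using assms by (simp add: presented_monoid_def)
  then show thesis by (rule quotientE) (rule that)
qed

lemma mult_cls:
  assumes "u \<in> lists A" "v \<in> lists A"
  shows "cls u \<otimes>\<^bsub>presented_monoid A R\<^esub> cls v = cls (u @ v)"
proof -
  have "(\<Union>x\<in>cls u. \<Union>y\<in>cls v. cls (x @ y)) = cls (u @ v)"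
  proof -
    have "cls (x @ y) = cls (u @ v)" if "x \<in> cls u" "y \<in> cls v" for x y
      using that word_cong_append equiv_class_eq[OF equiv_word_cong] by (metis Image_singleton_iff)
    moreover have "u \<in> cls u" "v \<in> cls v" using assms equiv_class_self[OF equiv_word_cong] by auto
    ultimately show ?thesis by blast
  qed
  then show ?thesis by (simp add: presented_monoid_def)
qed

lemma one_cls: "\<one>\<^bsub>presented_monoid A R\<^esub> = cls []"
  by (simp add: presented_monoid_def)

text \<open>Left inverses of letters suffice: a word is inverted by inverting its letters in reverse
  order.\<close>

lemma group_presented_monoid:
  assumes inv: "\<And>a. a \<in> A \<Longrightarrow> \<exists>b\<in>A. cls [b, a] = cls []"
  shows "group (presented_monoid A R)"
proof (rule groupI)
  show "\<one>\<^bsub>presented_monoid A R\<^esub> \<in> carrier (presented_monoid A R)" by (simp add: one_cls in_carrier)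
next
  fix X Y assume "X \<in> carrier (presented_monoid A R)" "Y \<in> carrier (presented_monoid A R)"
  then show "X \<otimes>\<^bsub>presented_monoid A R\<^esub> Y \<in> carrier (presented_monoid A R)"
    by (elim carrier_cases) (simp add: mult_cls in_carrier)
next
  fix X Y Z assume "X \<in> carrier (presented_monoid A R)" "Y \<in> carrier (presented_monoid A R)"
    "Z \<in> carrier (presented_monoid A R)"
  then show "X \<otimes>\<^bsub>presented_monoid A R\<^esub> Y \<otimes>\<^bsub>presented_monoid A R\<^esub> Z =
      X \<otimes>\<^bsub>presented_monoid A R\<^esub> (Y \<otimes>\<^bsub>presented_monoid A R\<^esub> Z)"
    by (elim carrier_cases) (simp add: mult_cls)
next
  fix X assume "X \<in> carrier (presented_monoid A R)"
  then show "\<one>\<^bsub>presented_monoid A R\<^esub> \<otimes>\<^bsub>presented_monoid A R\<^esub> X = X"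
    by (elim carrier_cases) (simp add: one_cls mult_cls)
next
  fix X assume "X \<in> carrier (presented_monoid A R)"
  then obtain w where w: "w \<in> lists A" "X = cls w" by (rule carrier_cases)
  have "\<exists>v\<in>lists A. cls (v @ w) = cls []"
    using w(1)
  proof (induction w)
    case (Cons a w)
    then obtain v where v: "v \<in> lists A" "cls (v @ w) = cls []" by blast
    obtain b where b: "b \<in> A" "cls [b, a] = cls []" using inv Cons by blast
    have "cls ((v @ [b]) @ a # w) =
        cls v \<otimes>\<^bsub>presented_monoid A R\<^esub> (cls [b, a] \<otimes>\<^bsub>presented_monoid A R\<^esub> cls w)"
      using v(1) b(1) Cons.hyps by (simp add: mult_cls)
    also have "\<dots> = cls v \<otimes>\<^bsub>presented_monoid A R\<^esub> (cls [] \<otimes>\<^bsub>presented_monoid A R\<^esub> cls w)"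
      by (simp only: b(2))
    also have "\<dots> = cls (v @ w)" using v(1) Cons.hyps by (simp add: mult_cls)
    also note v(2)
    finally show ?case using v(1) b(1) by (intro bexI[of _ "v @ [b]"]) auto
  qed (intro bexI[of _ "[]"], auto)
  then obtain v where "v \<in> lists A" "cls (v @ w) = cls []" by blast
  then show "\<exists>Y\<in>carrier (presented_monoid A R). Y \<otimes>\<^bsub>presented_monoid A R\<^esub> X = \<one>\<^bsub>presented_monoid A R\<^esub>"
    using w by (intro bexI[of _ "cls v"]) (simp_all add: mult_cls one_cls in_carrier)
qed

primrec word_eval :: "('h, 'k) monoid_scheme \<Rightarrow> ('x \<Rightarrow> 'h) \<Rightarrow> 'x list \<Rightarrow> 'h" where
  "word_eval H f [] = \<one>\<^bsub>H\<^esub>"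
| "word_eval H f (a # w) = f a \<otimes>\<^bsub>H\<^esub> word_eval H f w"

text \<open>The universal property. Evaluation of words is invariant under a single rewriting step,
  hence constant on congruence classes.\<close>

lemma presented_monoid_hom:
  assumes H: "group H" and f: "\<And>a. a \<in> A \<Longrightarrow> f a \<in> carrier H"
    and rel: "\<And>u v. (u, v) \<in> R \<Longrightarrow> word_eval H f u = word_eval H f v"
  obtains \<Phi> where "\<Phi> \<in> hom (presented_monoid A R) H" "\<And>a. a \<in> A \<Longrightarrow> \<Phi> (cls [a]) = f a"
proof -
  interpret H: group H by (rule H)
  have closed: "word_eval H f w \<in> carrier H" if "w \<in> lists A" for w
    using that by (induction w) (auto simp: f)
  have app: "word_eval H f (u @ v) = word_eval H f u \<otimes>\<^bsub>H\<^esub> word_eval H f v"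
    if "u \<in> lists A" "v \<in> lists A" for u v
    using that by (induction u) (auto simp: f closed H.m_assoc)
  have "word_eval H f u = word_eval H f v" if uv: "(u, v) \<in> word_step A R" for u v
  proof -
    obtain p q u' v' where 1: "u = p @ u' @ q" "v = p @ v' @ q" "p \<in> lists A" "q \<in> lists A" "(u', v') \<in> R"
      using uv unfolding word_step_def by blast
    moreover have "u' \<in> lists A" "v' \<in> lists A" using 1(5) R_words by auto
    ultimately show ?thesis using rel by (simp add: app)
  qed
  then have eval_step: "word_eval H f u = word_eval H f v" if "(u, v) \<in> steps" for u v
    using that by (metis UnE converseD)
  have "word_eval H f u = word_eval H f v" if "(u, v) \<in> steps\<^sup>*" for u v
    using that
  proof induction
    case (step y z)
    then show ?case using eval_step by metis
  qed simp
  then have cong: "word_eval H f u = word_eval H f v" if "(u, v) \<in> word_cong A R" for u v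
    using that by (auto simp: word_cong_def)
  define \<Phi> where "\<Phi> X = word_eval H f (SOME w. w \<in> X)" for X
  have \<Phi>: "\<Phi> (cls w) = word_eval H f w" if "w \<in> lists A" for w
  proof -
    have "(SOME v. v \<in> cls w) \<in> cls w"
      using equiv_class_self[OF equiv_word_cong that] by (rule someI)
    then show ?thesis unfolding \<Phi>_def using cong by (metis Image_singleton_iff)
  qed
  have "\<Phi> \<in> hom (presented_monoid A R) H"
  proof (rule homI)
    fix X Y assume "X \<in> carrier (presented_monoid A R)" "Y \<in> carrier (presented_monoid A R)"
    then show "\<Phi> (X \<otimes>\<^bsub>presented_monoid A R\<^esub> Y) = \<Phi> X \<otimes>\<^bsub>H\<^esub> \<Phi> Y"
      by (elim carrier_cases) (simp add: mult_cls \<Phi> app)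
  qed (elim carrier_cases, simp add: \<Phi> closed)
  moreover have "\<Phi> (cls [a]) = f a" if "a \<in> A" for a using that by (simp add: \<Phi> f)
  ultimately show thesis using that by blast
qed

lemma presented_monoid_generated:
  assumes "group (presented_monoid A R)" and K: "subgroup K (presented_monoid A R)"
    and "\<And>a. a \<in> A \<Longrightarrow> cls [a] \<in> K"
  shows "K = carrier (presented_monoid A R)"
proof
  show "K \<subseteq> carrier (presented_monoid A R)" by (rule subgroup.subset[OF K])
  show "carrier (presented_monoid A R) \<subseteq> K"
  proof
    fix X assume "X \<in> carrier (presented_monoid A R)"
    then obtain w where w: "w \<in> lists A" "X = cls w" by (rule carrier_cases)
    have "cls w \<in> K" using w(1)
    proof (induction w)
      case Nil
      then show ?case using subgroup.one_closed[OF K] by (simp add: one_cls)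
    next
      case (Cons a w)
      then have "cls [a] \<otimes>\<^bsub>presented_monoid A R\<^esub> cls w \<in> K"
        using assms(3) by (intro subgroup.m_closed[OF K]) auto
      then show ?case using Cons by (simp add: mult_cls)
    qed
    then show "X \<in> K" using w by simp
  qed
qed

end

section \<open>Free groups\<close>

abbreviation free_group_relations :: "'x set \<Rightarrow> (('x \<times> bool) list \<times> ('x \<times> bool) list) set" where
  "free_group_relations S \<equiv> {([(x, b), (x, \<not> b)], []) | x b. x \<in> S}"

definition free_generator :: "'x set \<Rightarrow> 'x \<Rightarrow> ('x \<times> bool) list set" where
  "free_generator S x = word_cong (S \<times> UNIV) (free_group_relations S) `` {[(x, True)]}"

interpretation free_group: word_presentation "S \<times> UNIV" "free_group_relations S" for S
  by unfold_locales auto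

lemma group_free_group: "group (free_group S)"
  unfolding free_group_def
proof (rule free_group.group_presented_monoid)
  fix a assume a: "a \<in> S \<times> (UNIV :: bool set)"
  then have "free_group.cls S [(fst a, \<not> snd a), (fst a, \<not> \<not> snd a)] = free_group.cls S []"
    by (intro free_group.cls_relation) force
  then show "\<exists>b\<in>S \<times> UNIV. free_group.cls S [b, a] = free_group.cls S []"
    using a by (intro bexI[of _ "(fst a, \<not> snd a)"]) auto
qed

lemma free_generator_closed: "x \<in> S \<Longrightarrow> free_generator S x \<in> carrier (free_group S)"
  unfolding free_generator_def free_group_def by (rule free_group.in_carrier) simp

lemma free_group_hom:
  assumes H: "group H" and g: "\<And>x. x \<in> S \<Longrightarrow> g x \<in> carrier H"
  obtains \<Phi> where "\<Phi> \<in> hom (free_group S) H" "\<And>x. x \<in> S \<Longrightarrow> \<Phi> (free_generator S x) = g x"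
proof -
  interpret H: group H by (rule H)
  define f where "f a = (if snd a then g (fst a) else inv\<^bsub>H\<^esub> g (fst a))" for a
  obtain \<Phi> where \<Phi>: "\<Phi> \<in> hom (presented_monoid (S \<times> UNIV) (free_group_relations S)) H"
    "\<And>a. a \<in> S \<times> UNIV \<Longrightarrow> \<Phi> (free_group.cls S [a]) = f a"
  proof (rule free_group.presented_monoid_hom[OF H, where f = f and S = S])
    show "f a \<in> carrier H" if "a \<in> S \<times> UNIV" for a using that g by (auto simp: f_def)
    show "free_group.word_eval H f u = free_group.word_eval H f v" if "(u, v) \<in> free_group_relations S" for u v
      using that g by (auto simp: f_def)
  qed blast
  have "\<Phi> (free_generator S x) = g x" if "x \<in> S" for x
    using \<Phi>(2)[of "(x, True)"] that by (simp add: free_generator_def f_def)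
  with \<Phi>(1) show thesis unfolding free_group_def[symmetric] by (rule that)
qed

lemma generate_free_group: "generate (free_group S) (free_generator S ` S) = carrier (free_group S)"
proof -
  interpret F: group "free_group S" by (rule group_free_group)
  let ?K = "generate (free_group S) (free_generator S ` S)"
  have sub: "free_generator S ` S \<subseteq> carrier (free_group S)" by (rule image_subsetI) (rule free_generator_closed)
  have K: "subgroup ?K (free_group S)" by (rule F.generate_is_subgroup[OF sub])
  have cls_K: "free_group.cls S [a] \<in> ?K" if a_in: "a \<in> S \<times> UNIV" for a
  proof -
    obtain x b where a: "a = (x, b)" "x \<in> S" using a_in by auto
    have gen: "free_generator S x \<in> ?K" using a by (auto intro: generate.incl)
    show ?thesis
    proof (cases b)
      case True
      then show ?thesis using gen a by (simp add: free_generator_def)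
    next
      case False
      have "free_group.cls S [(x, False)] \<otimes>\<^bsub>free_group S\<^esub> free_generator S x = free_group.cls S [(x, False), (x, True)]"
        unfolding free_generator_def free_group_def using a by (subst free_group.mult_cls) auto
      also have "\<dots> = \<one>\<^bsub>free_group S\<^esub>"
        unfolding free_group_def free_group.one_cls using a by (intro free_group.cls_relation) force
      finally have "inv\<^bsub>free_group S\<^esub> free_generator S x = free_group.cls S [(x, False)]"
        using a free_group.in_carrier[of "[(x, False)]" S] unfolding free_group_def[symmetric]
        by (intro F.inv_equality) (auto simp: free_generator_closed)
      then show ?thesis using subgroup.m_inv_closed[OF K gen] a False by simp
    qed
  qed
  then show ?thesis
    unfolding free_group_def
    by (intro free_group.presented_monoid_generated group_free_group[of S, unfolded free_group_def]
        K[unfolded free_group_def] cls_K[unfolded free_group_def])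
qed

lemma finitely_generated_free_group: "finite S \<Longrightarrow> finitely_generated_group (free_group S)"
  unfolding finitely_generated_group_def
  using group_free_group generate_free_group free_generator_closed
  by (intro conjI exI[of _ "free_generator S ` S"]) auto

section \<open>Free products\<close>

locale free_product_of_groups = G: group G + H: group H
  for G :: "('a, 'c) monoid_scheme" and H :: "('b, 'd) monoid_scheme"
begin

abbreviation letters :: "('a + 'b) set" where
  "letters \<equiv> Inl ` carrier G \<union> Inr ` carrier H"

abbreviation relations :: "(('a + 'b) list \<times> ('a + 'b) list) set" where
  "relations \<equiv> {([Inl \<one>\<^bsub>G\<^esub>], []), ([Inr \<one>\<^bsub>H\<^esub>], [])}
        \<union> {([Inl x, Inl y], [Inl (x \<otimes>\<^bsub>G\<^esub> y)]) | x y. x \<in> carrier G \<and> y \<in> carrier G}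
        \<union> {([Inr x, Inr y], [Inr (x \<otimes>\<^bsub>H\<^esub> y)]) | x y. x \<in> carrier H \<and> y \<in> carrier H}"

sublocale W: word_presentation letters relations
  by unfold_locales auto

abbreviation FP where "FP \<equiv> free_product G H"

lemma FP_def: "FP = presented_monoid letters relations"
  by (simp add: free_product_def)

definition inl :: "'a \<Rightarrow> ('a + 'b) list set" where "inl x = W.cls [Inl x]"
definition inr :: "'b \<Rightarrow> ('a + 'b) list set" where "inr y = W.cls [Inr y]"

lemma group_FP: "group FP"
  unfolding FP_def
proof (rule W.group_presented_monoid)
  fix a assume "a \<in> letters"
  then consider x where "a = Inl x" "x \<in> carrier G" | y where "a = Inr y" "y \<in> carrier H" by blast
  then show "\<exists>b\<in>letters. W.cls [b, a] = W.cls []"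
  proof cases
    case 1
    have "W.cls [Inl (inv\<^bsub>G\<^esub> x), Inl x] = W.cls [Inl (inv\<^bsub>G\<^esub> x \<otimes>\<^bsub>G\<^esub> x)]"
      by (rule W.cls_relation) (use 1 in blast)
    also have "\<dots> = W.cls []" using 1 by (intro W.cls_relation) simp
    finally show ?thesis using 1 by blast
  next
    case 2
    have "W.cls [Inr (inv\<^bsub>H\<^esub> y), Inr y] = W.cls [Inr (inv\<^bsub>H\<^esub> y \<otimes>\<^bsub>H\<^esub> y)]"
      by (rule W.cls_relation) (use 2 in blast)
    also have "\<dots> = W.cls []" using 2 by (intro W.cls_relation) simp
    finally show ?thesis using 2 by blast
  qed
qed

sublocale FP: group FP by (rule group_FP)

sublocale inl: group_hom G FP inl
proof (unfold_locales, rule homI)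
  show "inl x \<in> carrier FP" if "x \<in> carrier G" for x
    unfolding inl_def FP_def using that by (intro W.in_carrier) auto
  show "inl (x \<otimes>\<^bsub>G\<^esub> y) = inl x \<otimes>\<^bsub>FP\<^esub> inl y" if "x \<in> carrier G" "y \<in> carrier G" for x y
  proof -
    have "inl x \<otimes>\<^bsub>FP\<^esub> inl y = W.cls ([Inl x] @ [Inl y])"
      unfolding inl_def FP_def using that by (intro W.mult_cls) auto
    also have "\<dots> = inl (x \<otimes>\<^bsub>G\<^esub> y)" unfolding inl_def using that by (intro W.cls_relation) auto
    finally show ?thesis by simp
  qed
qed

sublocale inr: group_hom H FP inr
proof (unfold_locales, rule homI)
  show "inr x \<in> carrier FP" if "x \<in> carrier H" for x
    unfolding inr_def FP_def using that by (intro W.in_carrier) auto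
  show "inr (x \<otimes>\<^bsub>H\<^esub> y) = inr x \<otimes>\<^bsub>FP\<^esub> inr y" if "x \<in> carrier H" "y \<in> carrier H" for x y
  proof -
    have "inr x \<otimes>\<^bsub>FP\<^esub> inr y = W.cls ([Inr x] @ [Inr y])"
      unfolding inr_def FP_def using that by (intro W.mult_cls) auto
    also have "\<dots> = inr (x \<otimes>\<^bsub>H\<^esub> y)" unfolding inr_def using that by (intro W.cls_relation) auto
    finally show ?thesis by simp
  qed
qed

lemma FP_hom:
  assumes K: "group K" and h: "h1 \<in> hom G K" "h2 \<in> hom H K"
  obtains \<Phi> where "\<Phi> \<in> hom FP K" "\<And>x. x \<in> carrier G \<Longrightarrow> \<Phi> (inl x) = h1 x"
    "\<And>y. y \<in> carrier H \<Longrightarrow> \<Phi> (inr y) = h2 y"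
proof -
  interpret h1: group_hom G K h1 by (intro group_hom.intro group_hom_axioms.intro K h) unfold_locales
  interpret h2: group_hom H K h2 by (intro group_hom.intro group_hom_axioms.intro K h) unfold_locales
  obtain \<Phi> where \<Phi>: "\<Phi> \<in> hom (presented_monoid letters relations) K"
    "\<And>a. a \<in> letters \<Longrightarrow> \<Phi> (W.cls [a]) = case_sum h1 h2 a"
  proof (rule W.presented_monoid_hom[OF K, where f = "case_sum h1 h2"])
    show "case_sum h1 h2 a \<in> carrier K" if "a \<in> letters" for a using that by auto
    show "W.word_eval K (case_sum h1 h2) u = W.word_eval K (case_sum h1 h2) v" if "(u, v) \<in> relations" for u v
      using that by auto
  qed blast
  show thesis
  proof (rule that)
    show "\<Phi> \<in> hom FP K" unfolding FP_def by (rule \<Phi>(1))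
    show "\<Phi> (inl x) = h1 x" if "x \<in> carrier G" for x
      using \<Phi>(2)[of "Inl x"] that by (simp add: inl_def)
    show "\<Phi> (inr y) = h2 y" if "y \<in> carrier H" for y
      using \<Phi>(2)[of "Inr y"] that by (simp add: inr_def)
  qed
qed

lemma FP_generated:
  assumes K: "subgroup K FP" and "\<And>x. x \<in> carrier G \<Longrightarrow> inl x \<in> K" "\<And>y. y \<in> carrier H \<Longrightarrow> inr y \<in> K"
  shows "K = carrier FP"
  using W.presented_monoid_generated[of K] group_FP assms unfolding FP_def inl_def inr_def by blast

lemma generate_FP: "generate FP (inl ` carrier G \<union> inr ` carrier H) = carrier FP"
proof (rule FP_generated)
  have sub: "inl ` carrier G \<union> inr ` carrier H \<subseteq> carrier FP" by auto
  show "subgroup (generate FP (inl ` carrier G \<union> inr ` carrier H)) FP" by (rule FP.generate_is_subgroup[OF sub])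
qed (auto intro: generate.incl)

lemma H1_FP_eqI:
  assumes f: "f \<in> H1 FP" and g: "g \<in> H1 FP" and "\<And>x. x \<in> carrier G \<Longrightarrow> f [inl x] = g [inl x]"
    and "\<And>y. y \<in> carrier H \<Longrightarrow> f [inr y] = g [inr y]"
  shows "f = g"
proof -
  have "f - g = 0"
  proof (rule FP.H1_zero_if_zero_on_generators[OF _ generate_FP])
    show "f - g \<in> H1 FP" by (rule cfun.subspace_diff[OF subspace_H1 f g])
    show "(f - g) [s] = 0" if "s \<in> inl ` carrier G \<union> inr ` carrier H" for s using that assms(3,4) by auto
  qed auto
  then show ?thesis by simp
qed

end


context free_product_of_groups
begin

text \<open>A class is a homomorphism to the additive group of complex numbers, and the universal
  property of the free product glues two of them.\<close>

lemma H1_FP_exists: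
  assumes a1: "a1 \<in> H1 G" and a2: "a2 \<in> H1 H"
  obtains a where "a \<in> H1 FP" "H1_pullback G inl a = a1" "H1_pullback H inr a = a2"
proof -
  define K :: "complex monoid" where "K = \<lparr>carrier = UNIV, monoid.mult = (+), one = 0\<rparr>"
  have K: "group K"
    by (rule groupI) (auto simp: K_def intro: exI[of _ "- x" for x])
  have "(\<lambda>x. a1 [x]) \<in> hom G K" "(\<lambda>y. a2 [y]) \<in> hom H K"
    using H1_add[OF a1] H1_add[OF a2] by (auto simp: K_def hom_def)
  then obtain \<Phi> where \<Phi>: "\<Phi> \<in> hom FP K" "\<And>x. x \<in> carrier G \<Longrightarrow> \<Phi> (inl x) = a1 [x]"
    "\<And>y. y \<in> carrier H \<Longrightarrow> \<Phi> (inr y) = a2 [y]"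
    using FP_hom[OF K] by blast
  define a where "a xs = (if length xs = 1 \<and> set xs \<subseteq> carrier FP then \<Phi> (hd xs) else 0)" for xs
  have a: "a \<in> H1 FP"
    unfolding H1_iff using hom_mult[OF \<Phi>(1)] by (auto simp: a_def K_def split: if_splits)
  show thesis
  proof (rule that[OF a])
    show "H1_pullback G inl a = a1"
      using \<Phi>(2) by (intro H1_eqI[OF inl.H1_pullback_in[OF a] a1]) (simp add: H1_pullback_apply a_def)
    show "H1_pullback H inr a = a2"
      using \<Phi>(3) by (intro H1_eqI[OF inr.H1_pullback_in[OF a] a2]) (simp add: H1_pullback_apply a_def)
  qed
qed

text \<open>A cochain \<open>c\<close> with \<open>\<delta>c = a \<cup> u\<close> is the same as a lift of \<open>(a, u)\<close> to the Heisenberg group,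
  and such lifts on the two factors extend to the free product.\<close>

lemma cup_exact_FP:
  assumes a: "a \<in> H1 FP" and u: "u \<in> H1 FP"
    and ex1: "cup_exact G (H1_pullback G inl a) (H1_pullback G inl u)"
    and ex2: "cup_exact H (H1_pullback H inr a) (H1_pullback H inr u)"
  shows "cup_exact FP a u"
proof -
  define K :: "(complex \<times> complex \<times> complex) monoid" where
    "K = \<lparr>carrier = UNIV, monoid.mult = (\<lambda>(x, y, s) (x', y', s'). (x + x', y + y', s + s' + x * y')), one = (0, 0, 0)\<rparr>"
  have K: "group K"
  proof (rule groupI)
    fix p assume "p \<in> carrier K"
    obtain x y s where p: "p = (x, y, s)" by (cases p) auto
    show "\<exists>q\<in>carrier K. q \<otimes>\<^bsub>K\<^esub> p = \<one>\<^bsub>K\<^esub>"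
      by (intro bexI[of _ "(- x, - y, x * y - s)"]) (auto simp: K_def p)
  qed (auto simp: K_def algebra_simps split: prod.splits)
  obtain c1 where c1: "\<And>x y. x \<in> carrier G \<Longrightarrow> y \<in> carrier G \<Longrightarrow>
      a [inl x] * u [inl y] = c1 x + c1 y - c1 (x \<otimes>\<^bsub>G\<^esub> y)"
    using ex1 by (auto simp: cup_exact_def H1_pullback_apply)
  obtain c2 where c2: "\<And>x y. x \<in> carrier H \<Longrightarrow> y \<in> carrier H \<Longrightarrow>
      a [inr x] * u [inr y] = c2 x + c2 y - c2 (x \<otimes>\<^bsub>H\<^esub> y)"
    using ex2 by (auto simp: cup_exact_def H1_pullback_apply)
  \<comment> \<open>The last entry is -c because it has to pick up + a [x] * u [y] on products,
    whereas c picks up the opposite sign.\<close>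
  have "(\<lambda>x. (a [inl x], u [inl x], - c1 x)) \<in> hom G K"
    using c1 H1_add[OF a] H1_add[OF u] by (auto simp: hom_def K_def)
  moreover have "(\<lambda>y. (a [inr y], u [inr y], - c2 y)) \<in> hom H K"
    using c2 H1_add[OF a] H1_add[OF u] by (auto simp: hom_def K_def)
  ultimately obtain \<Phi> where \<Phi>: "\<Phi> \<in> hom FP K"
    "\<And>x. x \<in> carrier G \<Longrightarrow> \<Phi> (inl x) = (a [inl x], u [inl x], - c1 x)"
    "\<And>y. y \<in> carrier H \<Longrightarrow> \<Phi> (inr y) = (a [inr y], u [inr y], - c2 y)"
    using FP_hom[OF K] by blast
  have mult: "fst (\<Phi> (p \<otimes>\<^bsub>FP\<^esub> q)) = fst (\<Phi> p) + fst (\<Phi> q)"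
    "fst (snd (\<Phi> (p \<otimes>\<^bsub>FP\<^esub> q))) = fst (snd (\<Phi> p)) + fst (snd (\<Phi> q))"
    "snd (snd (\<Phi> (p \<otimes>\<^bsub>FP\<^esub> q))) = snd (snd (\<Phi> p)) + snd (snd (\<Phi> q)) + fst (\<Phi> p) * fst (snd (\<Phi> q))"
    if "p \<in> carrier FP" "q \<in> carrier FP" for p q
    using hom_mult[OF \<Phi>(1) that] by (auto simp: K_def split: prod.splits)
  define a' where "a' xs = (if length xs = 1 \<and> set xs \<subseteq> carrier FP then fst (\<Phi> (hd xs)) else 0)" for xs
  define u' where "u' xs = (if length xs = 1 \<and> set xs \<subseteq> carrier FP then fst (snd (\<Phi> (hd xs))) else 0)" for xs
  have "a' \<in> H1 FP" "u' \<in> H1 FP"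
    unfolding H1_iff using mult by (auto simp: a'_def u'_def split: if_splits)
  \<comment> \<open>The first two components of the glued lift are classes that agree with a and u
    on both factors, hence everywhere; the third is then minus a primitive of a cup u.\<close>
  then have "a = a'" "u = u'"
    using a u \<Phi>(2,3) by (auto intro!: H1_FP_eqI simp: a'_def u'_def)
  then have "a [p] = fst (\<Phi> p)" "u [p] = fst (snd (\<Phi> p))" if "p \<in> carrier FP" for p
    using that by (simp_all add: a'_def u'_def)
  then show ?thesis
    unfolding cup_exact_def using mult(3) by (intro exI[of _ "\<lambda>p. - snd (snd (\<Phi> p))"]) simp
qed

text \<open>Exactness can be tested on the factors separately. If both components of (a1, a2) are
  nonzero, (a1, 0) is a partner, since a1 cup a1 is exact and a2 is nonzero. If a component is 0, a
  nonzero class on that factor, extended by 0, is a partner.\<close>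

lemma resonance_FP:
  assumes fg: "finitely_generated_group FP" and nz: "H1 G \<noteq> {0}" "H1 H \<noteq> {0}"
  shows "resonance FP = H1 FP"
proof (intro equalityI subsetI)
  fix a assume a: "a \<in> H1 FP"
  define a1 a2 where "a1 = H1_pullback G inl a" and "a2 = H1_pullback H inr a"
  have a12: "a1 \<in> H1 G" "a2 \<in> H1 H" using a inl.H1_pullback_in inr.H1_pullback_in by (auto simp: a1_def a2_def)
  have zero: "0 \<in> H1 G" "0 \<in> H1 H" using cfun.subspace_0[OF subspace_H1] by auto
  have ex0: "cup_exact K 0 v" "cup_exact K v 0" for K :: "('k, 'm) monoid_scheme" and v
    by (auto simp: cup_exact_def intro!: exI[of _ "\<lambda>_. 0"])
  have ex_self: "cup_exact G a1 a1" using cup_exact_self[OF a12(1), of 1] by simp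
  obtain n1 n2 where n: "n1 \<in> H1 G" "n1 \<noteq> 0" "n2 \<in> H1 H" "n2 \<noteq> 0" using nz zero by blast
  have "\<exists>u1\<in>H1 G. \<exists>u2\<in>H1 H. cup_exact G a1 u1 \<and> cup_exact H a2 u2 \<and> (\<forall>c. \<not> (u1 = cscale c a1 \<and> u2 = cscale c a2))"
  proof -
    consider "a1 = 0" | "a2 = 0" | "a1 \<noteq> 0" "a2 \<noteq> 0" by blast
    then show ?thesis
    proof cases
      case 1
      then show ?thesis using ex0 n zero by (intro bexI[of _ n1] bexI[of _ 0]) auto
    next
      case 2
      then show ?thesis using ex0 n zero by (intro bexI[of _ 0] bexI[of _ n2]) auto
    next
      case 3
      have "\<not> (a1 = cscale c a1 \<and> 0 = cscale c a2)" for c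
      proof
        assume c: "a1 = cscale c a1 \<and> 0 = cscale c a2"
        then have "c = 0" using 3(2) cfun.scale_eq_0_iff[of c a2] by metis
        then have "a1 = 0" using c by (auto simp: fun_eq_iff)
        with 3 show False by simp
      qed
      then show ?thesis using ex0 ex_self a12 zero by (intro bexI[of _ a1] bexI[of _ 0]) auto
    qed
  qed
  then obtain u1 u2 where u12: "u1 \<in> H1 G" "u2 \<in> H1 H" "cup_exact G a1 u1" "cup_exact H a2 u2"
    "\<And>c. \<not> (u1 = cscale c a1 \<and> u2 = cscale c a2)" by blast
  obtain u where u: "u \<in> H1 FP" "H1_pullback G inl u = u1" "H1_pullback H inr u = u2"
    using H1_FP_exists[OF u12(1,2)] by blast
  have "cup_exact FP a u"
    using u12(3,4) by (intro cup_exact_FP[OF a u(1)]) (simp_all add: u a1_def a2_def)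
  moreover have "u \<notin> cfun.span {a}"
  proof
    assume "u \<in> cfun.span {a}"
    then obtain c where "u = cscale c a" unfolding cfun.span_singleton by (rule imageE)
    then have "u1 = cscale c a1" "u2 = cscale c a2"
      unfolding u(2,3)[symmetric] a1_def a2_def by (simp_all add: cfun_pair.linear_scale[OF linear_H1_pullback])
    then show False using u12(5) by blast
  qed
  ultimately show "a \<in> resonance FP" unfolding resonance_iff[OF fg] using a u(1) by blast
qed (simp add: resonance_def)

end

section \<open>Abelian groups\<close>

lemma (in comm_group) commutator_eq_one: "x \<in> carrier G \<Longrightarrow> y \<in> carrier G \<Longrightarrow> commutator G x y = \<one>"
proof -
  assume xy: "x \<in> carrier G" "y \<in> carrier G"
  then have "commutator G x y = y \<otimes> x \<otimes> inv x \<otimes> inv y" by (simp only: m_comm)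
  then show ?thesis using xy by (simp add: m_assoc)
qed

lemma (in comm_group) lower_central_trivial:
  assumes "k \<ge> 2"
  shows "lower_central G k \<subseteq> {\<one>}"
proof -
  obtain j where j: "k = Suc j" "j \<ge> 1" using assms by (cases k) auto
  have "(\<Union>h\<in>lower_central G j. \<Union>g\<in>carrier G. {commutator G h g}) \<subseteq> {\<one>}"
    using commutator_eq_one lower_central_subset[of j] by auto
  then have "generate G (\<Union>h\<in>lower_central G j. \<Union>g\<in>carrier G. {commutator G h g}) \<subseteq> generate G {\<one>}"
    by (rule mono_generate)
  then show ?thesis unfolding j(1) lower_central_Suc[OF j(2)] commutator_subgroup_def by (simp add: generate_one)
qed

text \<open>All pairs commute, so a partner of a nonzero class is proportional to it and resonance
  shrinks to the origin at most, contributing no component of dimension at least 2. From k = 2 on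
  the lower central series is trivial, so the Chen ranks vanish as well.\<close>

lemma chen_ranks_formula_comm_group:
  fixes G :: "('a, 'b) monoid_scheme"
  assumes "comm_group G" and fg: "finitely_generated_group G"
  shows "chen_ranks_formula G"
proof -
  interpret comm_group G by (rule assms)
  have R: "resonance G \<subseteq> {0}"
  proof
    fix a assume "a \<in> resonance G"
    then obtain u where a: "a \<in> H1 G" and u: "u \<in> H1 G" "cup_exact G a u" "u \<notin> cfun.span {a}"
      unfolding resonance_iff[OF fg] by blast
    show "a \<in> {0}"
    proof (rule ccontr)
      assume "a \<notin> {0}"
      then obtain x where x: "x \<in> carrier G" "a [x] \<noteq> 0"
        using H1_eqI[OF a cfun.subspace_0[OF subspace_H1]] by fastforce
      have "u = cscale (u [x] / a [x]) a"
      proof (rule H1_eqI[OF u(1) cfun.subspace_scale[OF subspace_H1 a]])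
        fix y assume y: "y \<in> carrier G"
        have "a [x] * u [y] = a [y] * u [x]" using cup_exact_commuting[OF u(2) x(1) y] m_comm x(1) y by simp
        then show "u [y] = cscale (u [x] / a [x]) a [y]" using x(2) by (simp add: field_simps)
      qed
      then show False using u(3) by (auto simp: cfun.span_singleton)
    qed
  qed
  have "resonance_count G m = 0" if "m \<ge> 2" for m
  proof -
    have "components_of_dim (H1 G) (resonance G) m = {}"
    proof (rule ccontr)
      assume "components_of_dim (H1 G) (resonance G) m \<noteq> {}"
      then obtain Z where "Z \<subseteq> resonance G" "zariski_dim (H1 G) Z = enat m"
        by (auto simp: components_of_dim_def irreducible_components_def)
      then show False using zariski_dim_subset_zero[of Z "H1 G"] R that by (auto simp: zero_enat_def)
    qed
    then show ?thesis by (simp add: resonance_count_eq)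
  qed
  then have I: "{m. m \<ge> 2 \<and> resonance_count G m \<noteq> 0} = {}" by auto
  have "chen_rank G k = 0" if k: "k \<ge> 2" for k
  proof -
    have "\<phi> = 0" if \<phi>: "\<phi> \<in> chen_functionals G k" for \<phi>
    proof
      fix x
      have "\<one>\<^bsub>G\<^esub> \<in> lower_central G (Suc k)" by (rule subgroup.one_closed[OF lower_central_subgroup])
      then show "\<phi> x = 0 x"
        using \<phi> lower_central_trivial[OF k]
        by (cases "x \<in> lower_central G k") (auto simp: chen_functionals_def additive_functions_def)
    qed
    then have "chen_functionals G k = cfun.span {}"
      using cfun.subspace_0[OF subspace_chen_functionals] by auto
    then have "cfun.dim (chen_functionals G k) = card ({} :: ('a \<Rightarrow> complex) set)"
      using cfun.dim_span_eq_card_independent[OF cfun.independent_empty] by metis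
    then show ?thesis using chen_rank_eq_dim[OF fg] k by simp
  qed
  then have "\<forall>\<^sub>F k in sequentially. chen_rank G k = 0"
    unfolding eventually_sequentially by blast
  then show ?thesis unfolding chen_ranks_formula_def I by simp
qed

section \<open>Nontrivial elements of the Chen quotients\<close>

text \<open>The affine maps \<open>x \<mapsto> e\<^bsup>sX\<^esup> x + b\<close> of \<open>\<complex>[[X]]\<close>, encoded as \<open>(s, b)\<close>, form a metabelian group in
  which iterated commutators are detected by the order of vanishing of \<open>b\<close>.\<close>

definition affine_group :: "(complex \<times> complex fps) monoid" where
  "affine_group = \<lparr>carrier = UNIV, monoid.mult = (\<lambda>(s, b) (t, d). (s + t, fps_exp s * d + b)), one = (0, 0)\<rparr>"

lemma affine_group_simps [simp]:
  "carrier affine_group = UNIV" "\<one>\<^bsub>affine_group\<^esub> = (0, 0)"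
  "p \<otimes>\<^bsub>affine_group\<^esub> q = (fst p + fst q, fps_exp (fst p) * snd q + snd p)"
  by (auto simp: affine_group_def split: prod.splits)

lemma group_affine_group: "group affine_group"
proof (rule groupI)
  fix p assume "p \<in> carrier affine_group"
  show "\<exists>q\<in>carrier affine_group. q \<otimes>\<^bsub>affine_group\<^esub> p = \<one>\<^bsub>affine_group\<^esub>"
    by (intro bexI[of _ "(- fst p, - (fps_exp (- fst p) * snd p))"]) auto
qed (auto simp: fps_exp_add_mult algebra_simps)

context
  fixes G :: "('a, 'b) monoid_scheme" and \<rho>
  assumes G: "group G" and \<rho>: "\<rho> \<in> hom G affine_group"
begin

interpretation G: group G by (rule G)
interpretation \<rho>: group_hom G affine_group \<rho>
  by (intro group_hom.intro group_hom_axioms.intro G group_affine_group \<rho>)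

lemma affine_commutator:
  assumes "x \<in> carrier G" "y \<in> carrier G"
  shows "\<rho> (commutator G x y) =
    (0, (1 - fps_exp (fst (\<rho> y))) * snd (\<rho> x) - (1 - fps_exp (fst (\<rho> x))) * snd (\<rho> y))"
proof -
  \<comment> \<open>Comparing [x, y] y x with x y yields the commutator without computing inverses
    of affine maps.\<close>
  have "commutator G x y \<otimes>\<^bsub>G\<^esub> (y \<otimes>\<^bsub>G\<^esub> x) = x \<otimes>\<^bsub>G\<^esub> y"
    using assms by (simp add: G.m_assoc) (simp add: G.m_assoc[symmetric])
  moreover have "\<rho> (commutator G x y \<otimes>\<^bsub>G\<^esub> (y \<otimes>\<^bsub>G\<^esub> x)) =
      \<rho> (commutator G x y) \<otimes>\<^bsub>affine_group\<^esub> (\<rho> y \<otimes>\<^bsub>affine_group\<^esub> \<rho> x)"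
    using assms by (simp only: \<rho>.hom_mult G.m_closed G.inv_closed)
  moreover have "\<rho> (x \<otimes>\<^bsub>G\<^esub> y) = \<rho> x \<otimes>\<^bsub>affine_group\<^esub> \<rho> y" using assms by (simp only: \<rho>.hom_mult)
  ultimately have eq: "\<rho> (commutator G x y) \<otimes>\<^bsub>affine_group\<^esub> (\<rho> y \<otimes>\<^bsub>affine_group\<^esub> \<rho> x) = \<rho> x \<otimes>\<^bsub>affine_group\<^esub> \<rho> y"
    by simp
  obtain p b where pb: "\<rho> (commutator G x y) = (p, b)" by (cases "\<rho> (commutator G x y)") auto
  have "p = 0" using eq unfolding pb by simp
  moreover have "b = (1 - fps_exp (fst (\<rho> y))) * snd (\<rho> x) - (1 - fps_exp (fst (\<rho> x))) * snd (\<rho> y)"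
    using eq unfolding pb \<open>p = 0\<close> by (simp add: algebra_simps)
  ultimately show ?thesis using pb by simp
qed

text \<open>Elements acting as translations by multiples of X^(n+1).\<close>

definition affine_vanishing :: "nat \<Rightarrow> 'a set" where
  "affine_vanishing n = {x \<in> carrier G. fst (\<rho> x) = 0 \<and> (\<forall>j\<le>n. fps_nth (snd (\<rho> x)) j = 0)}"

lemma subgroup_affine_vanishing: "subgroup (affine_vanishing n) G"
proof (rule G.subgroupI)
  have "\<one>\<^bsub>G\<^esub> \<in> affine_vanishing n" using \<rho>.hom_one by (simp add: affine_vanishing_def)
  then show "affine_vanishing n \<noteq> {}" by blast
  fix x assume x: "x \<in> affine_vanishing n"
  then have xc: "x \<in> carrier G" by (simp add: affine_vanishing_def)
  then have "\<rho> (inv\<^bsub>G\<^esub> x) \<otimes>\<^bsub>affine_group\<^esub> \<rho> x = (0, 0)"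
    using \<rho>.hom_mult[of "inv\<^bsub>G\<^esub> x" x] \<rho>.hom_one by simp
  then have "fst (\<rho> (inv\<^bsub>G\<^esub> x)) = 0" "snd (\<rho> (inv\<^bsub>G\<^esub> x)) = - snd (\<rho> x)"
    using x by (auto simp: affine_vanishing_def eq_neg_iff_add_eq_0 add.commute)
  then show "inv\<^bsub>G\<^esub> x \<in> affine_vanishing n" using x by (simp add: affine_vanishing_def)
  fix y assume "y \<in> affine_vanishing n"
  then show "x \<otimes>\<^bsub>G\<^esub> y \<in> affine_vanishing n" using x by (simp add: affine_vanishing_def)
qed (auto simp: affine_vanishing_def)

text \<open>A first commutator has trivial linear part and a translation divisible by X. Each
  further commutator multiplies the translation by some 1 - e^(tX), which is again divisible by
  X.\<close>

lemma affine_lower_central: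
  assumes "x \<in> lower_central G (n + 2)"
  shows "x \<in> affine_vanishing n"
  using assms
proof (induction n arbitrary: x)
  case 0
  have "commutator G x y \<in> affine_vanishing 0" if "x \<in> carrier G" "y \<in> carrier G" for x y
    unfolding affine_vanishing_def mem_Collect_eq affine_commutator[OF that] using that by simp
  then have "(\<Union>x\<in>carrier G. \<Union>y\<in>carrier G. {commutator G x y}) \<subseteq> affine_vanishing 0"
    by blast
  then have "generate G (\<Union>x\<in>carrier G. \<Union>y\<in>carrier G. {commutator G x y}) \<subseteq> affine_vanishing 0"
    by (rule G.generate_subgroup_incl[OF _ subgroup_affine_vanishing])
  then show ?case using 0 by (auto simp: numeral_2_eq_2 commutator_subgroup_def)
next
  case (Suc n)
  have "commutator G h g \<in> affine_vanishing (Suc n)" if h: "h \<in> lower_central G (n + 2)" and g: "g \<in> carrier G" for h g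
  proof -
    have hv: "h \<in> affine_vanishing n" by (rule Suc.IH[OF h])
    then have hc: "h \<in> carrier G" and h0: "fst (\<rho> h) = 0" "\<And>j. j \<le> n \<Longrightarrow> fps_nth (snd (\<rho> h)) j = 0"
      by (auto simp: affine_vanishing_def)
    \<comment> \<open>The factor 1 - e^(tX) has no constant term, so coefficient j of the product
      involves coefficients of index below j alone, which vanish up to n.\<close>
    have "fps_nth ((1 - fps_exp (fst (\<rho> g))) * snd (\<rho> h)) j = 0" if "j \<le> Suc n" for j
      unfolding fps_mult_nth
    proof (rule sum.neutral, rule ballI)
      fix i assume "i \<in> {0..j}"
      then show "fps_nth (1 - fps_exp (fst (\<rho> g))) i * fps_nth (snd (\<rho> h)) (j - i) = 0"
        using that h0(2)[of "j - i"] by (cases "i = 0") auto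
    qed
    then show ?thesis
      unfolding affine_vanishing_def using affine_commutator[OF hc g] h0(1) hc g by simp
  qed
  then have "(\<Union>h\<in>lower_central G (n + 2). \<Union>g\<in>carrier G. {commutator G h g}) \<subseteq> affine_vanishing (Suc n)"
    by blast
  then have "generate G (\<Union>h\<in>lower_central G (n + 2). \<Union>g\<in>carrier G. {commutator G h g}) \<subseteq> affine_vanishing (Suc n)"
    by (rule G.generate_subgroup_incl[OF _ subgroup_affine_vanishing])
  moreover have "lower_central G (Suc n + 2) = commutator_subgroup G (lower_central G (n + 2)) (carrier G)"
    using lower_central_Suc[of "n + 2" G] by simp
  ultimately show ?case using Suc.prems by (auto simp: commutator_subgroup_def)
qed

text \<open>The derived subgroup acts by translations, and translations commute: the affine group is
  metabelian.\<close>

lemma affine_second_derived: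
  assumes "x \<in> second_derived G"
  shows "\<rho> x = (0, 0)"
proof -
  have D: "derived G (carrier G) \<subseteq> carrier G" by (rule G.derived_in_carrier) simp
  have "derived G (carrier G) = lower_central G 2"
    by (simp add: derived_def numeral_2_eq_2 commutator_subgroup_def)
  then have "x \<in> affine_vanishing 0" if "x \<in> derived G (carrier G)" for x
    using affine_lower_central[of x 0] that by (simp only: add_0)
  then have "fst (\<rho> x) = 0" if "x \<in> derived G (carrier G)" for x
    using that by (simp add: affine_vanishing_def)
  then have comm: "\<rho> (commutator G x y) = \<one>\<^bsub>affine_group\<^esub>" if "x \<in> derived G (carrier G)" "y \<in> derived G (carrier G)" for x y
    using affine_commutator[of x y] that D by (auto simp: subset_iff)
  let ?S = "derived_set G (derived G (carrier G))"
  have S: "?S \<subseteq> carrier G" using D by fastforce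
  have "x \<in> generate G ?S" using assms by (simp add: second_derived_def derived_def[of _ "derived _ _"])
  moreover have "generate G ?S \<subseteq> kernel G affine_group \<rho>"
  proof (rule G.generate_subgroup_incl[OF _ \<rho>.subgroup_kernel])
    show "?S \<subseteq> kernel G affine_group \<rho>" unfolding kernel_def using S comm by blast
  qed
  ultimately show ?thesis by (auto simp: kernel_def)
qed

text \<open>The coefficient of X^(n+1) is the lowest one not forced to vanish on the term of index n
  + 2, and it does vanish on the following term.\<close>

definition affine_functional :: "nat \<Rightarrow> 'a \<Rightarrow> complex" where
  "affine_functional n x = (if x \<in> lower_central G (n + 2) then fps_nth (snd (\<rho> x)) (n + 1) else 0)"

lemma affine_functional_in: "affine_functional n \<in> chen_functionals G (n + 2)"
proof -
  interpret L: subgroup "lower_central G (n + 2)" G by (rule G.lower_central_subgroup)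
  have add: "affine_functional n (x \<otimes>\<^bsub>G\<^esub> y) = affine_functional n x + affine_functional n y"
    if "x \<in> lower_central G (n + 2)" "y \<in> lower_central G (n + 2)" for x y
  proof -
    have "x \<in> carrier G" "y \<in> carrier G" "fst (\<rho> x) = 0"
      using that affine_lower_central G.lower_central_subset by (auto simp: affine_vanishing_def)
    then show ?thesis using that L.m_closed by (simp add: affine_functional_def)
  qed
  have "affine_functional n x = 0" if "x \<in> lower_central G (Suc (n + 2))" for x
    using affine_lower_central[of x "Suc n"] that by (simp add: affine_functional_def affine_vanishing_def)
  moreover have "affine_functional n x = 0" if "x \<in> second_derived G" for x
    using affine_second_derived[OF that] by (simp add: affine_functional_def)
  moreover have "affine_functional n x = 0" if "x \<notin> lower_central G (n + 2)" for x
    using that by (simp add: affine_functional_def)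
  ultimately show ?thesis using add by (auto simp: chen_functionals_def additive_functions_def)
qed

end

section \<open>Iterated commutators as witnesses\<close>

primrec iterated_commutator :: "('a, 'b) monoid_scheme \<Rightarrow> 'a \<Rightarrow> 'a \<Rightarrow> 'a \<Rightarrow> nat \<Rightarrow> 'a" where
  "iterated_commutator G x y z 0 = commutator G x y"
| "iterated_commutator G x y z (Suc n) = commutator G (iterated_commutator G x y z n) z"

lemma (in group) iterated_commutator_in:
  assumes "x \<in> carrier G" "y \<in> carrier G" "z \<in> carrier G"
  shows "iterated_commutator G x y z n \<in> lower_central G (n + 2)"
proof (induction n)
  case 0
  show ?case using commutator_in_lower_central[of 1 x y] assms by (simp add: numeral_2_eq_2)
next
  case (Suc n)
  then show ?case using commutator_in_lower_central[of "n + 2" _ z] assms by simp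
qed

lemma (in group_hom) iterated_commutator_hom_trivial:
  assumes xyz: "x \<in> carrier G" "y \<in> carrier G" "z \<in> carrier G" and 1: "h (commutator G x y) = \<one>\<^bsub>H\<^esub>"
  shows "h (iterated_commutator G x y z n) = \<one>\<^bsub>H\<^esub>"
proof (induction n)
  case 0
  show ?case using 1 by simp
next
  case (Suc n)
  have "iterated_commutator G x y z n \<in> carrier G"
    using G.iterated_commutator_in[OF xyz] G.lower_central_subset by blast
  then have "h (iterated_commutator G x y z (Suc n)) = commutator H (h (iterated_commutator G x y z n)) (h z)"
    using xyz by simp
  then show ?case using Suc xyz by simp
qed

text \<open>The iterated commutator acts as translation by (1 - e^X)^(n+1), with lowest coefficient
  (-1)^(n+1). Although y and z act alike they are kept apart: in the free group y is chosen so that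
  [x, y] dies in the free product.\<close>

lemma affine_functional_iterated_commutator:
  fixes G :: "('a, 'b) monoid_scheme"
  assumes G: "group G" and \<rho>: "\<rho> \<in> hom G affine_group"
    and xyz: "x \<in> carrier G" "y \<in> carrier G" "z \<in> carrier G"
    and val: "\<rho> x = (0, 1)" "\<rho> y = (1, 0)" "\<rho> z = (1, 0)"
  shows "affine_functional G \<rho> n (iterated_commutator G x y z n) \<noteq> 0"
proof -
  interpret group G by (rule G)
  have car: "iterated_commutator G x y z n \<in> carrier G" for n
    using iterated_commutator_in[OF xyz] lower_central_subset by blast
  have "\<rho> (iterated_commutator G x y z n) = (0, (1 - fps_exp 1) ^ (n + 1))"
  proof (induction n)
    case 0
    show ?case using affine_commutator[OF G \<rho> xyz(1,2)] val by simp
  next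
    case (Suc n)
    then show ?case using affine_commutator[OF G \<rho> car xyz(3), of n] val by simp
  qed
  moreover have "fps_nth ((1 - fps_exp 1) ^ (n + 1)) (n + 1) = (- 1 :: complex) ^ (n + 1)"
    by (subst startsby_zero_power_nth_same) simp_all
  ultimately show ?thesis
    using iterated_commutator_in[OF xyz, of n] unfolding affine_functional_def[OF G \<rho>] by simp
qed

section \<open>The free product of two free abelian groups of rank two\<close>

text \<open>Z^2 is carried over to \<open>nat\<close> by bijective encodings, since the groups to be
  exhibited have elements of type \<open>nat\<close>.\<close>

definition coord1 :: "nat \<Rightarrow> int" where "coord1 n = int_decode (fst (prod_decode n))"
definition coord2 :: "nat \<Rightarrow> int" where "coord2 n = int_decode (snd (prod_decode n))"
definition of_coords :: "int \<Rightarrow> int \<Rightarrow> nat" where "of_coords i j = prod_encode (int_encode i, int_encode j)"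

lemma coords [simp]: "coord1 (of_coords i j) = i" "coord2 (of_coords i j) = j" "of_coords (coord1 n) (coord2 n) = n"
  by (simp_all add: coord1_def coord2_def of_coords_def)

definition Z2 :: "nat monoid" where
  "Z2 = \<lparr>carrier = UNIV, monoid.mult = (\<lambda>m n. of_coords (coord1 m + coord1 n) (coord2 m + coord2 n)), one = of_coords 0 0\<rparr>"

lemma Z2_simps [simp]: "carrier Z2 = UNIV" "\<one>\<^bsub>Z2\<^esub> = of_coords 0 0"
  "m \<otimes>\<^bsub>Z2\<^esub> n = of_coords (coord1 m + coord1 n) (coord2 m + coord2 n)"
  by (simp_all add: Z2_def)

lemma comm_group_Z2: "comm_group Z2"
proof (rule comm_groupI)
  fix x assume "x \<in> carrier Z2"
  show "\<exists>y\<in>carrier Z2. y \<otimes>\<^bsub>Z2\<^esub> x = \<one>\<^bsub>Z2\<^esub>"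
    by (intro bexI[of _ "of_coords (- coord1 x) (- coord2 x)"]) auto
qed (simp_all add: add_ac)

interpretation Z2: comm_group Z2 by (rule comm_group_Z2)

lemma generate_Z2: "generate Z2 {of_coords 1 0, of_coords 0 1} = carrier Z2"
proof -
  let ?K = "generate Z2 {of_coords 1 0, of_coords 0 1}"
  interpret K: subgroup ?K Z2 by (rule Z2.generate_is_subgroup) simp
  have inv: "inv\<^bsub>Z2\<^esub> (of_coords i j) = of_coords (- i) (- j)" for i j
    by (rule Z2.inv_equality) simp_all
  have gens: "of_coords 1 0 \<in> ?K" "of_coords 0 1 \<in> ?K" by (auto intro: generate.incl)
  have gens': "of_coords (- 1) 0 \<in> ?K" "of_coords 0 (- 1) \<in> ?K"
    using K.m_inv_closed[OF gens(1)] K.m_inv_closed[OF gens(2)] by (simp_all add: inv)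
  have zero: "of_coords 0 0 \<in> ?K" using K.one_closed by simp
  have 1: "of_coords i 0 \<in> ?K" for i
  proof (induction i rule: int_induct[where k = 0])
    case (step1 i)
    then show ?case using K.m_closed[OF step1(2) gens(1)] by simp
  next
    case (step2 i)
    then show ?case using K.m_closed[OF step2(2) gens'(1)] by simp
  qed (rule zero)
  have 2: "of_coords 0 j \<in> ?K" for j
  proof (induction j rule: int_induct[where k = 0])
    case (step1 j)
    then show ?case using K.m_closed[OF step1(2) gens(2)] by simp
  next
    case (step2 j)
    then show ?case using K.m_closed[OF step2(2) gens'(2)] by simp
  qed (rule zero)
  have "n \<in> ?K" for n using K.m_closed[OF 1[of "coord1 n"] 2[of "coord2 n"]] by simp
  then show ?thesis by auto
qed

lemma finitely_generated_Z2: "finitely_generated_group Z2"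
  unfolding finitely_generated_group_def using generate_Z2 Z2.is_group
  by (intro conjI exI[of _ "{of_coords 1 0, of_coords 0 1}"]) auto

definition Z2_class :: "(nat \<Rightarrow> int) \<Rightarrow> nat list \<Rightarrow> complex" where
  "Z2_class c xs = (if length xs = 1 then of_int (c (hd xs)) else 0)"

lemma Z2_class_in: "Z2_class coord1 \<in> H1 Z2" "Z2_class coord2 \<in> H1 Z2"
  by (auto simp: H1_iff Z2_class_def)

lemma H1_Z2_nonzero: "H1 Z2 \<noteq> {0}"
proof
  assume "H1 Z2 = {0}"
  then have "Z2_class coord1 [of_coords 1 0] = 0" using Z2_class_in(1) by auto
  then show False by (simp add: Z2_class_def)
qed

interpretation Z2Z2: free_product_of_groups Z2 Z2 by unfold_locales

text \<open>Indices 0 and 1 generate the first factor and 2 and 3 the second, so generators 0 and 1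
  commute.\<close>

definition FP_gen :: "nat \<Rightarrow> (nat + nat) list set" where
  "FP_gen i = [Z2Z2.inl (of_coords 1 0), Z2Z2.inl (of_coords 0 1), Z2Z2.inr (of_coords 1 0), Z2Z2.inr (of_coords 0 1)] ! i"

lemma less_4_cases: "i < (4::nat) \<longleftrightarrow> i = 0 \<or> i = 1 \<or> i = 2 \<or> i = 3"
  by auto

lemma FP_gen_simps [simp]:
  "FP_gen 0 = Z2Z2.inl (of_coords 1 0)" "FP_gen (Suc 0) = Z2Z2.inl (of_coords 0 1)"
  "FP_gen 2 = Z2Z2.inr (of_coords 1 0)" "FP_gen 3 = Z2Z2.inr (of_coords 0 1)"
  by (simp_all add: FP_gen_def numeral_2_eq_2 numeral_3_eq_3)

lemma FP_gen_closed: "i < 4 \<Longrightarrow> FP_gen i \<in> carrier Z2Z2.FP"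
  by (auto simp: less_4_cases)

lemma FP_subgroup_generated:
  assumes K: "subgroup K Z2Z2.FP" and gen: "\<And>i. i < 4 \<Longrightarrow> FP_gen i \<in> K"
  shows "K = carrier Z2Z2.FP"
proof (rule Z2Z2.FP_generated[OF K])
  have g: "FP_gen 0 \<in> K" "FP_gen 1 \<in> K" "FP_gen 2 \<in> K" "FP_gen 3 \<in> K"
    using gen[of 0] gen[of 1] gen[of 2] gen[of 3] by simp_all
  fix x
  have "Z2Z2.inl ` generate Z2 {of_coords 1 0, of_coords 0 1} = generate Z2Z2.FP {FP_gen 0, FP_gen 1}"
    using Z2Z2.inl.generate_img[of "{of_coords 1 0, of_coords 0 1}"] by simp
  also have "\<dots> \<subseteq> K" using g by (intro Z2Z2.FP.generate_subgroup_incl[OF _ K]) simp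
  finally show "Z2Z2.inl x \<in> K" unfolding generate_Z2 by auto
  have "Z2Z2.inr ` generate Z2 {of_coords 1 0, of_coords 0 1} = generate Z2Z2.FP {FP_gen 2, FP_gen 3}"
    using Z2Z2.inr.generate_img[of "{of_coords 1 0, of_coords 0 1}"] by simp
  also have "\<dots> \<subseteq> K" using g by (intro Z2Z2.FP.generate_subgroup_incl[OF _ K]) simp
  finally show "Z2Z2.inr x \<in> K" unfolding generate_Z2 by auto
qed

lemma finitely_generated_FP: "finitely_generated_group Z2Z2.FP"
  unfolding finitely_generated_group_def
proof (intro conjI exI[of _ "FP_gen ` {..<4}"])
  have sub: "FP_gen ` {..<4} \<subseteq> carrier Z2Z2.FP" using FP_gen_closed by auto
  then show "FP_gen ` {..<4} \<subseteq> carrier Z2Z2.FP" .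
  show "generate Z2Z2.FP (FP_gen ` {..<4}) = carrier Z2Z2.FP"
    by (rule FP_subgroup_generated[OF Z2Z2.FP.generate_is_subgroup[OF sub]]) (auto intro: generate.incl)
qed (auto intro: Z2Z2.group_FP)

lemma FP_dual_class:
  assumes "i < 4"
  obtains f where "f \<in> H1 Z2Z2.FP" "\<And>j. j < 4 \<Longrightarrow> f [FP_gen j] = (if j = i then 1 else 0)"
proof -
  have zero: "0 \<in> H1 Z2" by (rule cfun.subspace_0[OF subspace_H1])
  define a1 where "a1 = (if i = 0 then Z2_class coord1 else if i = 1 then Z2_class coord2 else 0)"
  define a2 where "a2 = (if i = 2 then Z2_class coord1 else if i = 3 then Z2_class coord2 else 0)"
  have "a1 \<in> H1 Z2" "a2 \<in> H1 Z2" using Z2_class_in zero by (auto simp: a1_def a2_def)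
  then obtain f where f: "f \<in> H1 Z2Z2.FP" "H1_pullback Z2 Z2Z2.inl f = a1" "H1_pullback Z2 Z2Z2.inr f = a2"
    using Z2Z2.H1_FP_exists by blast
  have "f [Z2Z2.inl x] = a1 [x]" "f [Z2Z2.inr x] = a2 [x]" for x
    using fun_cong[OF f(2), of "[x]"] fun_cong[OF f(3), of "[x]"] by (simp_all add: H1_pullback_apply)
  then have "f [FP_gen j] = (if j = i then 1 else 0)" if "j < 4" for j
    using that assms by (auto simp: less_4_cases a1_def a2_def Z2_class_def)
  with f(1) show thesis by (rule that)
qed

text \<open>A flag of coordinate subspaces from C 0 to C 4, the whole space; the classes dual to the
  generators make it strict. This lower bound suffices, as \<open>chen_rank_FP_less\<close> treats
  every m from 4 on.\<close>

lemma zariski_dim_H1_FP: "enat 4 \<le> zariski_dim (H1 Z2Z2.FP) (H1 Z2Z2.FP)"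
proof -
  let ?V = "H1 Z2Z2.FP"
  define C where "C i = {f \<in> ?V. \<forall>j. i \<le> j \<and> j < 4 \<longrightarrow> f [FP_gen j] = 0}" for i :: nat
  show ?thesis
  proof (rule zariski_dim_ge)
    fix i :: nat
    let ?Q = "(\<lambda>j (f :: (nat + nat) list set list \<Rightarrow> complex). f [FP_gen j]) ` {i..<4}"
    have "?Q \<subseteq> polynomial_functions" by (auto intro!: polynomial_functions.linear linear_functionalI)
    then have "algebraic_set ?V {f \<in> ?V. \<forall>p\<in>?Q. p f = 0}" by (rule algebraic_zeros)
    moreover have "{f \<in> ?V. \<forall>p\<in>?Q. p f = 0} = C i" by (auto simp: C_def)
    ultimately have "algebraic_set ?V (C i)" by simp
    moreover have "cfun.subspace (C i)"
      using subspace_H1[of Z2Z2.FP] by (auto simp: cfun.subspace_def C_def)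
    ultimately show "irreducible_set ?V (C i) \<and> C i \<subseteq> ?V" using irreducible_subspace by (auto simp: C_def)
  next
    fix i :: nat assume i: "i < 4"
    obtain f where f: "f \<in> ?V" "\<And>j. j < 4 \<Longrightarrow> f [FP_gen j] = (if j = i then 1 else 0)"
      using FP_dual_class[OF i] by blast
    have "f \<in> C (Suc i)" using f by (auto simp: C_def)
    moreover have "f \<notin> C i" using f i by (auto simp: C_def)
    ultimately show "C i \<subset> C (Suc i)" by (auto simp: C_def)
  qed
qed

text \<open>The resonance variety is a linear space, hence irreducible and its own single component;
  its dimension is left undetermined.\<close>

lemma resonance_FP_count:
  "resonance_count Z2Z2.FP m = (if zariski_dim (H1 Z2Z2.FP) (H1 Z2Z2.FP) = enat m then 1 else 0)"
proof -
  let ?V = "H1 Z2Z2.FP"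
  have "irreducible_set ?V ?V" by (rule irreducible_subspace[OF subspace_H1 algebraic_self])
  moreover have "Z \<subseteq> ?V" if "irreducible_set ?V Z" for Z
    using that algebraic_subset irreducible_algebraic by blast
  ultimately have "irreducible_components ?V ?V = {?V}" unfolding irreducible_components_def by blast
  then have "{Z \<in> irreducible_components ?V ?V. zariski_dim ?V Z = enat m} =
      (if zariski_dim ?V ?V = enat m then {?V} else {})" by auto
  moreover have "resonance Z2Z2.FP = ?V"
    by (rule Z2Z2.resonance_FP[OF finitely_generated_FP H1_Z2_nonzero H1_Z2_nonzero])
  ultimately show ?thesis unfolding resonance_count_def by simp
qed

lemma chen_rank_FP_pos: "chen_rank Z2Z2.FP (n + 2) > 0"
proof -
  \<comment> \<open>One factor acts by constant translations and the other by multiplication with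
    e^(sX), each through its first coordinate. Both families commute among themselves, so the
    universal property applies.\<close>
  have "(\<lambda>x. (0, fps_const (of_int (coord1 x)))) \<in> hom Z2 affine_group"
    by (rule homI) (simp_all add: fps_const_add[symmetric] del: fps_const_add)
  moreover have "(\<lambda>x. (of_int (coord1 x), 0)) \<in> hom Z2 affine_group"
    by (rule homI) simp_all
  ultimately obtain \<rho> where \<rho>: "\<rho> \<in> hom Z2Z2.FP affine_group"
    "\<And>x. x \<in> carrier Z2 \<Longrightarrow> \<rho> (Z2Z2.inl x) = (0, fps_const (of_int (coord1 x)))"
    "\<And>x. x \<in> carrier Z2 \<Longrightarrow> \<rho> (Z2Z2.inr x) = (of_int (coord1 x), 0)"
    using Z2Z2.FP_hom[OF group_affine_group] by blast
  have "affine_functional Z2Z2.FP \<rho> n (iterated_commutator Z2Z2.FP (FP_gen 0) (FP_gen 2) (FP_gen 2) n) \<noteq> 0"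
    using FP_gen_closed[of 0] FP_gen_closed[of 2] \<rho>(2,3)
    by (intro affine_functional_iterated_commutator[OF Z2Z2.group_FP \<rho>(1)]) simp_all
  then have "affine_functional Z2Z2.FP \<rho> n \<noteq> 0" by auto
  then show ?thesis
    using chen_rank_pos[OF finitely_generated_FP _ affine_functional_in[OF Z2Z2.group_FP \<rho>(1)]] by simp
qed

text \<open>The kernel of the projection from the free group contains \<open>[x0, x1]\<close>, hence also the
  commutators \<open>[x0, x1, x2, \<dots>, x2]\<close>, which survive in every Chen quotient of the free group.\<close>

lemma chen_rank_FP_less:
  fixes m :: nat
  assumes m: "m \<ge> 4"
  shows "chen_rank Z2Z2.FP (n + 2) < chen_rank (free_group {..<m}) (n + 2)"
proof -
  let ?F = "free_group {..<m}"
  let ?x = "free_generator {..<m}"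
  have x: "?x i \<in> carrier ?F" if "i < m" for i using free_generator_closed[of i "{..<m}"] that by simp
  have x012: "?x 0 \<in> carrier ?F" "?x 1 \<in> carrier ?F" "?x 2 \<in> carrier ?F" using x m by simp_all
  \<comment> \<open>Generators beyond the first four go to 1, which keeps \<open>h\<close> onto for
    every m from 4 on.\<close>
  obtain h where h: "h \<in> hom ?F Z2Z2.FP"
    "\<And>i. i \<in> {..<m} \<Longrightarrow> h (?x i) = (if i < 4 then FP_gen i else \<one>\<^bsub>Z2Z2.FP\<^esub>)"
  proof (rule free_group_hom[OF Z2Z2.group_FP])
    show "(if i < 4 then FP_gen i else \<one>\<^bsub>Z2Z2.FP\<^esub>) \<in> carrier Z2Z2.FP" if "i \<in> {..<m}" for i
      using FP_gen_closed by simp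
  qed blast
  interpret h: group_hom ?F Z2Z2.FP h
    by (intro group_hom.intro group_hom_axioms.intro group_free_group Z2Z2.group_FP h(1))
  have surj: "h ` carrier ?F = carrier Z2Z2.FP"
  proof (rule FP_subgroup_generated)
    show "subgroup (h ` carrier ?F) Z2Z2.FP" by (rule h.img_is_subgroup)
    fix i :: nat assume "i < 4"
    then have "FP_gen i = h (?x i)" "?x i \<in> carrier ?F" using h(2) x m by simp_all
    then show "FP_gen i \<in> h ` carrier ?F" by (rule image_eqI)
  qed
  have "h (commutator ?F (?x 0) (?x 1)) = commutator Z2Z2.FP (FP_gen 0) (FP_gen 1)"
    using h.hom_commutator[OF x012(1,2)] h(2) m by simp
  also have "\<dots> = Z2Z2.inl (commutator Z2 (of_coords 1 0) (of_coords 0 1))"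
    using Z2Z2.inl.hom_commutator[of "of_coords 1 0" "of_coords 0 1"] by simp
  also have "\<dots> = \<one>\<^bsub>Z2Z2.FP\<^esub>"
    using Z2.commutator_eq_one[of "of_coords 1 0" "of_coords 0 1"] Z2Z2.inl.hom_one by (simp del: Z2_simps(2,3))
  finally have comm: "h (commutator ?F (?x 0) (?x 1)) = \<one>\<^bsub>Z2Z2.FP\<^esub>" .
  \<comment> \<open>This representation does not factor through \<open>h\<close>: the commutator of
    generators 0 and 1 acts as translation by 1 - e^X.\<close>
  obtain \<rho> where \<rho>: "\<rho> \<in> hom ?F affine_group" "\<And>i. i \<in> {..<m} \<Longrightarrow> \<rho> (?x i) = (if i = 0 then (0, 1) else (1, 0))"
    by (rule free_group_hom[OF group_affine_group, of "{..<m}" "\<lambda>i. if i = 0 then (0, 1) else (1, 0)"]) auto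
  let ?w = "iterated_commutator ?F (?x 0) (?x 1) (?x 2) n"
  show ?thesis
  proof (rule h.chen_rank_surj_less[OF finitely_generated_free_group finitely_generated_FP _ surj])
    show "affine_functional ?F \<rho> n \<in> chen_functionals ?F (n + 2)"
      by (rule affine_functional_in[OF group_free_group \<rho>(1)])
    show "?w \<in> lower_central ?F (n + 2)" by (rule h.G.iterated_commutator_in[OF x012])
    show "h ?w = \<one>\<^bsub>Z2Z2.FP\<^esub>" by (rule h.iterated_commutator_hom_trivial[OF x012 comm])
    show "affine_functional ?F \<rho> n ?w \<noteq> 0"
      using m by (intro affine_functional_iterated_commutator[OF group_free_group \<rho>(1) x012] \<rho>(2)[THEN trans]) auto
  qed simp_all
qed

theorem not_chen_ranks_formula_FP: "\<not> chen_ranks_formula Z2Z2.FP"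
proof
  let ?d = "zariski_dim (H1 Z2Z2.FP) (H1 Z2Z2.FP)"
  assume "chen_ranks_formula Z2Z2.FP"
  then obtain N where N: "\<And>k. k \<ge> N \<Longrightarrow> chen_rank Z2Z2.FP k =
      (\<Sum>m | m \<ge> 2 \<and> resonance_count Z2Z2.FP m \<noteq> 0. resonance_count Z2Z2.FP m * chen_rank (free_group {..<m}) k)"
    unfolding chen_ranks_formula_def eventually_sequentially by blast
  have I: "{m. m \<ge> 2 \<and> resonance_count Z2Z2.FP m \<noteq> 0} = {m. m \<ge> 2 \<and> ?d = enat m}"
    by (auto simp: resonance_FP_count)
  \<comment> \<open>The index N + 2 lies in the range of the formula and has the form n + 2 in which
    the Chen ranks were estimated.\<close>
  have "chen_rank Z2Z2.FP (N + 2) =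
      (\<Sum>m | m \<ge> 2 \<and> ?d = enat m. resonance_count Z2Z2.FP m * chen_rank (free_group {..<m}) (N + 2))"
    using N[of "N + 2"] unfolding I by simp
  also have "\<dots> = (\<Sum>m | m \<ge> 2 \<and> ?d = enat m. chen_rank (free_group {..<m}) (N + 2))"
    by (rule sum.cong) (auto simp: resonance_FP_count)
  finally have eq: "chen_rank Z2Z2.FP (N + 2) =
      (\<Sum>m | m \<ge> 2 \<and> ?d = enat m. chen_rank (free_group {..<m}) (N + 2))" .
  show False
  proof (cases "?d")
    case (enat m)
    then have m: "m \<ge> 4" using zariski_dim_H1_FP by simp
    then have "{m. m \<ge> 2 \<and> ?d = enat m} = {m}" using enat by auto
    then show False using eq chen_rank_FP_less[OF m, of N] by simp
  next
    \<comment> \<open>No m matches, so the right-hand side is an empty sum, against the positivity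
      of the left-hand side.\<close>
    case infinity
    then show False using eq chen_rank_FP_pos[of N] by simp
  qed
qed

theorem proposition1p4:
  shows "(\<forall>(G1 :: ('a, 'c) monoid_scheme) (G2 :: ('b, 'd) monoid_scheme).
            finitely_generated_group G1 \<and> finitely_generated_group G2 \<and>
            chen_ranks_formula G1 \<and> chen_ranks_formula G2 \<longrightarrow>
            chen_ranks_formula (G1 \<times>\<times> G2))
       \<and> (\<exists>(G1 :: nat monoid) (G2 :: nat monoid).
            finitely_generated_group G1 \<and> finitely_generated_group G2 \<and>
            chen_ranks_formula G1 \<and> chen_ranks_formula G2 \<and>
            \<not> chen_ranks_formula (free_product G1 G2))"
  using chen_ranks_formula_DirProd not_chen_ranks_formula_FP finitely_generated_Z2
    chen_ranks_formula_comm_group[OF comm_group_Z2 finitely_generated_Z2]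
  by blast

end
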